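(* (a) If $Z$ is a near UFD or a Dedekind domain, then the starred Primitive Specialization Hypothesis holds for $Z$; i.e. $\mathrm{PriSpe}^{\star}(k,s)$ holds for all integers $k,s\geq 1$. (b) If $Z$ is a near UFD, then both the coprime Schinzel Hypothesis and the Primitive Specialization Hypothesis hold for $Z$; i.e. $\mathrm{CopSch}(k,s)$ and $\mathrm{PriSpe}(k,n,s)$ hold for all integers $k,n,s\geq 1$. (c) If $Z$ is a Dedekind domain, then the Primitive Specialization Hypothesis holds with $k=1$ and $n,s\geq 1$ (i.e. $\mathrm{PriSpe}(1,n,s)$ holds for all $n,s\geq 1$), and the coprime Schinzel Hypothesis holds if in addition $s=1$ (i.e. $\mathrm{CopSch}(1,1)$ holds).
   Context: Let $Z$ be an integral domain with fraction field $Q$; $\underline t=(t_1,\ldots,t_k)$, $\underline y=(y_1,\ldots,y_n)$ are tuples of variables. Near UFD: an integral domain $Z$ such that every nonzero element of $Z$ has only finitely many prime divisors (up to multiplication by units), and every element of $Z$ that is not a unit has at least one prime divisor. Elements of an integral domain are coprime if they have no common divisor other than units. A polynomial in $\underline y$ with coefficients in an integral domain $A$ is primitive with respect to $A$ if its coefficients are coprime in $A$ (the zero polynomial is not primitive). A polynomial $P(\underline t,\underline y)\in Z[\underline t,\underline y]$ is primitive with respect to $Q[\underline t]$ if, viewed as a polynomial in $\underline y$, its coefficients are coprime in $Q[\underline t]$. A non-unit $a\in Z$, $a\neq 0$, is a fixed divisor of $P$ with respect to $\underline t$ if $P(\underline m,\underline y)\equiv 0\pmod a$ for every $\underline m\in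 Z^k$; $\mathcal F_{\underline t}(P)$ is the set of fixed divisors; a fixed prime divisor is a fixed divisor that is a prime element of $Z$. An element of $Z$ divides a polynomial over $Z$ if it divides all its coefficients in $Z$. $\mathrm{CopSch}(k,s)$: Consider $s$ sets $\{P_{11},\ldots,P_{1\ell_1}\},\ldots,\{P_{s1},\ldots,P_{s\ell_s}\}$ of nonzero polynomials in $Z[\underline t]$ such that $\ell_i\geq 2$ and $P_{i1},\ldots,P_{i\ell_i}$ are coprime in $Q[\underline t]$, for each $i=1,\ldots,s$. Assume further that for every non-unit $a\in Z$ there exists $\underline m\in Z^k$ such that, for each $i=1,\ldots,s$, the values $P_{i1}(\underline m),\ldots,P_{i\ell_i}(\underline m)$ are not all divisible by $a$. Then there exists $\underline m\in Z^k$ such that, for each $i=1,\ldots,s$, the values $P_{i1}(\underline m),\ldots,P_{i\ell_i}(\underline m)$ are coprime in $Z$. $\mathrm{PriSpe}(k,n,s)$: Let $P_1(\underline t,\underline y),\ldots,P_s(\underline t,\underline y)\in Z[\underline t,\underline y]$ be $s$ nonzero polynomials, primitive with respect to $Q[\underline t]$ and such that $\mathcal F_{\underline t}(P_1\cdots P_s)=\emptyset$. Then there exists $\underline m\in Z^k$ such that $P_1(\underline m,\underline y),\ldots,P_s(\underline m,\underline y)$ are primitive with respect to $Z$. $\mathrm{PriSpe}^{\star}(k,s)$ (defined for $Z$ such that every nonzero $a\in Z$ has only finitely many prime divisors modulo units): Let $n\geq 1$ and let $P_1(\underline t,\underline y),\ldots,P_s(\underline t,\underline y)\in Z[\underline t,\underline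 y]$ be $s$ nonzero polynomials, primitive with respect to $Q[\underline t]$ and such that the product $P_1\cdots P_s$ has no fixed prime divisor in $Z$ with respect to $\underline t$. Let $P_0\in Z[\underline t]$, $P_0\neq 0$. Then there exist $(m_1,\ldots,m_{k-1})\in Z^{k-1}$ and an arithmetic progression $\tau_k=(\omega_k\ell+\alpha_k)_{\ell\in Z}$ with $\omega_k,\alpha_k\in Z$, $\omega_k\neq 0$, such that for all but finitely many $m_k\in\tau_k$, the polynomials $P_1(m_1,\ldots,m_k,\underline y),\ldots,P_s(m_1,\ldots,m_k,\underline y)$ have no prime divisors in $Z$, and $P_0(m_1,\ldots,m_k)\neq 0$. (For $k=1$, existence of $(m_1,\ldots,m_{k-1})$ is not requested.) The coprime Schinzel Hypothesis, the Primitive Specialization Hypothesis and the starred Primitive Specialization Hypothesis hold for $Z$ if the corresponding property holds for all integers $k,n,s\geq 1$ (respectively $k,s\geq 1$). *)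

theory Defs
  imports
    "HOL-Library.Poly_Mapping"
    "HOL-Computational_Algebra.Computational_Algebra"
    "HOL-Algebra.Algebraic_Closure_Type"
begin

section \<open>The domain\<close>

text \<open>
  The domain \<open>Z\<close> is a type \<open>'a\<close> of class \<^class>\<open>idom\<close>, and its fraction field \<open>Q\<close> is
  \<^typ>\<open>'a fract\<close>.
\<close>

text \<open>
  In the first clause, the set \<open>{u * p | u unit}\<close> is the class of \<open>p\<close> up to multiplication by
  units.  The second clause includes \<open>x = 0\<close>; since prime elements are nonzero non-units,
  this excludes fields.
\<close>

definition near_UFD :: "'a::idom itself \<Rightarrow> bool" where
  "near_UFD Z \<longleftrightarrow>
     (\<forall>x::'a. x \<noteq> 0 \<longrightarrow>
        finite ((\<lambda>p. {u * p | u. u dvd 1}) ` {p. prime_elem p \<and> p dvd x})) \<and>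
     (\<forall>x::'a. \<not> x dvd 1 \<longrightarrow> (\<exists>p. prime_elem p \<and> p dvd x))"

text \<open>
  Noetherian, integrally closed in the fraction field, and every nonzero prime ideal is maximal.
  Fields are not excluded.
\<close>

definition dedekind_domain :: "'a::idom itself \<Rightarrow> bool" where
  "dedekind_domain Z \<longleftrightarrow>
     noetherian_ring (ring_of_type_algebra :: 'a ring) \<and>
     (\<forall>x::'a fract.
        (\<exists>f :: 'a poly. lead_coeff f = 1 \<and> poly (map_poly to_fract f) x = 0) \<longrightarrow>
        x \<in> range to_fract) \<and>
     (\<forall>I. primeideal I (ring_of_type_algebra :: 'a ring) \<and> I \<noteq> {0} \<longrightarrow>
        maximalideal I (ring_of_type_algebra :: 'a ring))"

section \<open>Polynomials in several variables\<close>

text \<open>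
  A polynomial maps monomials to coefficients, and a monomial maps variables to exponents.
  Variables are numbered from \<open>0\<close>: the tuple \<open>t\<close> has the indices \<open>0, \<dots>, k - 1\<close>.
\<close>

type_synonym 'a mpoly = "(nat \<Rightarrow>\<^sub>0 nat) \<Rightarrow>\<^sub>0 'a"

definition mpolys :: "nat \<Rightarrow> 'a::zero mpoly set" where
  "mpolys k = {p. \<forall>e \<in> Poly_Mapping.keys p. Poly_Mapping.keys e \<subseteq> {..<k}}"

text \<open>
  \<open>Z[t,y]\<close> is represented as \<open>Z[t][y]\<close>: the outer monomials are in \<open>y\<close>, the coefficients
  in \<open>Z[t]\<close>.
\<close>

definition mpolys2 :: "nat \<Rightarrow> nat \<Rightarrow> 'a::zero mpoly mpoly set" where
  "mpolys2 k n = {P \<in> mpolys n. \<forall>e. Poly_Mapping.lookup P e \<in> mpolys k}"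

text \<open>
  A point of \<open>Z\<^sup>k\<close> is given by a function \<open>m :: nat \<Rightarrow> 'a\<close>, of which only the values
  below \<open>k\<close> matter for polynomials in \<open>mpolys k\<close>; see \<open>eval_mpoly_cong\<close>.
\<close>

definition eval_mpoly :: "(nat \<Rightarrow> 'a::comm_semiring_1) \<Rightarrow> 'a mpoly \<Rightarrow> 'a" where
  "eval_mpoly m p =
     (\<Sum>e \<in> Poly_Mapping.keys p.
        Poly_Mapping.lookup p e * (\<Prod>i \<in> Poly_Mapping.keys e. m i ^ Poly_Mapping.lookup e i))"

lemma eval_mpoly_cong:
  assumes "p \<in> mpolys k" and "\<And>i. i < k \<Longrightarrow> m i = m' i"
  shows "eval_mpoly m p = eval_mpoly m' p"
  unfolding eval_mpoly_def
proof (rule sum.cong[OF refl])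
  fix e assume "e \<in> Poly_Mapping.keys p"
  then have "m i = m' i" if "i \<in> Poly_Mapping.keys e" for i
    using assms that by (auto simp: mpolys_def)
  then show "Poly_Mapping.lookup p e * (\<Prod>i \<in> Poly_Mapping.keys e. m i ^ Poly_Mapping.lookup e i)
    = Poly_Mapping.lookup p e * (\<Prod>i \<in> Poly_Mapping.keys e. m' i ^ Poly_Mapping.lookup e i)"
    by simp
qed

text \<open>The polynomial \<open>P(m,y)\<close>:\<close>

definition specialize :: "(nat \<Rightarrow> 'a::comm_semiring_1) \<Rightarrow> 'a mpoly mpoly \<Rightarrow> 'a mpoly" where
  "specialize m P = Poly_Mapping.map (eval_mpoly m) P"

lemma lookup_specialize:
  "Poly_Mapping.lookup (specialize m P) e = eval_mpoly m (Poly_Mapping.lookup P e)"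
  by (simp add: specialize_def map.rep_eq when_def eval_mpoly_def)

definition to_fract_mpoly :: "'a::idom mpoly \<Rightarrow> 'a fract mpoly" where
  "to_fract_mpoly p = Poly_Mapping.map to_fract p"

definition to_fract_mpoly2 :: "'a::idom mpoly mpoly \<Rightarrow> 'a fract mpoly mpoly" where
  "to_fract_mpoly2 P = Poly_Mapping.map to_fract_mpoly P"

section \<open>Coprimality, primitivity and fixed divisors\<close>

text \<open>
  The elements of \<open>S\<close> are coprime in the subring \<open>R\<close>: divisors, cofactors and
  inverses are all taken in \<open>R\<close>.
\<close>

definition coprime_in :: "'b::comm_semiring_1 set \<Rightarrow> 'b set \<Rightarrow> bool" where
  "coprime_in R S \<longleftrightarrow>
     (\<forall>d \<in> R. (\<forall>x \<in> S. \<exists>c \<in> R. x = d * c) \<longrightarrow> (\<exists>c \<in> R. d * c = 1))"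

text \<open>
  The coefficient \<open>0\<close> of absent monomials belongs to the range and does not affect coprimality;
  the zero polynomial is not primitive because \<open>0\<close> divides all its coefficients.
\<close>

definition primitive_in :: "'b::comm_semiring_1 set \<Rightarrow> 'b mpoly \<Rightarrow> bool" where
  "primitive_in R P \<longleftrightarrow> coprime_in R (range (Poly_Mapping.lookup P))"

definition divides_mpoly :: "'a::comm_semiring_1 \<Rightarrow> 'a mpoly \<Rightarrow> bool" where
  "divides_mpoly a p \<longleftrightarrow> (\<forall>e. a dvd Poly_Mapping.lookup p e)"

definition fixed_divisors :: "'a::idom mpoly mpoly \<Rightarrow> 'a set" where
  "fixed_divisors P = {a. a \<noteq> 0 \<and> \<not> a dvd 1 \<and> (\<forall>m. divides_mpoly a (specialize m P))}"

section \<open>The three properties\<close>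

definition CopSch :: "'a::idom itself \<Rightarrow> nat \<Rightarrow> nat \<Rightarrow> bool" where
  "CopSch Z k s \<longleftrightarrow>
     (\<forall>(l :: nat \<Rightarrow> nat) (P :: nat \<Rightarrow> nat \<Rightarrow> 'a mpoly).
        (\<forall>i<s. l i \<ge> 2 \<and>
           (\<forall>j<l i. P i j \<in> mpolys k \<and> P i j \<noteq> 0) \<and>
           coprime_in (mpolys k) ((\<lambda>j. to_fract_mpoly (P i j)) ` {..<l i})) \<and>
        (\<forall>a. \<not> a dvd 1 \<longrightarrow>
           (\<exists>m. \<forall>i<s. \<not> (\<forall>j<l i. a dvd eval_mpoly m (P i j))))
        \<longrightarrow>
        (\<exists>m. \<forall>i<s. coprime_in UNIV ((\<lambda>j. eval_mpoly m (P i j)) ` {..<l i})))"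

definition PriSpe :: "'a::idom itself \<Rightarrow> nat \<Rightarrow> nat \<Rightarrow> nat \<Rightarrow> bool" where
  "PriSpe Z k n s \<longleftrightarrow>
     (\<forall>P :: nat \<Rightarrow> 'a mpoly mpoly.
        (\<forall>i<s. P i \<in> mpolys2 k n \<and> P i \<noteq> 0 \<and>
           primitive_in (mpolys k) (to_fract_mpoly2 (P i))) \<and>
        fixed_divisors (\<Prod>i<s. P i) = {}
        \<longrightarrow>
        (\<exists>m. \<forall>i<s. primitive_in UNIV (specialize m (P i))))"

text \<open>
  With variables numbered from \<open>0\<close>, the last variable has index \<open>k - 1\<close>; the value
  of \<open>m\<close> there is replaced by the element \<open>x\<close> of the arithmetic progression.
\<close>

definition PriSpe_star :: "'a::idom itself \<Rightarrow> nat \<Rightarrow> nat \<Rightarrow> bool" where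
  "PriSpe_star Z k s \<longleftrightarrow>
     (\<forall>n\<ge>1. \<forall>(P :: nat \<Rightarrow> 'a mpoly mpoly) (P0 :: 'a mpoly).
        (\<forall>i<s. P i \<in> mpolys2 k n \<and> P i \<noteq> 0 \<and>
           primitive_in (mpolys k) (to_fract_mpoly2 (P i))) \<and>
        \<not> (\<exists>p \<in> fixed_divisors (\<Prod>i<s. P i). prime_elem p) \<and>
        P0 \<in> mpolys k \<and> P0 \<noteq> 0
        \<longrightarrow>
        (\<exists>(m :: nat \<Rightarrow> 'a) (\<omega> :: 'a) (\<alpha> :: 'a). \<omega> \<noteq> 0 \<and>
           finite {x \<in> range (\<lambda>l. \<omega> * l + \<alpha>).
             \<not> ((\<forall>i<s. \<not> (\<exists>p. prime_elem p \<and>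
                     divides_mpoly p (specialize (m(k - 1 := x)) (P i)))) \<and>
                eval_mpoly (m(k - 1 := x)) P0 \<noteq> 0)}))"

end

theory Submission
  imports Defs
begin

text \<open>
  \<^bold>\<open>From polynomials to families.\<close> A polynomial in \<open>y\<close> over \<open>Z[t]\<close> enters all three properties only
  through the set of its coefficients, so the object of study is a family \<open>C 0, \<dots>, C (s - 1)\<close> of finite
  sets in \<open>Z[t]\<close>, each coprime in \<open>Q[t]\<close>.  A prime \<open>p\<close> divides no specialized set at \<open>m\<close> if every \<open>C i\<close>
  contains some \<open>f\<close> with \<open>p\<close> not dividing \<open>f(m)\<close> (\<open>nonvanishing_mod\<close>).  A prime which is not a fixed
  divisor of the product admits such an \<open>m\<close>, because each coefficient of a product is a sum of products
  of coefficients (\<open>lookup_prod_in_ideal\<close>).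

  \<^bold>\<open>One variable.\<close> Coprime univariate sets satisfy a Bezout relation with a right-hand side \<open>\<delta> \<noteq> 0\<close> in \<open>Z\<close>,
  so only the finitely many primes that divide \<open>\<delta>\<close> can divide a specialized set.  They are treated one
  after the other: if \<open>p\<close> does not divide \<open>\<omega>\<close>, then \<open>m\<close> can be moved within its class modulo \<open>\<omega>\<close> to a
  point that is good for \<open>p\<close> (\<open>avoid_prime_in_progression\<close>), and \<open>\<omega>\<close> is then replaced by \<open>\<omega> * p\<close>.  This
  takes the place of the Chinese remainder theorem, as distinct primes of a near UFD
  need not be comaximal.  The result is a whole arithmetic progression.

  \<^bold>\<open>Several variables.\<close> The induction removes the last variable (\<open>specialize_last_variable\<close>).  Gauss's
  lemma provides the Bezout relation with \<open>\<delta>\<close> now a nonzero polynomial in the other variables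
  (\<open>coprime_eliminant\<close>), and shows that the coefficients with respect to the last variable are
  again coprime (\<open>coprime_coefficients\<close>).  The induction hypothesis applied to these coefficients gives
  values of the other variables at which \<open>\<delta>\<close> does not vanish and no prime divides all the coefficients.
  A prime could still be a fixed divisor of the remaining univariate problem, but only if it has
  few residue classes, at most as many as a degree bound \<open>D\<close>.  Such small primes divide the product of
  the differences of any \<open>D + 1\<close> distinct elements of \<open>Z\<close>, so they are finitely many, and
  they are put into the modulus \<open>\<omega>\<close> before the induction hypothesis is applied.

  \<^bold>\<open>Near UFDs and Dedekind domains.\<close> In both, a nonzero element has finitely many prime
  divisors, which proves part (a).  In a near UFD a non-unit has a prime divisor, so that part (b) is a case
  of the same result.  In a Dedekind domain a common divisor need not have a prime divisor, and
  part (c) compares the ideals \<open>I(m)\<close> generated by the values at \<open>m\<close>.  For any two of them, \<open>I(x)\<close> and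
  \<open>I(y)\<close>, some \<open>I(m)\<close> contains both: take \<open>m = e * x + (1 - e) * y\<close> where \<open>e\<close> is idempotent modulo a common
  nonzero element \<open>\<delta>\<close> of these ideals, is \<open>1\<close> only at primes where \<open>I(x)\<close> locally contains \<open>I(y)\<close>, and \<open>0\<close> only where
  the converse holds (\<open>comparable_ideals\<close>, \<open>idempotent_modulo\<close>).  By the ascending chain condition there is then a largest value ideal (\<open>largest_value_ideal\<close>), and a common divisor
  of the values at that \<open>m\<close> divides the values everywhere.
\<close>

section \<open>Unique factorization in polynomial rings\<close>

text \<open>
  The cofactor is taken in \<open>A\<close>, so that \<open>div_in A a 1\<close> says that \<open>a\<close> is a unit of \<open>A\<close>.
\<close>

definition div_in :: "'r::comm_ring_1 set \<Rightarrow> 'r \<Rightarrow> 'r \<Rightarrow> bool" where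
  "div_in A a b \<longleftrightarrow> (\<exists>c\<in>A. b = a * c)"

definition irred_in :: "'r::comm_ring_1 set \<Rightarrow> 'r \<Rightarrow> bool" where
  "irred_in A p \<longleftrightarrow> p \<in> A \<and> p \<noteq> 0 \<and> \<not> div_in A p 1 \<and>
     (\<forall>a\<in>A. \<forall>b\<in>A. p = a * b \<longrightarrow> div_in A a 1 \<or> div_in A b 1)"

text \<open>
  Unique factorization in the form that passes most easily to polynomials: irreducible elements are
  prime, and an additive length which vanishes exactly on units serves as the induction measure.
  The ring is a subset of a type because the number of variables, on which the induction
  runs, cannot be part of the type.
\<close>

definition ufd_in :: "'r::comm_ring_1 set \<Rightarrow> bool" where
  "ufd_in A \<longleftrightarrow>
     (\<exists>N :: 'r \<Rightarrow> nat.
        (\<forall>a\<in>A. \<forall>b\<in>A. a \<noteq> 0 \<longrightarrow> b \<noteq> 0 \<longrightarrow> N (a * b) = N a + N b) \<and>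
        (\<forall>a\<in>A. a \<noteq> 0 \<longrightarrow> (N a = 0 \<longleftrightarrow> div_in A a 1))) \<and>
     (\<forall>p. irred_in A p \<longrightarrow>
        (\<forall>a\<in>A. \<forall>b\<in>A. div_in A p (a * b) \<longrightarrow> div_in A p a \<or> div_in A p b))"

definition polys :: "'r::comm_ring_1 set \<Rightarrow> 'r poly set" where
  "polys A = {f. \<forall>i. coeff f i \<in> A}"

locale subring_set =
  fixes A :: "'r::idom set"
  assumes one_mem: "1 \<in> A"
    and diff_mem: "a \<in> A \<Longrightarrow> b \<in> A \<Longrightarrow> a - b \<in> A"
    and mult_mem: "a \<in> A \<Longrightarrow> b \<in> A \<Longrightarrow> a * b \<in> A"
begin

lemma zero_mem: "0 \<in> A" using diff_mem[OF one_mem one_mem] by simp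
lemma uminus_mem: "a \<in> A \<Longrightarrow> - a \<in> A" using diff_mem[OF zero_mem] by simp
lemma add_mem: "a \<in> A \<Longrightarrow> b \<in> A \<Longrightarrow> a + b \<in> A"
  using diff_mem[OF _ uminus_mem, of a b] by simp
lemma sum_mem: "(\<And>x. x \<in> S \<Longrightarrow> f x \<in> A) \<Longrightarrow> sum f S \<in> A"
  by (induction S rule: infinite_finite_induct) (auto intro: add_mem zero_mem)
lemma prod_mem: "(\<And>x. x \<in> S \<Longrightarrow> f x \<in> A) \<Longrightarrow> prod f S \<in> A"
  by (induction S rule: infinite_finite_induct) (auto intro: mult_mem one_mem)
lemma power_mem: "a \<in> A \<Longrightarrow> a ^ n \<in> A"
  by (induction n) (auto intro: one_mem mult_mem)

lemma div_in_refl: "div_in A a a"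
  unfolding div_in_def using one_mem by force
lemma div_in_zero: "div_in A a 0"
  unfolding div_in_def using zero_mem by force
lemma div_in_trans: "div_in A a b \<Longrightarrow> div_in A b c \<Longrightarrow> div_in A a c"
  unfolding div_in_def by (metis mult.assoc mult_mem)
lemma div_in_add: "div_in A a b \<Longrightarrow> div_in A a c \<Longrightarrow> div_in A a (b + c)"
  unfolding div_in_def by (metis distrib_left add_mem)
lemma div_in_diff: "div_in A a b \<Longrightarrow> div_in A a c \<Longrightarrow> div_in A a (b - c)"
  unfolding div_in_def by (metis right_diff_distrib diff_mem)
lemma div_in_multR: "div_in A a b \<Longrightarrow> c \<in> A \<Longrightarrow> div_in A a (b * c)"
  unfolding div_in_def by (metis mult.assoc mult_mem)
lemma div_in_multL: "div_in A a b \<Longrightarrow> c \<in> A \<Longrightarrow> div_in A a (c * b)"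
  using div_in_multR[of a b c] by (simp add: mult.commute)
lemma div_in_sum: "(\<And>x. x \<in> S \<Longrightarrow> div_in A a (f x)) \<Longrightarrow> div_in A a (sum f S)"
  by (induction S rule: infinite_finite_induct) (auto intro: div_in_add div_in_zero)

lemma length_function:
  assumes "ufd_in A"
  obtains N :: "'r \<Rightarrow> nat"
    where "\<And>a b. a \<in> A \<Longrightarrow> b \<in> A \<Longrightarrow> a \<noteq> 0 \<Longrightarrow> b \<noteq> 0 \<Longrightarrow> N (a * b) = N a + N b"
      "\<And>a. a \<in> A \<Longrightarrow> a \<noteq> 0 \<Longrightarrow> (N a = 0 \<longleftrightarrow> div_in A a 1)"
proof -
  obtain N :: "'r \<Rightarrow> nat"
    where "\<forall>a\<in>A. \<forall>b\<in>A. a \<noteq> 0 \<longrightarrow> b \<noteq> 0 \<longrightarrow> N (a * b) = N a + N b"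
      and "\<forall>a\<in>A. a \<noteq> 0 \<longrightarrow> (N a = 0 \<longleftrightarrow> div_in A a 1)"
    using assms[unfolded ufd_in_def, THEN conjunct1] by (elim exE conjE) (rule that)
  then show thesis by (intro that[of N]) auto
qed

lemma irred_prime:
  assumes "ufd_in A" "irred_in A p" "a \<in> A" "b \<in> A" "div_in A p (a * b)"
  shows "div_in A p a \<or> div_in A p b"
  using assms by (simp add: ufd_in_def)

lemma irred_divisor_exists:
  assumes "ufd_in A" "a \<in> A" "a \<noteq> 0" "\<not> div_in A a 1"
  shows "\<exists>p. irred_in A p \<and> div_in A p a"
proof -
  obtain N :: "'r \<Rightarrow> nat"
    where N: "\<And>a b. a \<in> A \<Longrightarrow> b \<in> A \<Longrightarrow> a \<noteq> 0 \<Longrightarrow> b \<noteq> 0 \<Longrightarrow> N (a * b) = N a + N b"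
      "\<And>a. a \<in> A \<Longrightarrow> a \<noteq> 0 \<Longrightarrow> (N a = 0 \<longleftrightarrow> div_in A a 1)"
    using length_function[OF assms(1)] by blast
  show ?thesis using assms(2-)
  proof (induction "N a" arbitrary: a rule: less_induct)
    case less
    show ?case
    proof (cases "irred_in A a")
      case True then show ?thesis using div_in_refl by blast
    next
      case False
      then obtain b c where bc: "b \<in> A" "c \<in> A" "a = b * c" "\<not> div_in A b 1" "\<not> div_in A c 1"
        using less.prems unfolding irred_in_def by blast
      then have "b \<noteq> 0" "c \<noteq> 0" using less.prems by auto
      then have "N b < N a" using N bc by force
      then obtain p where "irred_in A p" "div_in A p b"
        using less.hyps bc \<open>b \<noteq> 0\<close> by blast
      then show ?thesis using bc div_in_multR by blast
    qed
  qed
qed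

lemma polys_subring: "subring_set (polys A)"
proof
  show "1 \<in> polys A" by (auto simp: polys_def coeff_1 one_mem zero_mem)
next
  fix f g assume "f \<in> polys A" "g \<in> polys A"
  then show "f - g \<in> polys A" "f * g \<in> polys A"
    by (auto simp: polys_def coeff_mult intro!: sum_mem diff_mem mult_mem)
qed

lemma const_mem: "a \<in> A \<Longrightarrow> [:a:] \<in> polys A"
  by (auto simp: polys_def coeff_pCons zero_mem split: nat.splits)
lemma smult_polys_mem: "a \<in> A \<Longrightarrow> f \<in> polys A \<Longrightarrow> smult a f \<in> polys A"
  by (auto simp: polys_def mult_mem)
lemma monom_mem: "a \<in> A \<Longrightarrow> monom a n \<in> polys A"
  by (auto simp: polys_def zero_mem)

lemma const_div_iff:
  assumes "f \<in> polys A" "p \<noteq> 0"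
  shows "div_in (polys A) [:p:] f \<longleftrightarrow> (\<forall>i. div_in A p (coeff f i))"
proof
  assume "div_in (polys A) [:p:] f"
  then show "\<forall>i. div_in A p (coeff f i)"
    unfolding div_in_def polys_def by auto
next
  assume *: "\<forall>i. div_in A p (coeff f i)"
  then have "\<forall>i. \<exists>c. c \<in> A \<and> coeff f i = p * c" by (auto simp: div_in_def)
  then obtain c where c: "\<And>i. c i \<in> A" "\<And>i. coeff f i = p * c i" by metis
  define g where "g = Abs_poly c"
  have "MOST i. c i = 0"
    using MOST_coeff_eq_0[of f] c(2) assms(2) by simp
  then have g: "coeff g = c" unfolding g_def by (rule Abs_poly_inverse[simplified])
  have "f = [:p:] * g" by (intro poly_eqI) (simp add: g c(2))
  moreover have "g \<in> polys A" using c(1) by (auto simp: polys_def g)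
  ultimately show "div_in (polys A) [:p:] f" unfolding div_in_def by blast
qed

text \<open>
  For two polynomials not divisible by \<open>p\<close>, consider the coefficients of lowest index that \<open>p\<close> does
  not divide: their product is the only term of a coefficient of the product that \<open>p\<close> does not divide.
\<close>

lemma irred_stays_prime:
  assumes "ufd_in A" "irred_in A p" "f \<in> polys A" "g \<in> polys A"
    and "div_in (polys A) [:p:] (f * g)"
  shows "div_in (polys A) [:p:] f \<or> div_in (polys A) [:p:] g"
proof (rule ccontr)
  assume not: "\<not> (div_in (polys A) [:p:] f \<or> div_in (polys A) [:p:] g)"
  have p0: "p \<noteq> 0" using assms(2) by (auto simp: irred_in_def)
  have fg: "f * g \<in> polys A" using assms polys_subring by (auto intro: subring_set.mult_mem)
  have ex: "\<exists>i. \<not> div_in A p (coeff f i)" "\<exists>j. \<not> div_in A p (coeff g j)"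
    using not const_div_iff[OF assms(3) p0] const_div_iff[OF assms(4) p0] by blast+
  obtain i where i: "\<not> div_in A p (coeff f i)" "\<And>k. k < i \<Longrightarrow> div_in A p (coeff f k)"
    using ex(1) unfolding exists_least_iff[where P = "\<lambda>i. \<not> div_in A p (coeff f i)"] by blast
  obtain j where j: "\<not> div_in A p (coeff g j)" "\<And>k. k < j \<Longrightarrow> div_in A p (coeff g k)"
    using ex(2) unfolding exists_least_iff[where P = "\<lambda>i. \<not> div_in A p (coeff g i)"] by blast
  have mem: "coeff f k \<in> A" "coeff g k \<in> A" for k using assms by (auto simp: polys_def)
  let ?t = "\<lambda>k. coeff f k * coeff g (i + j - k)"
  have "coeff (f * g) (i + j) = ?t i + sum ?t ({..i+j} - {i})"
    unfolding coeff_mult by (subst sum.remove[of _ i]) auto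
  then have "?t i = coeff (f * g) (i + j) - sum ?t ({..i+j} - {i})" by simp
  moreover have "div_in A p (coeff (f * g) (i + j))"
    using const_div_iff[OF fg p0] assms(5) by blast
  moreover have "div_in A p (sum ?t ({..i+j} - {i}))"
  proof (rule div_in_sum)
    fix k assume k: "k \<in> {..i+j} - {i}"
    show "div_in A p (?t k)"
    proof (cases "k < i")
      case True then show ?thesis using i(2) mem div_in_multR by blast
    next
      case False
      then have "i + j - k < j" using k by auto
      then show ?thesis using j(2) mem div_in_multL by blast
    qed
  qed
  ultimately have "div_in A p (?t i)" using div_in_diff by presburger
  then have "div_in A p (coeff f i * coeff g j)" by simp
  then show False using i(1) j(1) mem irred_prime[OF assms(1,2)] by blast
qed

text \<open>
  This is Gauss's lemma.  A prime factor of \<open>c\<close> divides \<open>g * q\<close>, hence \<open>q\<close> as \<open>g\<close> is primitive, and can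
  be cancelled on both sides; the induction is on the length of \<open>c\<close>.
\<close>

lemma cancel_constant:
  assumes "ufd_in A" "g \<in> polys A" and prim: "\<And>p. irred_in A p \<Longrightarrow> \<not> div_in (polys A) [:p:] g"
    and "c \<in> A" "c \<noteq> 0" "h \<in> polys A" "q \<in> polys A" "smult c h = g * q"
  shows "div_in (polys A) g h"
proof -
  obtain N :: "'r \<Rightarrow> nat"
    where N: "\<And>a b. a \<in> A \<Longrightarrow> b \<in> A \<Longrightarrow> a \<noteq> 0 \<Longrightarrow> b \<noteq> 0 \<Longrightarrow> N (a * b) = N a + N b"
      "\<And>a. a \<in> A \<Longrightarrow> a \<noteq> 0 \<Longrightarrow> (N a = 0 \<longleftrightarrow> div_in A a 1)"
    using length_function[OF assms(1)] by blast
  show ?thesis using assms(4-)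
  proof (induction "N c" arbitrary: c q rule: less_induct)
    case less
    show ?case
    proof (cases "div_in A c 1")
      case True
      then obtain d where d: "d \<in> A" "c * d = 1" unfolding div_in_def by metis
      have "h = smult d (smult c h)" using d(2) by (simp add: mult.commute)
      also have "\<dots> = g * smult d q" using less.prems by simp
      finally show ?thesis unfolding div_in_def using d less.prems smult_polys_mem by blast
    next
      case False
      then obtain p where p: "irred_in A p" "div_in A p c"
        using irred_divisor_exists assms(1) less.prems by blast
      then obtain c' where c': "c' \<in> A" "c = p * c'" unfolding div_in_def by blast
      have pA: "p \<in> A" "p \<noteq> 0" "\<not> div_in A p 1" using p by (auto simp: irred_in_def)
      have c'0: "c' \<noteq> 0" using c' less.prems by auto
      have "N c' < N c" using N pA c' c'0 by force
      have "[:p:] * smult c' h = g * q" using less.prems c' by (simp add: mult.commute[of c' p])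
      then have "div_in (polys A) [:p:] (g * q)"
        unfolding div_in_def using smult_polys_mem c' less.prems by metis
      then have "div_in (polys A) [:p:] q"
        using irred_stays_prime[OF assms(1) p(1)] assms(2) less.prems prim[OF p(1)] by blast
      then obtain q' where q': "q' \<in> polys A" "q = [:p:] * q'" unfolding div_in_def by blast
      have "smult p (smult c' h) = smult p (g * q')"
        using less.prems c' q' by simp
      then have "smult c' h = g * q'" using pA by (simp add: smult_cancel)
      then show ?thesis using less.hyps[OF \<open>N c' < N c\<close> c'(1) c'0] less.prems q' by blast
    qed
  qed
qed

text \<open>
  Each irreducible constant that is split off shortens the leading coefficient.
\<close>

lemma primitive_part_exists:
  assumes "ufd_in A" "f \<in> polys A" "f \<noteq> 0"
  shows "\<exists>c\<in>A. \<exists>g\<in>polys A. c \<noteq> 0 \<and> f = smult c g \<and>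
           (\<forall>p. irred_in A p \<longrightarrow> \<not> div_in (polys A) [:p:] g)"
proof -
  obtain N :: "'r \<Rightarrow> nat"
    where N: "\<And>a b. a \<in> A \<Longrightarrow> b \<in> A \<Longrightarrow> a \<noteq> 0 \<Longrightarrow> b \<noteq> 0 \<Longrightarrow> N (a * b) = N a + N b"
      "\<And>a. a \<in> A \<Longrightarrow> a \<noteq> 0 \<Longrightarrow> (N a = 0 \<longleftrightarrow> div_in A a 1)"
    using length_function[OF assms(1)] by blast
  show ?thesis using assms(2-)
  proof (induction "N (lead_coeff f)" arbitrary: f rule: less_induct)
    case less
    show ?case
    proof (cases "\<exists>p. irred_in A p \<and> div_in (polys A) [:p:] f")
      case True
      then obtain p f' where p: "irred_in A p" "f' \<in> polys A" "f = smult p f'"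
        unfolding div_in_def by auto
      have pA: "p \<in> A" "p \<noteq> 0" "\<not> div_in A p 1" using p by (auto simp: irred_in_def)
      have f'0: "f' \<noteq> 0" using p less.prems by auto
      have "lead_coeff f' \<in> A" "lead_coeff f' \<noteq> 0" using p f'0 by (auto simp: polys_def)
      moreover have "lead_coeff f = p * lead_coeff f'" using p by simp
      ultimately have "N (lead_coeff f') < N (lead_coeff f)" using N pA by force
      then obtain c g where "c \<in> A" "g \<in> polys A" "c \<noteq> 0" "f' = smult c g"
        "\<forall>p. irred_in A p \<longrightarrow> \<not> div_in (polys A) [:p:] g"
        using less.hyps p(2) f'0 by blast
      then show ?thesis using p pA mult_mem by (intro bexI[of _ "p * c"] bexI[of _ g]) auto
    next
      case False
      then show ?thesis using less.prems one_mem by (intro bexI[of _ 1] bexI[of _ f]) auto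
    qed
  qed
qed

lemma pseudo_division:
  assumes "d \<in> polys A" "d \<noteq> 0" "f \<in> polys A"
  shows "\<exists>c\<in>A. \<exists>q\<in>polys A. \<exists>r\<in>polys A.
           c \<noteq> 0 \<and> smult c f = q * d + r \<and> (r = 0 \<or> degree r < degree d)"
  using assms(3)
proof (induction "if f = 0 then 0 else Suc (degree f)" arbitrary: f rule: less_induct)
  case less
  interpret P: subring_set "polys A" by (rule polys_subring)
  show ?case
  proof (cases "f = 0 \<or> degree f < degree d")
    case True
    then show ?thesis using one_mem P.zero_mem less.prems
      by (intro bexI[of _ 1] bexI[of _ 0] bexI[of _ f]) auto
  next
    case False
    define n where "n = degree f - degree d"
    define a where "a = lead_coeff d"
    define m where "m = monom (lead_coeff f) n"
    define f' where "f' = smult a f - m * d"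
    have a: "a \<in> A" "a \<noteq> 0" using assms by (auto simp: a_def polys_def)
    have m: "m \<in> polys A" unfolding m_def using less.prems by (intro monom_mem) (auto simp: polys_def)
    have f': "f' \<in> polys A" unfolding f'_def
      by (intro P.diff_mem P.mult_mem smult_polys_mem a m assms less.prems)
    have deg: "degree (m * d) = degree f"
      using False assms by (simp add: m_def degree_mult_eq degree_monom_eq n_def)
    have "coeff (m * d) (degree f) = lead_coeff f * a"
      using deg by (metis a_def lead_coeff_mult lead_coeff_monom m_def)
    then have co: "coeff f' (degree f) = 0" by (simp add: f'_def mult.commute)
    have le: "degree f' \<le> degree f" unfolding f'_def
      by (rule degree_diff_le) (use deg in \<open>auto intro: degree_smult_le\<close>)
    have "f' = 0 \<or> degree f' < degree f"
      using co le by (metis leading_coeff_0_iff nat_less_le)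
    then have "(if f' = 0 then 0 else Suc (degree f')) < (if f = 0 then 0 else Suc (degree f))"
      using False by auto
    from less.hyps[OF this f'] obtain c q r where
      cqr: "c \<in> A" "q \<in> polys A" "r \<in> polys A" "c \<noteq> 0" "smult c f' = q * d + r"
        "r = 0 \<or> degree r < degree d" by blast
    have "smult (c * a) f = smult c f' + smult c (m * d)" by (simp add: f'_def smult_diff_right)
    also have "\<dots> = (q + smult c m) * d + r" using cqr(5) by (simp add: algebra_simps)
    finally show ?thesis using cqr a m
      by (intro bexI[of _ "c * a"] bexI[of _ "q + smult c m"] bexI[of _ r])
        (auto intro: mult_mem P.add_mem smult_polys_mem)
  qed
qed

text \<open>
  An arbitrary ideal \<open>J\<close> that contains \<open>C\<close> can express any property which is inherited by combinations of \<open>C\<close>.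
  A nonzero element \<open>d\<close> of least degree in \<open>J\<close> pseudo-divides every \<open>f\<close> in \<open>C\<close>, and by Gauss's
  lemma its primitive part divides \<open>f\<close> itself.  This primitive part is therefore a unit, and \<open>d\<close> is a constant.
\<close>

lemma eliminate_variable:
  assumes ufd: "ufd_in A" and CJ: "C \<subseteq> J" and JP: "J \<subseteq> polys A"
    and Jdiff: "\<And>f g. f \<in> J \<Longrightarrow> g \<in> J \<Longrightarrow> f - g \<in> J"
    and Jmult: "\<And>f h. f \<in> J \<Longrightarrow> h \<in> polys A \<Longrightarrow> h * f \<in> J"
    and cop: "\<And>d. d \<in> polys A \<Longrightarrow> (\<And>f. f \<in> C \<Longrightarrow> div_in (polys A) d f) \<Longrightarrow> div_in (polys A) d 1"
  shows "\<exists>\<delta>\<in>A. \<delta> \<noteq> 0 \<and> [:\<delta>:] \<in> J"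
proof -
  interpret P: subring_set "polys A" by (rule polys_subring)
  have "\<exists>d. d \<in> J \<and> d \<noteq> 0"
  proof (rule ccontr)
    assume "\<not> ?thesis"
    then have "div_in (polys A) 0 f" if "f \<in> C" for f using that CJ P.div_in_zero by blast
    then have "div_in (polys A) 0 1" using cop[OF P.zero_mem] by blast
    then show False by (simp add: div_in_def)
  qed
  then obtain d where d: "d \<in> J" "d \<noteq> 0" and
    min: "\<And>e. e \<in> J \<Longrightarrow> e \<noteq> 0 \<Longrightarrow> degree d \<le> degree e"
    using ex_has_least_nat[of "\<lambda>d. d \<in> J \<and> d \<noteq> 0" _ degree] by blast
  obtain a d0 where a: "a \<in> A" "d0 \<in> polys A" "a \<noteq> 0" "d = smult a d0"
    "\<And>p. irred_in A p \<Longrightarrow> \<not> div_in (polys A) [:p:] d0"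
    using primitive_part_exists[OF ufd] d JP by (metis subsetD)
  have "div_in (polys A) d0 f" if f: "f \<in> C" for f
  proof -
    obtain c q r where cqr: "c \<in> A" "q \<in> polys A" "r \<in> polys A" "c \<noteq> 0" "smult c f = q * d + r"
        "r = 0 \<or> degree r < degree d"
      using pseudo_division[of d f] d f CJ JP by blast
    have "r = [:c:] * f - q * d" using cqr(5) by simp
    then have "r \<in> J" using Jdiff Jmult const_mem cqr f CJ d by (metis subsetD)
    then have "r = 0" using min cqr(6) by force
    then have "smult c f = d0 * smult a q" using cqr a by (simp add: mult.commute[of q d0])
    then show ?thesis
      using cancel_constant[OF ufd a(2) a(5) cqr(1,4)] f CJ JP cqr a smult_polys_mem by blast
  qed
  then have "div_in (polys A) d0 1" using cop a(2) by blast
  then obtain e where "1 = d0 * e" unfolding div_in_def by blast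
  then have "degree d0 = 0" by (metis degree_1 degree_mult_eq_0 one_neq_zero mult_eq_0_iff)
  then have "degree d = 0" using a by simp
  then obtain \<delta> where \<delta>: "d = [:\<delta>:]" by (rule degree_eq_zeroE)
  moreover have "coeff d 0 \<in> A" using d JP by (auto simp: polys_def)
  ultimately show ?thesis using d by auto
qed

text \<open>
  The length of a polynomial is its degree plus the length of its leading coefficient.  For primality,
  let \<open>f\<close> be irreducible of positive degree, hence primitive.  If \<open>f\<close> divides \<open>g * h\<close> but not
  \<open>g\<close>, then \<open>f\<close> and \<open>g\<close> are coprime, some constant \<open>\<delta>\<close> is a combination of them, \<open>f\<close> divides \<open>\<delta> * h\<close>, and
  Gauss's lemma removes \<open>\<delta>\<close>.
\<close>

lemma ufd_polys:
  assumes ufd: "ufd_in A"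
  shows "ufd_in (polys A)"
proof -
  interpret P: subring_set "polys A" by (rule polys_subring)
  obtain N :: "'r \<Rightarrow> nat"
    where N: "\<And>a b. a \<in> A \<Longrightarrow> b \<in> A \<Longrightarrow> a \<noteq> 0 \<Longrightarrow> b \<noteq> 0 \<Longrightarrow> N (a * b) = N a + N b"
      "\<And>a. a \<in> A \<Longrightarrow> a \<noteq> 0 \<Longrightarrow> (N a = 0 \<longleftrightarrow> div_in A a 1)"
    using length_function[OF ufd] by blast
  have const_unit: "div_in (polys A) [:a:] 1 \<longleftrightarrow> div_in A a 1" if "a \<in> A" for a
  proof
    assume "div_in (polys A) [:a:] 1"
    then obtain f where f: "f \<in> polys A" "1 = [:a:] * f" unfolding div_in_def by blast
    have "1 = coeff ([:a:] * f) 0" unfolding f(2)[symmetric] by simp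
    then show "div_in A a 1" using f(1) unfolding div_in_def polys_def by auto
  next
    assume "div_in A a 1"
    then obtain b where "b \<in> A" "1 = a * b" unfolding div_in_def by blast
    then have "1 = [:a:] * [:b:]" by (simp add: one_pCons mult.commute[of b a])
    then show "div_in (polys A) [:a:] 1" using const_mem \<open>b \<in> A\<close> unfolding div_in_def by blast
  qed
  define M where "M f = degree f + N (lead_coeff f)" for f :: "'r poly"
  have "M (f * g) = M f + M g" if "f \<in> polys A" "g \<in> polys A" "f \<noteq> 0" "g \<noteq> 0" for f g
    using that N(1)[of "lead_coeff f" "lead_coeff g"]
    lead_coeff_mult[of f g] by (auto simp: M_def polys_def degree_mult_eq)
  moreover have "M f = 0 \<longleftrightarrow> div_in (polys A) f 1" if f: "f \<in> polys A" "f \<noteq> 0" for f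
  proof (cases "degree f = 0")
    case True
    then obtain a where a: "f = [:a:]" by (rule degree_eq_zeroE)
    moreover have "a \<in> A" using f(1) a by (auto simp: polys_def coeff_pCons split: nat.splits)
    ultimately show ?thesis using N(2) const_unit f by (auto simp: M_def)
  next
    case False
    then have "\<not> div_in (polys A) f 1"
      unfolding div_in_def by (metis degree_1 degree_mult_eq_0 one_neq_zero mult_eq_0_iff)
    then show ?thesis using False by (simp add: M_def)
  qed
  moreover have "div_in (polys A) f g \<or> div_in (polys A) f h"
    if f: "irred_in (polys A) f" and g: "g \<in> polys A" and h: "h \<in> polys A"
      and fgh: "div_in (polys A) f (g * h)" for f g h
  proof (cases "degree f = 0")
    case True
    have fP: "f \<in> polys A" "f \<noteq> 0" "\<not> div_in (polys A) f 1" using f by (auto simp: irred_in_def)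
    obtain a where a: "f = [:a:]" using True by (rule degree_eq_zeroE)
    have aA: "a \<in> A" using fP a by (auto simp: polys_def coeff_pCons split: nat.splits)
    have "irred_in A a"
      unfolding irred_in_def
    proof (intro conjI ballI impI)
      show "a \<in> A" "a \<noteq> 0" "\<not> div_in A a 1" using aA fP a const_unit by auto
      fix b c assume bc: "b \<in> A" "c \<in> A" "a = b * c"
      then have "f = [:b:] * [:c:]" using a by simp
      then show "div_in A b 1 \<or> div_in A c 1"
        using f bc const_mem const_unit unfolding irred_in_def by blast
    qed
    then show ?thesis using irred_stays_prime[OF ufd] g h fgh a by blast
  next
    case False
    have fP: "f \<in> polys A" "f \<noteq> 0" "\<not> div_in (polys A) f 1" using f by (auto simp: irred_in_def)
    have prim: "\<not> div_in (polys A) [:p:] f" if p: "irred_in A p" for p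
    proof
      assume "div_in (polys A) [:p:] f"
      then obtain f' where f': "f' \<in> polys A" "f = [:p:] * f'" unfolding div_in_def by blast
      then have "div_in (polys A) [:p:] 1 \<or> div_in (polys A) f' 1"
        using f p const_mem unfolding irred_in_def by blast
      moreover have "degree f' \<noteq> 0" using f' False by (auto split: if_splits)
      then have "\<not> div_in (polys A) f' 1"
        unfolding div_in_def by (metis degree_1 degree_mult_eq_0 one_neq_zero mult_eq_0_iff)
      ultimately show False using p const_unit unfolding irred_in_def by blast
    qed
    show ?thesis
    proof (rule ccontr)
      assume not: "\<not> ?thesis"
      define J where "J = {u * f + v * g | u v. u \<in> polys A \<and> v \<in> polys A}"
      have "\<exists>\<delta>\<in>A. \<delta> \<noteq> 0 \<and> [:\<delta>:] \<in> J"
      proof (rule eliminate_variable[OF ufd, of "{f, g}"])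
        have "f = 1 * f + 0 * g" "g = 0 * f + 1 * g" by auto
        then show "{f, g} \<subseteq> J" unfolding J_def using P.one_mem P.zero_mem by blast
        show "J \<subseteq> polys A" unfolding J_def using fP g by (auto intro: P.add_mem P.mult_mem)
        fix x y assume "x \<in> J" "y \<in> J"
        then obtain u v u' v' where uv: "x = u * f + v * g" "y = u' * f + v' * g"
          "u \<in> polys A" "v \<in> polys A" "u' \<in> polys A" "v' \<in> polys A" unfolding J_def by blast
        then have "x - y = (u - u') * f + (v - v') * g" by (simp add: algebra_simps)
        then show "x - y \<in> J" unfolding J_def using uv P.diff_mem by blast
      next
        fix x w assume "x \<in> J" and w: "w \<in> polys A"
        then obtain u v where uv: "x = u * f + v * g"
          "u \<in> polys A" "v \<in> polys A" unfolding J_def by blast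
        then have "w * x = (w * u) * f + (w * v) * g" by (simp add: algebra_simps)
        then show "w * x \<in> J" unfolding J_def using uv w P.mult_mem by blast
      next
        fix d assume d: "d \<in> polys A" and "\<And>x. x \<in> {f, g} \<Longrightarrow> div_in (polys A) d x"
        then have df: "div_in (polys A) d f" and dg: "div_in (polys A) d g" by auto
        from df obtain c where c: "c \<in> polys A" "f = d * c" unfolding div_in_def by blast
        show "div_in (polys A) d 1"
        proof (rule ccontr)
          assume "\<not> div_in (polys A) d 1"
          then have "div_in (polys A) c 1" using f c d unfolding irred_in_def by blast
          then obtain c' where "c' \<in> polys A" "1 = c * c'" unfolding div_in_def by blast
          then have "d = f * c'" using c by (metis mult.assoc mult.right_neutral)
          then have "div_in (polys A) f d" using \<open>c' \<in> polys A\<close> unfolding div_in_def by blast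
          then show False using dg not P.div_in_trans by blast
        qed
      qed
      then obtain \<delta> u v where \<delta>: "\<delta> \<in> A" "\<delta> \<noteq> 0" "[:\<delta>:] = u * f + v * g"
        "u \<in> polys A" "v \<in> polys A" unfolding J_def by blast
      obtain w where w: "w \<in> polys A" "g * h = f * w" using fgh unfolding div_in_def by blast
      have "smult \<delta> h = [:\<delta>:] * h" by simp
      also have "\<dots> = u * f * h + v * (g * h)" using \<delta>(3) by (simp add: algebra_simps)
      also have "\<dots> = f * (u * h + v * w)" using w by (simp add: algebra_simps)
      finally have "smult \<delta> h = f * (u * h + v * w)" .
      then have "div_in (polys A) f h"
        using cancel_constant[OF ufd fP(1) prim \<delta>(1,2) h] \<delta> w h
        by (blast intro: P.add_mem P.mult_mem)
      then show False using not by blast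
    qed
  qed
  ultimately show ?thesis unfolding ufd_in_def by (intro conjI exI[of _ M]) blast+
qed

end

section \<open>Ideals\<close>

text \<open>
  The carrier is the whole type, so plain sets suffice; \<open>ideal_iff_is_ideal\<close> connects them with the ideals in terms of
  which Noetherian rings are defined.
\<close>

definition is_ideal :: "'a::comm_ring_1 set \<Rightarrow> bool" where
  "is_ideal I \<longleftrightarrow> 0 \<in> I \<and> (\<forall>x\<in>I. \<forall>y\<in>I. x + y \<in> I) \<and> (\<forall>x\<in>I. \<forall>c. c * x \<in> I)"

lemma is_ideal_diff:
  assumes "is_ideal I" "x \<in> I" "y \<in> I" shows "x - y \<in> I"
proof -
  have "x - y = x + (-1) * y" by simp
  then show ?thesis using assms unfolding is_ideal_def by metis
qed

lemma is_ideal_multR: "is_ideal I \<Longrightarrow> x \<in> I \<Longrightarrow> x * c \<in> I"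
  unfolding is_ideal_def by (metis mult.commute)
lemma is_ideal_mult: "is_ideal I \<Longrightarrow> x \<in> I \<Longrightarrow> c * x \<in> I"
  unfolding is_ideal_def by blast
lemma is_ideal_add: "is_ideal I \<Longrightarrow> x \<in> I \<Longrightarrow> y \<in> I \<Longrightarrow> x + y \<in> I"
  unfolding is_ideal_def by blast
lemma is_ideal_zero: "is_ideal I \<Longrightarrow> 0 \<in> I"
  unfolding is_ideal_def by blast
lemma is_ideal_sum: "is_ideal I \<Longrightarrow> (\<And>x. x \<in> S \<Longrightarrow> f x \<in> I) \<Longrightarrow> sum f S \<in> I"
  by (induction S rule: infinite_finite_induct) (auto intro: is_ideal_zero is_ideal_add)
lemma is_ideal_multiples: "is_ideal {y. a dvd y}"
  by (auto simp: is_ideal_def)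
lemma is_ideal_vimage: "is_ideal I \<Longrightarrow> is_ideal {y. c * y \<in> I}"
  unfolding is_ideal_def by (auto simp: distrib_left mult.left_commute[of c])

definition ideal_sum :: "'a::comm_ring_1 set \<Rightarrow> 'a set \<Rightarrow> 'a set" where
  "ideal_sum I J = {x + y | x y. x \<in> I \<and> y \<in> J}"

lemma ideal_sum:
  assumes "is_ideal I" "is_ideal J"
  shows "is_ideal (ideal_sum I J)" "I \<subseteq> ideal_sum I J" "J \<subseteq> ideal_sum I J"
proof -
  show "I \<subseteq> ideal_sum I J" "J \<subseteq> ideal_sum I J"
    unfolding ideal_sum_def using is_ideal_zero[OF assms(1)] is_ideal_zero[OF assms(2)] by force+
  have "(x + y) + (x' + y') = (x + x') + (y + y')" for x y x' y' :: 'a by simp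
  then show "is_ideal (ideal_sum I J)"
    using assms unfolding is_ideal_def ideal_sum_def
    by (auto, metis add_0, metis, metis distrib_left)
qed

definition ideal_gen :: "'a::comm_ring_1 set \<Rightarrow> 'a set" where
  "ideal_gen S = \<Inter> {I. is_ideal I \<and> S \<subseteq> I}"

lemma is_ideal_gen: "is_ideal (ideal_gen S)"
  by (auto simp: is_ideal_def ideal_gen_def)
lemma ideal_gen_superset: "S \<subseteq> ideal_gen S"
  by (auto simp: ideal_gen_def)
lemma ideal_gen_least: "is_ideal I \<Longrightarrow> S \<subseteq> I \<Longrightarrow> ideal_gen S \<subseteq> I"
  by (auto simp: ideal_gen_def)

section \<open>Polynomials in finitely many variables\<close>

lemma sum_singles: "(\<Sum>e\<in>Poly_Mapping.keys p. Poly_Mapping.single e (Poly_Mapping.lookup p e)) = p"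
proof (rule poly_mapping_eqI)
  fix e
  have "Poly_Mapping.lookup (\<Sum>e\<in>Poly_Mapping.keys p. Poly_Mapping.single e (Poly_Mapping.lookup p e)) e
     = (\<Sum>x\<in>Poly_Mapping.keys p. if x = e then Poly_Mapping.lookup p e else 0)"
    unfolding lookup_sum by (intro sum.cong) (auto simp: lookup_single)
  also have "\<dots> = Poly_Mapping.lookup p e" by (auto simp: in_keys_iff)
  finally show "Poly_Mapping.lookup
    (\<Sum>e\<in>Poly_Mapping.keys p. Poly_Mapping.single e (Poly_Mapping.lookup p e)) e = Poly_Mapping.lookup p e" .
qed

lemma mult_eq_sum_singles:
  fixes p q :: "'r::comm_semiring_1 mpoly"
  shows "p * q = (\<Sum>e\<in>Poly_Mapping.keys p. \<Sum>e'\<in>Poly_Mapping.keys q.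
      Poly_Mapping.single (e + e') (Poly_Mapping.lookup p e * Poly_Mapping.lookup q e'))"
  by (subst sum_singles[of p, symmetric], subst sum_singles[of q, symmetric])
    (simp add: sum_product mult_single)

lemma keys_add_nat: "Poly_Mapping.keys (a + b) = Poly_Mapping.keys a \<union> Poly_Mapping.keys b"
  for a b :: "'v \<Rightarrow>\<^sub>0 nat"
  by (auto simp: in_keys_iff lookup_add)

lemma mpolys_subring: "subring_set (mpolys k :: 'b::idom mpoly set)"
proof
  show "1 \<in> (mpolys k :: 'b mpoly set)" by (auto simp: mpolys_def)
next
  fix f g :: "'b mpoly" assume fg: "f \<in> mpolys k" "g \<in> mpolys k"
  have "Poly_Mapping.keys (f - g) \<subseteq> Poly_Mapping.keys f \<union> Poly_Mapping.keys g"
    by (auto simp: in_keys_iff lookup_minus)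
  then show "f - g \<in> mpolys k" using fg unfolding mpolys_def by blast
  show "f * g \<in> mpolys k" using fg keys_mult[of f g] unfolding mpolys_def by (fastforce simp: keys_add_nat)
qed

interpretation mpolys: subring_set "mpolys k :: 'b::idom mpoly set" by (rule mpolys_subring)
interpretation poly_mpolys: subring_set "polys (mpolys k) :: 'b::idom mpoly poly set"
  by (rule mpolys.polys_subring)

lemma single_mem_mpolys: "Poly_Mapping.keys e \<subseteq> {..<k} \<Longrightarrow> Poly_Mapping.single e c \<in> mpolys k"
  by (auto simp: mpolys_def)

lemma mpolys_mono: "k \<le> k' \<Longrightarrow> mpolys k \<subseteq> mpolys k'"
  by (fastforce simp: mpolys_def)

section \<open>Evaluation\<close>

definition monom_val :: "(nat \<Rightarrow> 'a::comm_semiring_1) \<Rightarrow> (nat \<Rightarrow>\<^sub>0 nat) \<Rightarrow> 'a" where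
  "monom_val m e = (\<Prod>i\<in>Poly_Mapping.keys e. m i ^ Poly_Mapping.lookup e i)"

lemma monom_val_superset:
  "finite S \<Longrightarrow> Poly_Mapping.keys e \<subseteq> S \<Longrightarrow> monom_val m e = (\<Prod>i\<in>S. m i ^ Poly_Mapping.lookup e i)"
  unfolding monom_val_def by (intro prod.mono_neutral_left) (auto simp: in_keys_iff)

lemma monom_val_add: "monom_val m (a + b) = monom_val m a * monom_val m b"
proof -
  let ?S = "Poly_Mapping.keys a \<union> Poly_Mapping.keys b"
  have "monom_val m c = (\<Prod>i\<in>?S. m i ^ Poly_Mapping.lookup c i)" if "Poly_Mapping.keys c \<subseteq> ?S" for c
    using that by (intro monom_val_superset) auto
  then show ?thesis by (simp add: keys_add_nat lookup_add power_add prod.distrib)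
qed

lemma eval_superset:
  "finite S \<Longrightarrow> Poly_Mapping.keys p \<subseteq> S \<Longrightarrow> eval_mpoly m p = (\<Sum>e\<in>S. Poly_Mapping.lookup p e * monom_val m e)"
  unfolding eval_mpoly_def monom_val_def by (intro sum.mono_neutral_left) (auto simp: in_keys_iff)

lemma eval_zero [simp]: "eval_mpoly m 0 = 0"
  by (simp add: eval_mpoly_def)

lemma eval_add: "eval_mpoly m (p + q) = eval_mpoly m p + eval_mpoly m q"
proof -
  let ?S = "Poly_Mapping.keys p \<union> Poly_Mapping.keys q"
  have "Poly_Mapping.keys (p + q) \<subseteq> ?S" by (rule keys_add)
  then show ?thesis by (simp add: eval_superset[of ?S] lookup_add distrib_right sum.distrib)
qed

lemma eval_sum: "eval_mpoly m (sum f S) = (\<Sum>x\<in>S. eval_mpoly m (f x))"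
  by (induction S rule: infinite_finite_induct) (auto simp: eval_add)

lemma eval_single: "eval_mpoly m (Poly_Mapping.single e c) = c * monom_val m e"
  by (subst eval_superset[of "{e}"]) auto

lemma eval_mult: "eval_mpoly m (p * q) = eval_mpoly m p * eval_mpoly m q"
proof -
  have "eval_mpoly m (p * q) = (\<Sum>e\<in>Poly_Mapping.keys p. \<Sum>e'\<in>Poly_Mapping.keys q.
      (Poly_Mapping.lookup p e * monom_val m e) * (Poly_Mapping.lookup q e' * monom_val m e'))"
    by (simp add: mult_eq_sum_singles[of p q] eval_sum eval_single monom_val_add mult_ac)
  also have "\<dots> = eval_mpoly m p * eval_mpoly m q"
    by (simp add: sum_product eval_superset[OF finite_keys order_refl])
  finally show ?thesis .
qed

lemma eval_one [simp]: "eval_mpoly m 1 = 1"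
  by (simp flip: single_one add: eval_single monom_val_def)

lemma eval_const [simp]: "eval_mpoly m (Poly_Mapping.single 0 c) = c"
  by (simp add: eval_single monom_val_def)

lemma eval_diff: "eval_mpoly m (p - q) = eval_mpoly m p - eval_mpoly m q"
  for p :: "'b::comm_ring_1 mpoly"
  using eval_add[of m "p - q" q] by simp

lemma eval_power: "eval_mpoly m (p ^ n) = eval_mpoly m p ^ n"
  by (induction n) (auto simp: eval_mult)

lemma eval_prod: "eval_mpoly m (prod f S) = (\<Prod>x\<in>S. eval_mpoly m (f x))"
  by (induction S rule: infinite_finite_induct) (auto simp: eval_mult)

section \<open>The last variable\<close>

definition Var :: "nat \<Rightarrow> 'b::comm_semiring_1 mpoly" where
  "Var k = Poly_Mapping.single (Poly_Mapping.single k 1) 1"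

lemma Var_power: "Var k ^ n = Poly_Mapping.single (Poly_Mapping.single k n) 1"
  by (induction n) (auto simp: Var_def mult_single single_add[symmetric])

lemma Var_mem: "Var k \<in> mpolys (Suc k)"
  by (auto simp: Var_def intro!: single_mem_mpolys)

lemma eval_Var [simp]: "eval_mpoly m (Var k) = m k"
  by (simp add: Var_def eval_single monom_val_def)

lemma poly_Var_mem:
  fixes q :: "'b::idom mpoly poly"
  assumes "q \<in> polys (mpolys k)"
  shows "poly q (Var k) \<in> mpolys (Suc k)"
  unfolding poly_altdef using assms mpolys_mono[of k "Suc k"]
  by (intro mpolys.sum_mem mpolys.mult_mem mpolys.power_mem Var_mem) (auto simp: polys_def)

text \<open>
  Together with \<open>poly_Var_inj\<close> and \<open>poly_Var_mem\<close>, this identifies the polynomials in \<open>k + 1\<close> variables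
  with the univariate polynomials over those in \<open>k\<close> variables, \<open>Var k\<close> being the new variable.
\<close>

lemma last_variable_expansion:
  fixes f :: "'b::idom mpoly"
  assumes "f \<in> mpolys (Suc k)"
  shows "\<exists>q\<in>polys (mpolys k). poly q (Var k) = f"
proof -
  define q where "q = (\<Sum>e\<in>Poly_Mapping.keys f.
    Polynomial.monom (Poly_Mapping.single (e - Poly_Mapping.single k (Poly_Mapping.lookup e k)) (Poly_Mapping.lookup f e))
      (Poly_Mapping.lookup e k))"
  have "q \<in> polys (mpolys k)" unfolding q_def
  proof (intro poly_mpolys.sum_mem mpolys.monom_mem single_mem_mpolys)
    fix e assume "e \<in> Poly_Mapping.keys f"
    then have "Poly_Mapping.keys e \<subseteq> {..<Suc k}" using assms by (auto simp: mpolys_def)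
    moreover have "Poly_Mapping.keys (e - Poly_Mapping.single k (Poly_Mapping.lookup e k))
        \<subseteq> Poly_Mapping.keys e - {k}"
      by (auto simp: in_keys_iff lookup_minus lookup_single when_def)
    ultimately show "Poly_Mapping.keys (e - Poly_Mapping.single k (Poly_Mapping.lookup e k)) \<subseteq> {..<k}"
      using less_Suc_eq by auto
  qed
  moreover have "poly q (Var k) = f"
  proof -
    have "e - Poly_Mapping.single k (Poly_Mapping.lookup e k) + Poly_Mapping.single k (Poly_Mapping.lookup e k) = e"
      for e :: "nat \<Rightarrow>\<^sub>0 nat"
      by (rule poly_mapping_eqI) (auto simp: lookup_add lookup_minus lookup_single when_def)
    then have "poly q (Var k) = (\<Sum>e\<in>Poly_Mapping.keys f. Poly_Mapping.single e (Poly_Mapping.lookup f e))"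
      by (simp add: q_def poly_sum poly_monom Var_power mult_single)
    then show ?thesis by (simp only: sum_singles)
  qed
  ultimately show ?thesis by blast
qed

text \<open>
  The coefficients of \<open>q\<close> can be read off from its value at \<open>Var k\<close>, since they do not involve that
  variable themselves.
\<close>

lemma lookup_poly_Var:
  fixes q :: "'b::idom mpoly poly"
  assumes q: "q \<in> polys (mpolys k)" and e: "k \<notin> Poly_Mapping.keys e"
  shows "Poly_Mapping.lookup (poly q (Var k)) (e + Poly_Mapping.single k n) = Poly_Mapping.lookup (coeff q n) e"
proof -
  have summand: "Poly_Mapping.lookup (c * Var k ^ i) (e + Poly_Mapping.single k n)
      = (if i = n then Poly_Mapping.lookup c e else 0)" if c: "c \<in> mpolys k" for c :: "'b mpoly" and i
  proof -
    have iff: "e' + Poly_Mapping.single k i = e + Poly_Mapping.single k n \<longleftrightarrow> e' = e \<and> i = n"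
      if "e' \<in> Poly_Mapping.keys c" for e'
    proof
      assume eq: "e' + Poly_Mapping.single k i = e + Poly_Mapping.single k n"
      have "k \<notin> Poly_Mapping.keys e'" using that c by (auto simp: mpolys_def)
      then have "i = n" using arg_cong[OF eq, of "\<lambda>x. Poly_Mapping.lookup x k"] e
        by (simp add: lookup_add in_keys_iff)
      then show "e' = e \<and> i = n" using eq by simp
    qed auto
    have "c * Var k ^ i = (\<Sum>e'\<in>Poly_Mapping.keys c. Poly_Mapping.single (e' + Poly_Mapping.single k i) (Poly_Mapping.lookup c e'))"
      by (subst sum_singles[of c, symmetric]) (simp add: sum_distrib_right Var_power mult_single)
    then have "Poly_Mapping.lookup (c * Var k ^ i) (e + Poly_Mapping.single k n) =
      (\<Sum>e'\<in>Poly_Mapping.keys c. if e' = e then (if i = n then Poly_Mapping.lookup c e else 0) else 0)"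
      by (simp only: lookup_sum) (intro sum.cong, auto simp: lookup_single when_def iff)
    also have "\<dots> = (if i = n then Poly_Mapping.lookup c e else 0)"
      by (auto simp: in_keys_iff)
    finally show ?thesis .
  qed
  have "Poly_Mapping.lookup (poly q (Var k)) (e + Poly_Mapping.single k n)
      = (\<Sum>i\<le>degree q. if i = n then Poly_Mapping.lookup (coeff q i) e else 0)"
    unfolding poly_altdef lookup_sum using q by (intro sum.cong) (auto simp: summand polys_def)
  also have "\<dots> = Poly_Mapping.lookup (coeff q n) e"
    by (auto simp: coeff_eq_0)
  finally show ?thesis .
qed

lemma poly_Var_inj:
  fixes q r :: "'b::idom mpoly poly"
  assumes "q \<in> polys (mpolys k)" "r \<in> polys (mpolys k)" "poly q (Var k) = poly r (Var k)"
  shows "q = r"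
proof (intro poly_eqI poly_mapping_eqI)
  fix n e
  have mem: "coeff q n \<in> mpolys k" "coeff r n \<in> mpolys k" using assms by (auto simp: polys_def)
  show "Poly_Mapping.lookup (coeff q n) e = Poly_Mapping.lookup (coeff r n) e"
  proof (cases "k \<in> Poly_Mapping.keys e")
    case True
    then have "e \<notin> Poly_Mapping.keys (coeff q n)" "e \<notin> Poly_Mapping.keys (coeff r n)"
      using mem by (auto simp: mpolys_def)
    then show ?thesis by (simp add: in_keys_iff)
  next
    case False
    then show ?thesis using lookup_poly_Var[of _ k e n] assms by metis
  qed
qed

lemma eval_poly_Var:
  "eval_mpoly m (poly q (Var k)) = poly (map_poly (eval_mpoly m) q) (m k)"
proof -
  have "poly (map_poly (eval_mpoly m) q) (m k) = (\<Sum>i\<le>degree q. coeff (map_poly (eval_mpoly m) q) i * m k ^ i)"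
    unfolding poly_altdef
    by (intro sum.mono_neutral_left) (auto simp: coeff_eq_0 intro: order_trans[OF _ map_poly_degree_leq])
  then show ?thesis
    by (simp add: poly_altdef eval_sum eval_mult eval_power coeff_map_poly)
qed

section \<open>Unique factorization over a field\<close>

lemma ufd_transfer:
  assumes ufd: "ufd_in B" and B: "0 \<in> B" "1 \<in> B" "\<And>a b. a \<in> B \<Longrightarrow> b \<in> B \<Longrightarrow> a * b \<in> B"
    and bij: "bij_betw \<phi> B B'" and hom: "\<phi> 0 = 0" "\<phi> 1 = 1"
      "\<And>a b. a \<in> B \<Longrightarrow> b \<in> B \<Longrightarrow> \<phi> (a * b) = \<phi> a * \<phi> b"
  shows "ufd_in B'"
proof -
  have B': "B' = \<phi> ` B" and inj: "\<And>a b. a \<in> B \<Longrightarrow> b \<in> B \<Longrightarrow> \<phi> a = \<phi> b \<longleftrightarrow> a = b"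
    using bij by (auto simp: bij_betw_def inj_on_def)
  have div: "div_in B' (\<phi> a) (\<phi> b) \<longleftrightarrow> div_in B a b" if "a \<in> B" "b \<in> B" for a b
    unfolding div_in_def B' using that inj hom B by (auto simp: B(3) hom(3)[symmetric])
  have div1: "div_in B' (\<phi> a) 1 \<longleftrightarrow> div_in B a 1" if "a \<in> B" for a
    using div[OF that B(2)] hom by simp
  have zero: "\<phi> a = 0 \<longleftrightarrow> a = 0" if "a \<in> B" for a using inj[OF that B(1)] hom by simp
  have irred: "irred_in B a" if "irred_in B' (\<phi> a)" "a \<in> B" for a
    unfolding irred_in_def
  proof (intro conjI ballI impI)
    show "a \<in> B" "a \<noteq> 0" "\<not> div_in B a 1"
      using that div1 zero unfolding irred_in_def by auto
    fix b c assume bc: "b \<in> B" "c \<in> B" "a = b * c"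
    then have "\<phi> a = \<phi> b * \<phi> c" using hom by simp
    then have "div_in B' (\<phi> b) 1 \<or> div_in B' (\<phi> c) 1"
      using that bc unfolding irred_in_def B' by blast
    then show "div_in B b 1 \<or> div_in B c 1" using bc div1 by blast
  qed
  obtain N :: "'a \<Rightarrow> nat"
    where N: "\<forall>a\<in>B. \<forall>b\<in>B. a \<noteq> 0 \<longrightarrow> b \<noteq> 0 \<longrightarrow> N (a * b) = N a + N b"
      and N0: "\<forall>a\<in>B. a \<noteq> 0 \<longrightarrow> (N a = 0 \<longleftrightarrow> div_in B a 1)"
    using ufd[unfolded ufd_in_def, THEN conjunct1] by (elim exE conjE) (rule that)
  have pr: "\<forall>p. irred_in B p \<longrightarrow>
        (\<forall>a\<in>B. \<forall>b\<in>B. div_in B p (a * b) \<longrightarrow> div_in B p a \<or> div_in B p b)"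
    using ufd[unfolded ufd_in_def, THEN conjunct2] .
  define M where "M = N \<circ> inv_into B \<phi>"
  have M: "M (\<phi> a) = N a" if "a \<in> B" for a
    using that bij by (simp add: M_def bij_betw_def)
  show ?thesis unfolding ufd_in_def
  proof (intro conjI exI[of _ M] ballI allI impI)
    fix a' b' assume "a' \<in> B'" "b' \<in> B'" "a' \<noteq> 0" "b' \<noteq> 0"
    then obtain a b where "a \<in> B" "b \<in> B" "a' = \<phi> a" "b' = \<phi> b" "a \<noteq> 0" "b \<noteq> 0"
      using B' hom by force
    then show "M (a' * b') = M a' + M b'" using N M B(3) by (simp flip: hom(3))
  next
    fix a' assume "a' \<in> B'" "a' \<noteq> 0"
    then obtain a where "a \<in> B" "a' = \<phi> a" "a \<noteq> 0" using B' hom by force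
    then show "(M a' = 0) = div_in B' a' 1" using N0 M div1 by simp
  next
    fix p' a' b' assume p': "irred_in B' p'" and "a' \<in> B'" "b' \<in> B'" and d: "div_in B' p' (a' * b')"
    then obtain a b where ab: "a \<in> B" "b \<in> B" "a' = \<phi> a" "b' = \<phi> b" using B' by blast
    obtain p where p: "p \<in> B" "p' = \<phi> p" using p' B' unfolding irred_in_def by blast
    have "div_in B p (a * b)" using d ab p div B(3) by (simp flip: hom(3))
    then show "div_in B' p' a' \<or> div_in B' p' b'"
      using pr irred[of p] p' ab p div by simp
  qed
qed

lemma mpolys_0E:
  assumes "f \<in> mpolys 0"
  obtains c where "f = Poly_Mapping.single 0 c"
proof
  have "Poly_Mapping.keys f \<subseteq> {0}" using assms by (auto simp: mpolys_def)
  then show "f = Poly_Mapping.single 0 (Poly_Mapping.lookup f 0)"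
    by (intro poly_mapping_eqI) (auto simp: lookup_single when_def in_keys_iff)
qed

lemma ufd_mpolys: "ufd_in (mpolys k :: 'b::field mpoly set)"
proof (induction k)
  case 0
  have unit: "div_in (mpolys 0) f 1" if mem: "f \<in> mpolys 0" and "f \<noteq> 0" for f :: "'b mpoly"
  proof -
    obtain c where f: "f = Poly_Mapping.single 0 c" using mpolys_0E[OF mem] .
    then have "c \<noteq> 0" using that(2) by auto
    then have "1 = f * Poly_Mapping.single 0 (inverse c)" by (simp add: f mult_single)
    moreover have "Poly_Mapping.single 0 (inverse c) \<in> mpolys 0" by (intro single_mem_mpolys) auto
    ultimately show ?thesis unfolding div_in_def by blast
  qed
  then have "\<not> irred_in (mpolys 0) f" for f :: "'b mpoly" by (auto simp: irred_in_def)
  then show ?case unfolding ufd_in_def using unit by (intro conjI exI[of _ "\<lambda>_. 0"]) auto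
next
  case (Suc k)
  show ?case
  proof (rule ufd_transfer[OF mpolys.ufd_polys[OF Suc], of "\<lambda>q. poly q (Var k)"])
    show "bij_betw (\<lambda>q. poly q (Var k)) (polys (mpolys k)) (mpolys (Suc k) :: 'b mpoly set)"
      unfolding bij_betw_def inj_on_def
      using poly_Var_inj poly_Var_mem last_variable_expansion by blast
  qed (auto intro: poly_mpolys.zero_mem poly_mpolys.one_mem poly_mpolys.mult_mem)
qed

section \<open>Denominators\<close>

lemma lookup_to_fract: "Poly_Mapping.lookup (to_fract_mpoly p) e = to_fract (Poly_Mapping.lookup p e)"
  by (simp add: to_fract_mpoly_def map.rep_eq when_def)

lemma keys_to_fract: "Poly_Mapping.keys (to_fract_mpoly p) = Poly_Mapping.keys p"
  by (auto simp: in_keys_iff lookup_to_fract)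

lemma to_fract_mem_iff: "to_fract_mpoly p \<in> mpolys k \<longleftrightarrow> p \<in> mpolys k"
  by (simp add: mpolys_def keys_to_fract)

lemma to_fract_mpoly_zero [simp]: "to_fract_mpoly 0 = 0"
  by (rule poly_mapping_eqI) (simp add: lookup_to_fract)

lemma to_fract_mpoly_diff: "to_fract_mpoly (p - q) = to_fract_mpoly p - to_fract_mpoly q"
  by (rule poly_mapping_eqI) (simp add: lookup_to_fract lookup_minus)

lemma to_fract_mpoly_sum: "to_fract_mpoly (sum f S) = (\<Sum>x\<in>S. to_fract_mpoly (f x))"
  by (rule poly_mapping_eqI) (simp add: lookup_to_fract lookup_sum)

lemma to_fract_mpoly_single: "to_fract_mpoly (Poly_Mapping.single e c) = Poly_Mapping.single e (to_fract c)"
  by (rule poly_mapping_eqI) (simp add: lookup_to_fract lookup_single when_def)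

lemma to_fract_mpoly_mult: "to_fract_mpoly (p * q) = to_fract_mpoly p * to_fract_mpoly q"
proof -
  have "to_fract_mpoly (p * q) = (\<Sum>e\<in>Poly_Mapping.keys p. Poly_Mapping.single e (to_fract (Poly_Mapping.lookup p e))) *
      (\<Sum>e'\<in>Poly_Mapping.keys q. Poly_Mapping.single e' (to_fract (Poly_Mapping.lookup q e')))"
    by (simp add: mult_eq_sum_singles[of p q] to_fract_mpoly_sum to_fract_mpoly_single sum_product mult_single)
  also have "\<dots> = to_fract_mpoly p * to_fract_mpoly q"
    using sum_singles[of "to_fract_mpoly p"] sum_singles[of "to_fract_mpoly q"]
    by (simp add: keys_to_fract lookup_to_fract)
  finally show ?thesis .
qed

lemma to_fract_mpoly_one: "to_fract_mpoly 1 = 1"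
  by (simp flip: single_one add: to_fract_mpoly_single)

lemma to_fract_mpoly_power: "to_fract_mpoly (p ^ n) = to_fract_mpoly p ^ n"
  by (induction n) (auto simp: to_fract_mpoly_mult to_fract_mpoly_one)

lemma to_fract_Var: "to_fract_mpoly (Var k) = Var k"
  by (simp add: Var_def to_fract_mpoly_single)

lemma common_denominator:
  assumes "finite S"
  shows "\<exists>c::'a::idom. c \<noteq> 0 \<and> (\<forall>x\<in>S. to_fract c * x \<in> range to_fract)"
  using assms
proof (induction S)
  case empty then show ?case by (intro exI[of _ 1]) auto
next
  case (insert x S)
  then obtain c :: 'a where c: "c \<noteq> 0" "\<forall>x\<in>S. to_fract c * x \<in> range to_fract" by blast
  obtain a b where ab: "x = Fract a b" "b \<noteq> 0" by (cases x)
  have "to_fract (c * b) * x = to_fract (c * a)"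
    using ab by (simp add: Fract_conv_to_fract)
  moreover have "to_fract (c * b) * y \<in> range to_fract" if "y \<in> S" for y
  proof -
    have "to_fract c * y \<in> range to_fract" using c(2) that by (rule bspec)
    then obtain d where d: "to_fract c * y = to_fract d" by (rule imageE)
    have "to_fract (c * b) * y = to_fract b * (to_fract c * y)" by simp
    also have "\<dots> = to_fract (b * d)" unfolding d by simp
    finally show ?thesis by (simp only: rangeI)
  qed
  ultimately have "\<forall>y\<in>insert x S. to_fract (c * b) * y \<in> range to_fract" by (auto simp del: to_fract_mult)
  then show ?case using c(1) ab(2) by (intro exI[of _ "c * b"]) simp
qed

text \<open>
  Cofactors obtained over the fraction field are brought back to the domain with this.
\<close>

lemma clear_denominators:
  fixes g :: "'a::idom fract mpoly"
  assumes "g \<in> mpolys k"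
  shows "\<exists>c h. c \<noteq> 0 \<and> h \<in> mpolys k \<and> to_fract_mpoly h = Poly_Mapping.single 0 (to_fract c) * g"
proof -
  obtain c :: 'a where c: "c \<noteq> 0"
    "\<forall>x\<in>Poly_Mapping.lookup g ` Poly_Mapping.keys g. to_fract c * x \<in> range to_fract"
    using common_denominator[of "Poly_Mapping.lookup g ` Poly_Mapping.keys g"] by auto
  then have "\<forall>e\<in>Poly_Mapping.keys g. \<exists>a. to_fract a = to_fract c * Poly_Mapping.lookup g e"
    by force
  then obtain a where a: "\<And>e. e \<in> Poly_Mapping.keys g \<Longrightarrow> to_fract (a e) = to_fract c * Poly_Mapping.lookup g e"
    by metis
  define h where "h = (\<Sum>e\<in>Poly_Mapping.keys g. Poly_Mapping.single e (a e))"
  have "h \<in> mpolys k" unfolding h_def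
    using assms by (intro mpolys.sum_mem single_mem_mpolys) (auto simp: mpolys_def)
  moreover have "to_fract_mpoly h = Poly_Mapping.single 0 (to_fract c) * g"
  proof -
    have "to_fract_mpoly h = Poly_Mapping.single 0 (to_fract c) *
        (\<Sum>e\<in>Poly_Mapping.keys g. Poly_Mapping.single e (Poly_Mapping.lookup g e))"
      by (simp add: h_def to_fract_mpoly_sum to_fract_mpoly_single a sum_distrib_left mult_single)
    then show ?thesis by (simp only: sum_singles)
  qed
  ultimately show ?thesis using c by blast
qed

lemma to_fract_poly_Var:
  "to_fract_mpoly (poly q (Var k)) = (\<Sum>i\<le>degree q. to_fract_mpoly (coeff q i) * Var k ^ i)"
  by (simp add: poly_altdef to_fract_mpoly_sum to_fract_mpoly_mult to_fract_mpoly_power to_fract_Var)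

section \<open>Coprime polynomials\<close>

lemma coprime_in_iff: "coprime_in R S \<longleftrightarrow> (\<forall>d\<in>R. (\<forall>x\<in>S. div_in R d x) \<longrightarrow> div_in R d 1)"
  unfolding coprime_in_def div_in_def by metis

text \<open>
  The eliminant \<open>\<delta>\<close> is a combination over \<open>Z[t]\<close> of the elements of \<open>C\<close> that does not involve the last
  variable.  All that matters about the combination is its effect on values, namely that every ideal that contains the
  values of \<open>C\<close> at \<open>m\<close> contains that of \<open>\<delta>\<close>; recording only this avoids explicit cofactors.
\<close>

lemma coprime_eliminant:
  fixes C :: "'a::idom mpoly set"
  assumes C: "C \<subseteq> mpolys (Suc k)" and cop: "coprime_in (mpolys (Suc k)) (to_fract_mpoly ` C)"
  shows "\<exists>\<delta>\<in>mpolys k. \<delta> \<noteq> 0 \<and>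
    (\<forall>m I. is_ideal I \<longrightarrow> (\<forall>f\<in>C. eval_mpoly m f \<in> I) \<longrightarrow> eval_mpoly m \<delta> \<in> I)"
proof -
  define Jz where "Jz = {h. h \<in> mpolys (Suc k) \<and>
     (\<forall>m I. is_ideal I \<longrightarrow> (\<forall>f\<in>C. eval_mpoly m f \<in> I) \<longrightarrow> eval_mpoly m h \<in> I)}"
  have Jz_diff: "h - h' \<in> Jz" if "h \<in> Jz" "h' \<in> Jz" for h h'
    using that by (auto simp: Jz_def eval_diff intro: mpolys.diff_mem is_ideal_diff)
  have Jz_mult: "g * h \<in> Jz" if "h \<in> Jz" "g \<in> mpolys (Suc k)" for g h
    using that by (auto simp: Jz_def eval_mult is_ideal_def intro: mpolys.mult_mem)
  let ?A = "mpolys k :: 'a fract mpoly set"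
  let ?phi = "\<lambda>q :: 'a fract mpoly poly. poly q (Var k)"
  let ?c = "\<lambda>c :: 'a. Poly_Mapping.single 0 (to_fract c) :: 'a fract mpoly"
  let ?d = "\<lambda>c :: 'a. Poly_Mapping.single 0 c :: 'a mpoly"
  have d_mem: "?d c \<in> mpolys j" for c j by (intro single_mem_mpolys) auto
  have to_d: "to_fract_mpoly (?d c) = ?c c" for c by (rule to_fract_mpoly_single)
  \<comment> \<open>Elements of the ideal over the fraction field carry a multiple with coefficients
    in the domain that behaves as required on values.\<close>
  define J where "J = {q \<in> polys ?A. \<exists>c h. c \<noteq> 0 \<and> h \<in> Jz \<and> to_fract_mpoly h = ?c c * ?phi q}"
  have J_I: "q \<in> J" if "to_fract_mpoly h = ?c c * ?phi q" "c \<noteq> 0" "h \<in> Jz" "q \<in> polys ?A" for q c h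
    using that unfolding J_def by blast
  have "\<exists>\<delta>\<in>?A. \<delta> \<noteq> 0 \<and> [:\<delta>:] \<in> J"
  proof (rule mpolys.eliminate_variable[OF ufd_mpolys, of "{q \<in> polys ?A. ?phi q \<in> to_fract_mpoly ` C}"])
    show "J \<subseteq> polys ?A" by (auto simp: J_def)
    show "{q \<in> polys ?A. ?phi q \<in> to_fract_mpoly ` C} \<subseteq> J"
    proof
      fix q assume "q \<in> {q \<in> polys ?A. ?phi q \<in> to_fract_mpoly ` C}"
      then obtain f where f: "q \<in> polys ?A" "f \<in> C" "?phi q = to_fract_mpoly f" by blast
      then have "f \<in> Jz" using C by (auto simp: Jz_def)
      moreover have "to_fract_mpoly f = ?c 1 * ?phi q" using f by simp
      ultimately show "q \<in> J" by (intro J_I[of f 1]) (simp_all add: f)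
    qed
  next
    fix q r assume "q \<in> J" "r \<in> J"
    then obtain c h c' h' where 1: "q \<in> polys ?A" "c \<noteq> 0" "h \<in> Jz" "to_fract_mpoly h = ?c c * ?phi q"
      and 2: "r \<in> polys ?A" "c' \<noteq> 0" "h' \<in> Jz" "to_fract_mpoly h' = ?c c' * ?phi r"
      unfolding J_def by blast
    have cc: "?c (c * c') = ?c c * ?c c'" by (simp add: mult_single)
    have "to_fract_mpoly (?d c' * h - ?d c * h') = ?c (c * c') * ?phi (q - r)"
      unfolding to_fract_mpoly_diff to_fract_mpoly_mult to_d 1 2 cc by (simp add: algebra_simps)
    moreover have "c * c' \<noteq> 0" using 1 2 by simp
    moreover have "?d c' * h - ?d c * h' \<in> Jz" using 1 2 d_mem Jz_diff Jz_mult by blast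
    ultimately show "q - r \<in> J" by (rule J_I[OF _ _ _ poly_mpolys.diff_mem[OF 1(1) 2(1)]])
  next
    fix q w assume "q \<in> J" and w: "w \<in> polys ?A"
    then obtain c h where 1: "q \<in> polys ?A" "c \<noteq> 0" "h \<in> Jz" "to_fract_mpoly h = ?c c * ?phi q"
      unfolding J_def by blast
    obtain c' g where 2: "c' \<noteq> 0" "g \<in> mpolys (Suc k)" "to_fract_mpoly g = ?c c' * ?phi w"
      using clear_denominators[OF poly_Var_mem[OF w]] by blast
    have cc: "?c (c * c') = ?c c * ?c c'" by (simp add: mult_single)
    have "to_fract_mpoly (g * h) = ?c (c * c') * ?phi (w * q)"
      unfolding to_fract_mpoly_mult 1 2 cc by (simp add: algebra_simps)
    moreover have "c * c' \<noteq> 0" using 1 2 by simp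
    moreover have "g * h \<in> Jz" using 1 2 Jz_mult by blast
    ultimately show "w * q \<in> J" by (rule J_I[OF _ _ _ poly_mpolys.mult_mem[OF w 1(1)]])
  next
    fix d assume d: "d \<in> polys ?A"
      and div: "\<And>q. q \<in> {q \<in> polys ?A. ?phi q \<in> to_fract_mpoly ` C} \<Longrightarrow> div_in (polys ?A) d q"
    have "div_in (mpolys (Suc k)) (?phi d) x" if x: "x \<in> to_fract_mpoly ` C" for x
    proof -
      have "x \<in> mpolys (Suc k)" using x C to_fract_mem_iff by blast
      then obtain q where q: "q \<in> polys ?A" "?phi q = x" using last_variable_expansion by blast
      then have "div_in (polys ?A) d q" using div x by simp
      then obtain r where "r \<in> polys ?A" "q = d * r" unfolding div_in_def by blast
      then have "x = ?phi d * ?phi r" using q by simp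
      then show ?thesis unfolding div_in_def using poly_Var_mem[OF \<open>r \<in> polys ?A\<close>] by blast
    qed
    then have "div_in (mpolys (Suc k)) (?phi d) 1"
      using cop poly_Var_mem[OF d] unfolding coprime_in_iff by blast
    then obtain e where e: "e \<in> mpolys (Suc k)" "1 = ?phi d * e" unfolding div_in_def by blast
    obtain r where r: "r \<in> polys ?A" "?phi r = e" using last_variable_expansion[OF e(1)] by blast
    have "?phi 1 = ?phi (d * r)" using e r by simp
    then have "1 = d * r"
      by (intro poly_Var_inj[where k = k] poly_mpolys.one_mem poly_mpolys.mult_mem d r)
    then show "div_in (polys ?A) d 1" using r unfolding div_in_def by blast
  qed
  then obtain \<delta> c h where \<delta>: "\<delta> \<in> ?A" "\<delta> \<noteq> 0" "c \<noteq> 0" "h \<in> Jz" "to_fract_mpoly h = ?c c * \<delta>"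
    unfolding J_def by auto
  have "?c c \<in> ?A" by (intro single_mem_mpolys) auto
  then have "to_fract_mpoly h \<in> ?A" unfolding \<delta>(5) using \<delta>(1) by (intro mpolys.mult_mem)
  then have "h \<in> mpolys k" by (simp only: to_fract_mem_iff)
  moreover have "h \<noteq> 0"
  proof
    assume "h = 0"
    then have "?c c * \<delta> = 0" using \<delta> by simp
    then have "?c c = 0" using \<delta> by simp
    then have "to_fract c = 0" by (metis lookup_single_eq lookup_zero)
    then show False using \<delta> by simp
  qed
  ultimately show ?thesis using \<delta>(4) by (auto simp: Jz_def)
qed

text \<open>
  A common divisor of the coefficients with respect to the last variable divides the polynomials,
  hence is a unit in \<open>k + 1\<close> variables; the constant term of its inverse is an inverse in \<open>k\<close> variables.
\<close>

lemma coprime_coefficients: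
  fixes Q :: "'a::idom mpoly poly set"
  assumes Q: "Q \<subseteq> polys (mpolys k)"
    and cop: "coprime_in (mpolys (Suc k)) (to_fract_mpoly ` (\<lambda>q. poly q (Var k)) ` Q)"
  shows "coprime_in (mpolys k) (to_fract_mpoly ` (\<Union>q\<in>Q. set (coeffs q)))"
  unfolding coprime_in_iff
proof (intro ballI impI)
  fix d :: "'a fract mpoly"
  assume d: "d \<in> mpolys k" and div: "\<forall>x\<in>to_fract_mpoly ` (\<Union>q\<in>Q. set (coeffs q)). div_in (mpolys k) d x"
  have sub: "mpolys k \<subseteq> (mpolys (Suc k) :: 'a fract mpoly set)" by (rule mpolys_mono) simp
  have "div_in (mpolys (Suc k)) d x" if x: "x \<in> to_fract_mpoly ` (\<lambda>q. poly q (Var k)) ` Q" for x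
  proof -
    obtain q where q: "q \<in> Q" "x = to_fract_mpoly (poly q (Var k))" using x by blast
    have "div_in (mpolys (Suc k)) d (to_fract_mpoly (coeff q i))" for i
    proof (cases "coeff q i = 0")
      case True then show ?thesis by (simp add: mpolys.div_in_zero)
    next
      case False
      then have "coeff q i \<in> set (coeffs q)" by (metis coeff_in_coeffs le_degree coeff_0)
      then have "div_in (mpolys k) d (to_fract_mpoly (coeff q i))" using div q by blast
      then show ?thesis using sub unfolding div_in_def by blast
    qed
    then show ?thesis unfolding q to_fract_poly_Var
      by (intro mpolys.div_in_sum mpolys.div_in_multR mpolys.power_mem Var_mem)
  qed
  then have "div_in (mpolys (Suc k)) d 1" using cop d sub unfolding coprime_in_iff by blast
  then obtain e where e: "e \<in> mpolys (Suc k)" "1 = d * e" unfolding div_in_def by blast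
  obtain r where r: "r \<in> polys (mpolys k)" "poly r (Var k) = e" using last_variable_expansion[OF e(1)] by blast
  have "poly 1 (Var k) = poly ([:d:] * r) (Var k)" using e r by simp
  then have 1: "1 = [:d:] * r"
    by (intro poly_Var_inj[where k = k] poly_mpolys.one_mem poly_mpolys.mult_mem mpolys.const_mem d r)
  have "1 = coeff ([:d:] * r) 0" unfolding 1[symmetric] by simp
  then have "1 = d * coeff r 0" by simp
  then show "div_in (mpolys k) d 1" using r unfolding div_in_def polys_def by blast
qed

section \<open>Congruences modulo a prime\<close>

definition incongruent :: "'a::comm_ring_1 \<Rightarrow> 'a set \<Rightarrow> bool" where
  "incongruent p S \<longleftrightarrow> (\<forall>x\<in>S. \<forall>y\<in>S. p dvd x - y \<longrightarrow> x = y)"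

lemma cong_sym: "p dvd a - b \<Longrightarrow> p dvd b - a" for p :: "'a::comm_ring_1"
  by (metis dvd_minus_iff minus_diff_eq)

lemma cong_mult:
  fixes p :: "'a::comm_ring_1"
  assumes "p dvd a - b" "p dvd c - d" shows "p dvd a * c - b * d"
proof -
  have "a * c - b * d = (a - b) * c + b * (c - d)" by (simp add: algebra_simps)
  then show ?thesis using assms by simp
qed

lemma cong_power: "p dvd a - b \<Longrightarrow> p dvd a ^ n - b ^ n" for p :: "'a::comm_ring_1"
  by (induction n) (auto intro: cong_mult)

lemma cong_prod:
  fixes f g :: "'b \<Rightarrow> 'a::comm_ring_1"
  shows "(\<And>i. i \<in> S \<Longrightarrow> p dvd f i - g i) \<Longrightarrow> p dvd prod f S - prod g S"
  by (induction S rule: infinite_finite_induct) (auto intro: cong_mult)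

lemma cong_dvd_iff: "p dvd a - b \<Longrightarrow> p dvd a \<longleftrightarrow> p dvd b" for p :: "'a::comm_ring_1"
  by (metis diff_add_cancel dvd_add_right_iff dvd_add_left_iff)

lemma poly_cong: "p dvd x - y \<Longrightarrow> p dvd poly f x - poly f y" for p :: "'a::comm_ring_1"
proof (induction f)
  case (pCons a f)
  then have "p dvd x * poly f x - y * poly f y" by (intro cong_mult) auto
  then show ?case by simp
qed simp

lemma eval_cong:
  fixes p :: "'a::comm_ring_1"
  assumes "f \<in> mpolys k" "\<And>i. i < k \<Longrightarrow> p dvd m i - m' i"
  shows "p dvd eval_mpoly m f - eval_mpoly m' f"
  unfolding eval_mpoly_def sum_subtractf[symmetric]
proof (intro dvd_sum)
  fix e assume "e \<in> Poly_Mapping.keys f"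
  then have "p dvd m i - m' i" if "i \<in> Poly_Mapping.keys e" for i
    using assms that by (auto simp: mpolys_def)
  then show "p dvd Poly_Mapping.lookup f e * (\<Prod>i\<in>Poly_Mapping.keys e. m i ^ Poly_Mapping.lookup e i)
      - Poly_Mapping.lookup f e * (\<Prod>i\<in>Poly_Mapping.keys e. m' i ^ Poly_Mapping.lookup e i)"
    by (intro cong_mult cong_prod cong_power) auto
qed

lemma prime_elem_assoc:
  fixes p q :: "'a::idom"
  assumes "prime_elem p" "prime_elem q" "q dvd p" shows "p dvd q"
proof -
  obtain c where c: "p = q * c" using assms(3) by blast
  then consider "p dvd q" | "p dvd c" using assms(1) by (metis dvd_refl prime_elem_dvd_mult_iff)
  then show ?thesis
  proof cases
    case 2
    then obtain d where d: "c = p * d" by blast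
    have "p * (q * d) = q * c" by (simp add: d mult_ac)
    then have "p * 1 = p * (q * d)" by (simp flip: c)
    moreover have "p \<noteq> 0" using assms(1) by auto
    ultimately have "1 = q * d" by (metis mult_left_cancel)
    then show ?thesis using assms(2) by (metis dvd_triv_left prime_elem_not_unit)
  qed
qed

lemma prime_elem_dvd_prod:
  fixes p :: "'a::idom"
  assumes "prime_elem p" "finite S" "p dvd prod f S" shows "\<exists>i\<in>S. p dvd f i"
  using assms(2,3)
proof (induction S)
  case empty then show ?case using assms(1) by (auto simp: prime_elem_def)
next
  case (insert i S) then show ?case using assms(1) by (auto simp: prime_elem_dvd_mult_iff)
qed

text \<open>
  A polynomial over the domain \<open>Z / p\<close> with more roots than its degree is zero.  The argument divides
  by \<open>x - a\<close> for the roots \<open>a\<close> one by one, which avoids the quotient ring.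
\<close>

lemma prime_dvd_coeffs_of_roots:
  fixes p :: "'a::idom"
  assumes p: "prime_elem p" and "finite S" "incongruent p S" "degree f < card S"
    and "\<And>x. x \<in> S \<Longrightarrow> p dvd poly f x"
  shows "[:p:] dvd f"
  using assms(2-)
proof (induction "degree f" arbitrary: f S)
  case 0
  then obtain c where c: "f = [:c:]" by (metis degree_eq_zeroE)
  obtain x where "x \<in> S" using 0 by (metis card.empty ex_in_conv less_nat_zero_code)
  then have "p dvd c" using 0 c by fastforce
  then show ?case by (simp add: c const_poly_dvd_iff coeff_pCons split: nat.splits)
next
  case (Suc n)
  obtain a where a: "a \<in> S" using Suc by (metis card.empty ex_in_conv less_nat_zero_code)
  define g where "g = synthetic_div f a"
  have f: "f = [:- a, 1:] * g + [:poly f a:]" unfolding g_def by (simp only: synthetic_div_correct')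
  have "[:p:] dvd g"
  proof (rule Suc.hyps(1)[of g "S - {a}"])
    show "n = degree g" using Suc by (simp add: g_def degree_synthetic_div flip: Suc.hyps(2))
    then show "degree g < card (S - {a})" using Suc a by (simp flip: Suc.hyps(2))
    show "finite (S - {a})" "incongruent p (S - {a})" using Suc by (auto simp: incongruent_def)
    fix x assume x: "x \<in> S - {a}"
    have "poly f x = (x - a) * poly g x + poly f a"
      using arg_cong[OF f, of "\<lambda>f. poly f x"] by (simp add: algebra_simps)
    then have "p dvd (x - a) * poly g x" using Suc.prems(4) x a
      by (metis DiffD1 dvd_add_left_iff)
    moreover have "\<not> p dvd x - a" using Suc.prems(2) x a unfolding incongruent_def by blast
    ultimately show "p dvd poly g x" using p by (simp add: prime_elem_dvd_mult_iff)
  qed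
  moreover have "[:p:] dvd [:poly f a:]" using Suc.prems(4) a by (simp add: const_poly_dvd_iff coeff_pCons split: nat.splits)
  ultimately show ?case by (subst f) (intro dvd_add dvd_mult)
qed

text \<open>
  Multiplication by \<open>\<omega>\<close> is injective modulo \<open>p\<close>.  If there are more residue classes than the degree of
  \<open>f\<close>, the progression therefore meets more classes than \<open>f\<close> can have roots.  Otherwise the classes are finite in
  number, and the progression meets all of them, including that of \<open>b\<close>.
\<close>

lemma avoid_prime_in_progression:
  fixes p :: "'a::idom"
  assumes p: "prime_elem p" and \<omega>: "\<not> p dvd \<omega>" and b: "\<not> p dvd poly f b"
  shows "\<exists>l. \<not> p dvd poly f (\<alpha> + \<omega> * l)"
proof (rule ccontr)
  assume "\<not> ?thesis"
  then have zero: "p dvd poly f (\<alpha> + \<omega> * l)" for l by blast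
  let ?P = "\<lambda>S. finite S \<and> incongruent p S"
  let ?h = "\<lambda>l. \<alpha> + \<omega> * l"
  have image: "?P (?h ` S) \<and> card (?h ` S) = card S" if S: "?P S" for S
  proof -
    have *: "p dvd x - y" if "p dvd ?h x - ?h y" for x y
    proof -
      have "p dvd \<omega> * (x - y)" using that by (simp add: algebra_simps)
      then show ?thesis using p \<omega> by (simp add: prime_elem_dvd_mult_iff)
    qed
    have S': "x = y" if "x \<in> S" "y \<in> S" "p dvd ?h x - ?h y" for x y
      using *[OF that(3)] S that(1,2) unfolding incongruent_def by blast
    then have "inj_on ?h S" by (intro inj_onI) (simp only: diff_self dvd_0_right)
    moreover have "incongruent p (?h ` S)" using S' unfolding incongruent_def by fast
    ultimately show ?thesis using S by (simp add: card_image)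
  qed
  have bound: "card S \<le> degree f" if S: "?P S" for S
  proof (rule ccontr)
    assume "\<not> card S \<le> degree f"
    then have "[:p:] dvd f" using image[OF S] zero by (intro prime_dvd_coeffs_of_roots[OF p, of "?h ` S"]) auto
    then have "p dvd poly f b" by (auto elim!: dvdE)
    then show False using b by blast
  qed
  have "?P {}" by (auto simp: incongruent_def)
  \<comment> \<open>A largest incongruent set represents all residue classes, and so does its image.\<close>
  then obtain S where S: "?P S" and max: "\<And>T. ?P T \<Longrightarrow> card T \<le> card S"
    using ex_has_greatest_nat[of ?P "{}" card "Suc (degree f)"] bound by (metis le_imp_less_Suc)
  have "\<exists>y\<in>?h ` S. p dvd b - y"
  proof (rule ccontr)
    assume not: "\<not> ?thesis"
    then have "b \<notin> ?h ` S" by force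
    have "\<not> p dvd b - y" "\<not> p dvd y - b" if "y \<in> ?h ` S" for y
      using not that cong_sym[of p y b] by blast+
    then have "incongruent p (insert b (?h ` S))"
      using image[OF S] unfolding incongruent_def by blast
    then have "card (insert b (?h ` S)) \<le> card S" using image[OF S] max by simp
    then show False using image[OF S] \<open>b \<notin> ?h ` S\<close> by simp
  qed
  then show False using zero b poly_cong cong_dvd_iff by blast
qed

lemma eval_in_one_coordinate:
  "\<exists>F. \<forall>x. poly F x = eval_mpoly (m(j := x)) g"
proof -
  define F where "F = (\<Sum>e\<in>Poly_Mapping.keys g. smult (Poly_Mapping.lookup g e)
     (\<Prod>i\<in>Poly_Mapping.keys e. (if i = j then [:0, 1:] else [:m i:]) ^ Poly_Mapping.lookup e i))"
  have "poly F x = eval_mpoly (m(j := x)) g" for x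
    unfolding F_def eval_mpoly_def
    by (auto simp: poly_sum poly_prod intro!: sum.cong prod.cong arg_cong2[where f = times])
  then show ?thesis by blast
qed

text \<open>
  The coordinates in \<open>J\<close> are moved into the class of \<open>\<alpha>\<close> modulo \<open>\<omega>\<close> one at a time.
\<close>

lemma avoid_prime_in_lattice:
  fixes p :: "'a::idom"
  assumes p: "prime_elem p" and \<omega>: "\<not> p dvd \<omega>" and "finite J"
    and "\<not> p dvd eval_mpoly m g" "\<And>j. j \<notin> J \<Longrightarrow> m j = \<alpha> j"
  shows "\<exists>\<beta>. (\<forall>j. \<omega> dvd \<beta> j - \<alpha> j) \<and> (\<forall>j. j \<notin> J \<longrightarrow> \<beta> j = \<alpha> j) \<and> \<not> p dvd eval_mpoly \<beta> g"
  using assms(3-)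
proof (induction J arbitrary: m \<alpha>)
  case empty
  then have "m = \<alpha>" by auto
  then show ?case using empty by (intro exI[of _ \<alpha>]) auto
next
  case (insert j J)
  obtain F where F: "\<And>x. poly F x = eval_mpoly (m(j := x)) g"
    using eval_in_one_coordinate by metis
  have "\<not> p dvd poly F (m j)" using insert.prems by (simp add: F)
  then obtain l where l: "\<not> p dvd eval_mpoly (m(j := \<alpha> j + \<omega> * l)) g"
    using avoid_prime_in_progression[OF p \<omega>] F by metis
  have "\<exists>\<beta>. (\<forall>i. \<omega> dvd \<beta> i - (\<alpha>(j := \<alpha> j + \<omega> * l)) i) \<and>
      (\<forall>i. i \<notin> J \<longrightarrow> \<beta> i = (\<alpha>(j := \<alpha> j + \<omega> * l)) i) \<and> \<not> p dvd eval_mpoly \<beta> g"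
    by (rule insert.IH[OF l]) (use insert.prems in auto)
  then obtain \<beta> where \<beta>: "\<And>i. \<omega> dvd \<beta> i - (\<alpha>(j := \<alpha> j + \<omega> * l)) i"
    "\<And>i. i \<notin> J \<Longrightarrow> \<beta> i = (\<alpha>(j := \<alpha> j + \<omega> * l)) i" "\<not> p dvd eval_mpoly \<beta> g" by blast
  have "\<omega> dvd \<beta> i - \<alpha> i" for i
    using \<beta>(1)[of i] \<beta>(2)[of j] insert.hyps by (cases "i = j") auto
  moreover have "\<beta> i = \<alpha> i" if "i \<notin> insert j J" for i using \<beta>(2)[of i] that by auto
  ultimately show ?case using \<beta>(3) by blast
qed

section \<open>Avoiding finitely many primes\<close>

text \<open>
  If \<open>C i\<close> is the set of coefficients of a polynomial \<open>P i\<close> over \<open>Z[t]\<close>, this means that \<open>p\<close> divides none of the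
  specialized polynomials.
\<close>

definition nonvanishing_mod :: "nat \<Rightarrow> (nat \<Rightarrow> 'a::comm_ring_1 mpoly set) \<Rightarrow> 'a \<Rightarrow> (nat \<Rightarrow> 'a) \<Rightarrow> bool" where
  "nonvanishing_mod s C p m \<longleftrightarrow> (\<forall>i<s. \<exists>f\<in>C i. \<not> p dvd eval_mpoly m f)"

lemma nonvanishing_mod_cong:
  assumes "nonvanishing_mod s C p m" "\<And>i. i < s \<Longrightarrow> C i \<subseteq> mpolys k" "\<And>j. j < k \<Longrightarrow> p dvd m j - m' j"
  shows "nonvanishing_mod s C p m'"
  unfolding nonvanishing_mod_def
proof (intro allI impI)
  fix i assume i: "i < s"
  then obtain f where f: "f \<in> C i" "\<not> p dvd eval_mpoly m f"
    using assms(1) unfolding nonvanishing_mod_def by blast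
  then have "\<not> p dvd eval_mpoly m' f"
    using eval_cong[of f k p m m'] assms(2)[OF i] assms(3) cong_dvd_iff by blast
  then show "\<exists>f\<in>C i. \<not> p dvd eval_mpoly m' f" using f by blast
qed

lemma nonvanishing_mod_dvd: "nonvanishing_mod s C p m \<Longrightarrow> p dvd q \<Longrightarrow> nonvanishing_mod s C q m"
  unfolding nonvanishing_mod_def using dvd_trans by blast

text \<open>
  As \<open>p\<close> is prime, it suffices to keep the value of one product of members, one from each \<open>C i\<close>, nonzero modulo \<open>p\<close>.
\<close>

lemma avoid_prime_simultaneously:
  fixes p :: "'a::idom"
  assumes p: "prime_elem p" and \<omega>: "\<not> p dvd \<omega>" and J: "finite J"
    and m: "nonvanishing_mod s C p m" and mJ: "\<And>j. j \<notin> J \<Longrightarrow> m j = \<alpha> j"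
  shows "\<exists>\<beta>. (\<forall>j. \<omega> dvd \<beta> j - \<alpha> j) \<and> (\<forall>j. j \<notin> J \<longrightarrow> \<beta> j = \<alpha> j) \<and> nonvanishing_mod s C p \<beta>"
proof -
  obtain f where f: "\<And>i. i < s \<Longrightarrow> f i \<in> C i" "\<And>i. i < s \<Longrightarrow> \<not> p dvd eval_mpoly m (f i)"
    using m unfolding nonvanishing_mod_def by metis
  have "\<not> p dvd eval_mpoly m (\<Prod>i<s. f i)"
    using prime_elem_dvd_prod[OF p, of "{..<s}" "\<lambda>i. eval_mpoly m (f i)"] f by (auto simp: eval_prod)
  then obtain \<beta> where \<beta>: "\<forall>j. \<omega> dvd \<beta> j - \<alpha> j" "\<forall>j. j \<notin> J \<longrightarrow> \<beta> j = \<alpha> j"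
    "\<not> p dvd eval_mpoly \<beta> (\<Prod>i<s. f i)"
    using avoid_prime_in_lattice[OF p \<omega> J, of m "\<Prod>i<s. f i" \<alpha>] mJ by blast
  have "\<not> p dvd eval_mpoly \<beta> (f i)" if "i < s" for i
    using \<beta>(3) that unfolding eval_prod by (metis dvd_prodI dvd_trans finite_lessThan lessThan_iff)
  then have "nonvanishing_mod s C p \<beta>" unfolding nonvanishing_mod_def using f by blast
  then show ?thesis using \<beta> by blast
qed

text \<open>
  Each prime of \<open>R\<close> that does not yet divide the modulus is handled by moving the point within its
  class, which does not affect the primes already handled, and is then multiplied into the modulus.
  The set \<open>J\<close> contains the coordinates that may be moved.
\<close>

lemma enlarge_modulus:
  fixes \<omega> :: "'a::idom"
  assumes J: "finite J" and C: "\<And>i. i < s \<Longrightarrow> C i \<subseteq> mpolys k"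
    and "finite R" "\<And>p. p \<in> R \<Longrightarrow> prime_elem p"
    and \<omega>: "\<omega> \<noteq> 0" "\<And>p. prime_elem p \<Longrightarrow> p dvd \<omega> \<Longrightarrow> nonvanishing_mod s C p \<alpha>"
    and "\<And>p. p \<in> R \<Longrightarrow> \<exists>m. nonvanishing_mod s C p m \<and> (\<forall>j. j \<notin> J \<longrightarrow> m j = \<alpha> j)"
  shows "\<exists>\<omega>' \<alpha>'. \<omega>' \<noteq> 0 \<and> \<omega> dvd \<omega>' \<and> (\<forall>j. \<omega> dvd \<alpha>' j - \<alpha> j) \<and> (\<forall>j. j \<notin> J \<longrightarrow> \<alpha>' j = \<alpha> j) \<and>
     (\<forall>p\<in>R. p dvd \<omega>') \<and> (\<forall>p. prime_elem p \<longrightarrow> p dvd \<omega>' \<longrightarrow> nonvanishing_mod s C p \<alpha>')"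
  using assms(3,4,7)
proof (induction R)
  case empty
  show ?case using \<omega> by (intro exI[of _ \<omega>] exI[of _ \<alpha>]) auto
next
  case (insert p R)
  have "\<exists>\<omega>' \<alpha>'. \<omega>' \<noteq> 0 \<and> \<omega> dvd \<omega>' \<and> (\<forall>j. \<omega> dvd \<alpha>' j - \<alpha> j) \<and> (\<forall>j. j \<notin> J \<longrightarrow> \<alpha>' j = \<alpha> j) \<and>
     (\<forall>p\<in>R. p dvd \<omega>') \<and> (\<forall>p. prime_elem p \<longrightarrow> p dvd \<omega>' \<longrightarrow> nonvanishing_mod s C p \<alpha>')"
    by (rule insert.IH) (use insert.prems in auto)
  then obtain \<omega>' \<alpha>' where IH: "\<omega>' \<noteq> 0" "\<omega> dvd \<omega>'" "\<And>j. \<omega> dvd \<alpha>' j - \<alpha> j" "\<And>j. j \<notin> J \<Longrightarrow> \<alpha>' j = \<alpha> j"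
     "\<And>p. p \<in> R \<Longrightarrow> p dvd \<omega>'" "\<And>p. prime_elem p \<Longrightarrow> p dvd \<omega>' \<Longrightarrow> nonvanishing_mod s C p \<alpha>'"
    by blast
  show ?case
  proof (cases "p dvd \<omega>'")
    case True
    then show ?thesis using IH by blast
  next
    case False
    have p: "prime_elem p" using insert.prems by blast
    obtain m where "nonvanishing_mod s C p m" "\<And>j. j \<notin> J \<Longrightarrow> m j = \<alpha>' j"
      using insert.prems(2)[of p] IH(4) by auto
    from avoid_prime_simultaneously[OF p False J this] obtain \<beta> where
      \<beta>: "\<And>j. \<omega>' dvd \<beta> j - \<alpha>' j" "\<And>j. j \<notin> J \<Longrightarrow> \<beta> j = \<alpha>' j" "nonvanishing_mod s C p \<beta>" by blast
    have "nonvanishing_mod s C q \<beta>" if q: "prime_elem q" "q dvd \<omega>' * p" for q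
    proof (cases "q dvd \<omega>'")
      case True
      have "q dvd \<alpha>' j - \<beta> j" for j
        using dvd_trans[OF True \<beta>(1)[of j]] by (rule cong_sym)
      then show ?thesis using nonvanishing_mod_cong[OF IH(6)[OF q(1) True] C] by blast
    next
      case False
      then have "q dvd p" using q by (simp add: prime_elem_dvd_mult_iff)
      then show ?thesis using nonvanishing_mod_dvd[OF \<beta>(3)] prime_elem_assoc[OF p q(1)] by blast
    qed
    moreover have "\<omega> dvd \<beta> j - \<alpha> j" for j
    proof -
      have "\<omega> dvd (\<beta> j - \<alpha>' j) + (\<alpha>' j - \<alpha> j)" using dvd_trans[OF IH(2) \<beta>(1)] IH(3) by (rule dvd_add)
      then show ?thesis by simp
    qed
    moreover have "\<omega>' * p \<noteq> 0" using IH p by auto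
    moreover have "\<omega> dvd \<omega>' * p" using IH(2) by (rule dvd_mult2)
    moreover have "\<forall>q\<in>insert p R. q dvd \<omega>' * p" using IH(5) by (auto intro: dvd_mult2)
    ultimately show ?thesis using \<beta>(2) IH(4) by (intro exI[of _ "\<omega>' * p"] exI[of _ \<beta>]) simp
  qed
qed

section \<open>Induction on the number of variables\<close>

text \<open>
  Up to units, since a prime that divides another prime is associated to it.
\<close>

definition finitely_many_primes :: "'a::idom itself \<Rightarrow> bool" where
  "finitely_many_primes Z \<longleftrightarrow>
     (\<forall>x::'a. x \<noteq> 0 \<longrightarrow> (\<exists>R. finite R \<and> (\<forall>p\<in>R. prime_elem p) \<and>
        (\<forall>p. prime_elem p \<longrightarrow> p dvd x \<longrightarrow> (\<exists>r\<in>R. r dvd p))))"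

lemma in_set_coeffs: "c \<in> set (coeffs q) \<Longrightarrow> \<exists>n. c = coeff q n"
  by (auto simp: coeffs_def split: if_splits)

text \<open>
  The small primes are those with at most \<open>D\<close> residue classes.  Among \<open>D + 1\<close> distinct elements two
  are congruent modulo such a prime, so the product of all differences is a choice of \<open>z\<close>.
\<close>

lemma small_primes_divide:
  assumes "infinite (UNIV :: 'a::idom set)"
  shows "\<exists>z::'a. z \<noteq> 0 \<and> (\<forall>p. (\<forall>S. finite S \<longrightarrow> incongruent p S \<longrightarrow> card S \<le> D) \<longrightarrow> p dvd z)"
proof -
  obtain B :: "'a set" where B: "finite B" "card B = Suc D"
    using infinite_arbitrarily_large[OF assms] by blast
  define U where "U = {u \<in> B \<times> B. fst u \<noteq> snd u}"
  define z where "z = (\<Prod>u\<in>U. fst u - snd u)"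
  have U: "finite U" using B by (auto simp: U_def)
  have "z \<noteq> 0" using U by (auto simp: z_def U_def)
  moreover have "p dvd z" if p: "\<forall>S. finite S \<longrightarrow> incongruent p S \<longrightarrow> card S \<le> D" for p
  proof -
    have "\<not> incongruent p B" using p B by fastforce
    then obtain x y where "(x, y) \<in> U" "p dvd x - y" unfolding incongruent_def U_def by auto
    moreover have "fst (x, y) - snd (x, y) dvd z" unfolding z_def using U \<open>(x, y) \<in> U\<close> by (rule dvd_prodI)
    ultimately show ?thesis by (metis dvd_trans fst_conv snd_conv)
  qed
  ultimately show ?thesis by blast
qed

text \<open>
  The prescribed class of the point modulo \<open>\<omega>\<close> is what makes the induction on \<open>k\<close> work: it is used
  to protect the small primes.
\<close>

definition prime_free_specialization :: "'a::idom itself \<Rightarrow> nat \<Rightarrow> nat \<Rightarrow> bool" where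
  "prime_free_specialization Z k s \<longleftrightarrow> (\<forall>C \<omega> \<alpha> P0.
     (\<forall>i<s. finite (C i) \<and> C i \<subseteq> mpolys k \<and> coprime_in (mpolys k) (to_fract_mpoly ` C i)) \<longrightarrow>
     (\<forall>p::'a. prime_elem p \<longrightarrow> (\<exists>m. nonvanishing_mod s C p m)) \<longrightarrow>
     \<omega> \<noteq> 0 \<longrightarrow> (\<forall>p. prime_elem p \<longrightarrow> p dvd \<omega> \<longrightarrow> nonvanishing_mod s C p \<alpha>) \<longrightarrow>
     P0 \<in> mpolys k \<longrightarrow> P0 \<noteq> 0 \<longrightarrow>
     (\<exists>m. (\<forall>j<k. \<omega> dvd m j - \<alpha> j) \<and> (\<forall>p. prime_elem p \<longrightarrow> nonvanishing_mod s C p m) \<and> eval_mpoly m P0 \<noteq> 0))"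

text \<open>
  The conclusion is stronger than what the induction needs: in the last coordinate a whole arithmetic
  progression is allowed.
\<close>

lemma specialize_last_variable:
  fixes Z :: "'a::idom itself" and C :: "nat \<Rightarrow> 'a mpoly set"
  assumes inf: "infinite (UNIV :: 'a set)" and fp: "finitely_many_primes Z"
    and IH: "prime_free_specialization Z k s"
    and C: "\<And>i. i < s \<Longrightarrow> finite (C i)" "\<And>i. i < s \<Longrightarrow> C i \<subseteq> mpolys (Suc k)"
      "\<And>i. i < s \<Longrightarrow> coprime_in (mpolys (Suc k)) (to_fract_mpoly ` C i)"
    and ex_good: "\<And>p::'a. prime_elem p \<Longrightarrow> \<exists>m. nonvanishing_mod s C p m"
    and \<omega>: "\<omega> \<noteq> 0" "\<And>p. prime_elem p \<Longrightarrow> p dvd \<omega> \<Longrightarrow> nonvanishing_mod s C p \<alpha>"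
    and P0: "P0 \<in> mpolys (Suc k)" "P0 \<noteq> 0"
  shows "\<exists>m \<omega>'. \<omega>' \<noteq> 0 \<and> (\<forall>j<Suc k. \<omega> dvd m j - \<alpha> j) \<and> \<omega> dvd \<omega>' \<and>
     (\<forall>x p. \<omega>' dvd x - m k \<longrightarrow> prime_elem p \<longrightarrow> nonvanishing_mod s C p (m(k := x))) \<and>
     finite {x. eval_mpoly (m(k := x)) P0 = 0}"
proof -
  have primes: "\<exists>R. finite R \<and> (\<forall>p\<in>R. prime_elem p) \<and> (\<forall>p. prime_elem p \<longrightarrow> p dvd x \<longrightarrow> (\<exists>r\<in>R. r dvd p))"
    if "x \<noteq> 0" for x :: 'a
    using fp that unfolding finitely_many_primes_def by blast
  have "\<exists>q. f \<in> mpolys (Suc k) \<longrightarrow> q \<in> polys (mpolys k) \<and> poly q (Var k) = f" for f :: "'a mpoly"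
    using last_variable_expansion by blast
  then obtain q where q: "\<And>f :: 'a mpoly. f \<in> mpolys (Suc k) \<Longrightarrow> q f \<in> polys (mpolys k)"
    "\<And>f. f \<in> mpolys (Suc k) \<Longrightarrow> poly (q f) (Var k) = f"
    by metis
  \<comment> \<open>\<open>D\<close> bounds the degree in the last variable of a product of members, one from each \<open>C i\<close>.\<close>
  define D where "D = (\<Sum>i<s. \<Sum>f\<in>C i. degree (q f))"
  obtain z :: 'a where z: "z \<noteq> 0"
    "\<And>p. (\<And>S. finite S \<Longrightarrow> incongruent p S \<Longrightarrow> card S \<le> D) \<Longrightarrow> p dvd z"
    using small_primes_divide[OF inf, of D] by metis
  obtain R where R: "finite R" "\<And>p. p \<in> R \<Longrightarrow> prime_elem p"
    "\<And>p. prime_elem p \<Longrightarrow> p dvd z \<Longrightarrow> \<exists>r\<in>R. r dvd p"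
    using primes[OF z(1)] by blast
  have "\<exists>m. nonvanishing_mod s C p m \<and> (\<forall>j. j \<notin> {..k} \<longrightarrow> m j = \<alpha> j)" if p: "p \<in> R" for p
  proof -
    obtain m where "nonvanishing_mod s C p m" using ex_good R(2)[OF p] by blast
    then have "nonvanishing_mod s C p (\<lambda>j. if j \<le> k then m j else \<alpha> j)"
      by (rule nonvanishing_mod_cong[OF _ C(2)]) auto
    then show ?thesis by (intro exI[of _ "\<lambda>j. if j \<le> k then m j else \<alpha> j"]) auto
  qed
  \<comment> \<open>The small primes are put into the modulus, with all coordinates free to move.\<close>
  from enlarge_modulus[OF _ C(2) R(1,2) \<omega> this]
  obtain \<omega>1 \<alpha>1 where 1: "\<omega>1 \<noteq> 0" "\<omega> dvd \<omega>1" "\<And>j. \<omega> dvd \<alpha>1 j - \<alpha> j" "\<And>p. p \<in> R \<Longrightarrow> p dvd \<omega>1"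
     "\<And>p. prime_elem p \<Longrightarrow> p dvd \<omega>1 \<Longrightarrow> nonvanishing_mod s C p \<alpha>1"
    by auto
  have small: "p dvd \<omega>1" if p: "prime_elem p" "p dvd z" for p
  proof -
    obtain r where "r \<in> R" "r dvd p" using R(3) p by blast
    then show ?thesis using prime_elem_assoc[OF p(1) R(2)] 1(4) dvd_trans by blast
  qed
  have "\<forall>i. \<exists>\<delta>. i < s \<longrightarrow> \<delta> \<in> mpolys k \<and> \<delta> \<noteq> 0 \<and>
    (\<forall>m I. is_ideal I \<longrightarrow> (\<forall>f\<in>C i. eval_mpoly m f \<in> I) \<longrightarrow> eval_mpoly m \<delta> \<in> I)"
    using coprime_eliminant[OF C(2,3)] by blast
  then obtain \<delta> where \<delta>: "\<And>i. i < s \<Longrightarrow> \<delta> i \<in> mpolys k" "\<And>i. i < s \<Longrightarrow> \<delta> i \<noteq> 0"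
    "\<And>i m I. i < s \<Longrightarrow> is_ideal I \<Longrightarrow> (\<And>f. f \<in> C i \<Longrightarrow> eval_mpoly m f \<in> I) \<Longrightarrow> eval_mpoly m (\<delta> i) \<in> I"
    by metis
  define C' where "C' i = (\<Union>r\<in>q ` C i. set (coeffs r))" for i
  \<comment> \<open>Nonvanishing of \<open>P0'\<close> keeps the eliminants nonzero, and \<open>P0\<close> nonzero as a polynomial in the last variable.\<close>
  define P0' where "P0' = (\<Prod>i<s. \<delta> i) * lead_coeff (q P0)"
  have coeff_mem: "coeff (q f) n \<in> mpolys k" if "f \<in> mpolys (Suc k)" for f n
    using q(1)[OF that] by (auto simp: polys_def)
  have good': "nonvanishing_mod s C' p m" if pm: "nonvanishing_mod s C p m" for p m
    unfolding nonvanishing_mod_def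
  proof (intro allI impI)
    fix i assume i: "i < s"
    then obtain f where f: "f \<in> C i" "\<not> p dvd eval_mpoly m f"
      using pm unfolding nonvanishing_mod_def by blast
    have "eval_mpoly m f = eval_mpoly m (poly (q f) (Var k))" using q(2) f C(2)[OF i] by auto
    also have "\<dots> = (\<Sum>n\<le>degree (q f). eval_mpoly m (coeff (q f) n) * m k ^ n)"
      by (simp add: poly_altdef eval_sum eval_mult eval_power)
    finally have "p dvd eval_mpoly m f" if "\<And>n. p dvd eval_mpoly m (coeff (q f) n)"
      using that by (auto intro!: dvd_sum dvd_mult2)
    then obtain n where n: "\<not> p dvd eval_mpoly m (coeff (q f) n)"
      using f(2) by blast
    then have "coeff (q f) n \<noteq> 0" by auto
    then have "coeff (q f) n \<in> set (coeffs (q f))" by (metis coeff_in_coeffs le_degree coeff_0)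
    then show "\<exists>f\<in>C' i. \<not> p dvd eval_mpoly m f" unfolding C'_def using f n by blast
  qed
  have "\<exists>m. (\<forall>j<k. \<omega>1 dvd m j - \<alpha>1 j) \<and> (\<forall>p. prime_elem p \<longrightarrow> nonvanishing_mod s C' p m) \<and> eval_mpoly m P0' \<noteq> 0"
  proof (rule IH[unfolded prime_free_specialization_def, rule_format])
    fix i assume i: "i < s"
    have im: "(\<lambda>r. poly r (Var k)) ` q ` C i = C i"
      using q(2) C(2)[OF i] by (force simp: image_image)
    have "C' i \<subseteq> mpolys k"
      using C(2)[OF i] coeff_mem in_set_coeffs unfolding C'_def by fast
    moreover have "coprime_in (mpolys k) (to_fract_mpoly ` C' i)"
      unfolding C'_def by (rule coprime_coefficients) (use C(2,3)[OF i] q(1) im in auto)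
    ultimately show "finite (C' i) \<and> C' i \<subseteq> mpolys k \<and> coprime_in (mpolys k) (to_fract_mpoly ` C' i)"
      using C(1)[OF i] by (auto simp: C'_def)
  next
    show "P0' \<in> mpolys k" unfolding P0'_def
      using \<delta>(1) by (intro mpolys.mult_mem mpolys.prod_mem coeff_mem P0) auto
    have "q P0 \<noteq> 0" using q(2)[OF P0(1)] P0(2) by auto
    then show "P0' \<noteq> 0" unfolding P0'_def using \<delta>(2) by simp
  qed (use 1 ex_good good' in blast)+
  then obtain m1 where m1: "\<And>j. j < k \<Longrightarrow> \<omega>1 dvd m1 j - \<alpha>1 j"
    "\<And>p. prime_elem p \<Longrightarrow> nonvanishing_mod s C' p m1" "eval_mpoly m1 P0' \<noteq> 0" by blast
  define u where "u f = map_poly (eval_mpoly m1) (q f)" for f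
  have u: "poly (u f) x = eval_mpoly (m(k := x)) f" if f: "f \<in> mpolys (Suc k)" and m: "\<And>j. j < k \<Longrightarrow> m j = m1 j" for f x m
  proof -
    have "u f = map_poly (eval_mpoly (m(k := x))) (q f)"
      unfolding u_def
      by (intro poly_eqI) (auto simp: coeff_map_poly m intro!: eval_mpoly_cong[OF coeff_mem[OF f]])
    then show ?thesis using eval_poly_Var[of "m(k := x)" "q f" k] q(2)[OF f] by simp
  qed
  \<comment> \<open>For primes in the modulus, the coordinate \<open>\<alpha>1 k\<close> completes \<open>m1\<close> to a point congruent to \<open>\<alpha>1\<close>.\<close>
  have m1_good: "nonvanishing_mod s C p (m1(k := \<alpha>1 k))" if p: "prime_elem p" "p dvd \<omega>1" for p
  proof (rule nonvanishing_mod_cong[OF 1(5)[OF p] C(2)])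
    fix j assume j: "j < Suc k"
    have "p dvd m1 j - \<alpha>1 j" if "j < k" using m1(1)[OF that] p(2) dvd_trans by blast
    then have "p dvd \<alpha>1 j - m1 j" if "j < k" using that by (simp add: cong_sym)
    then show "p dvd \<alpha>1 j - (m1(k := \<alpha>1 k)) j" using j by (auto simp: less_Suc_eq)
  qed
  have slice: "\<exists>x. nonvanishing_mod s C p (m1(k := x))" if p: "prime_elem p" for p
  proof (cases "p dvd z")
    case True
    have "nonvanishing_mod s C p (m1(k := \<alpha>1 k))" using m1_good[OF p] small[OF p True] .
    then show ?thesis by blast
  next
    case False
    \<comment> \<open>A prime that is not small has more residue classes than the degree of the product \<open>F\<close>, which is
      nonzero modulo \<open>p\<close>.\<close>
    then obtain S where S: "finite S" "incongruent p S" "D < card S" using z(2) by (meson not_le)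
    have "\<exists>f. f \<in> C i \<and> \<not> [:p:] dvd u f" if i: "i < s" for i
    proof -
      obtain c where c: "c \<in> C' i" "\<not> p dvd eval_mpoly m1 c"
        using m1(2)[OF p] i unfolding nonvanishing_mod_def by blast
      then obtain f n where f: "f \<in> C i" "c = coeff (q f) n"
        unfolding C'_def using in_set_coeffs by fast
      then have "coeff (u f) n = eval_mpoly m1 c" by (simp add: u_def coeff_map_poly)
      then show ?thesis using c f by (metis const_poly_dvd_iff)
    qed
    then obtain f where f: "\<And>i. i < s \<Longrightarrow> f i \<in> C i" "\<And>i. i < s \<Longrightarrow> \<not> [:p:] dvd u (f i)" by metis
    define F where "F = (\<Prod>i<s. u (f i))"
    have "\<not> [:p:] dvd F"
      using prime_elem_dvd_prod[of "[:p:]" "{..<s}" "\<lambda>i. u (f i)"] p f(2)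
      by (auto simp: F_def prime_elem_const_poly_iff)
    moreover have "degree F \<le> D"
    proof -
      have "degree F \<le> (\<Sum>i<s. degree (u (f i)))" unfolding F_def
        using degree_prod_sum_le[of "{..<s}" "\<lambda>i. u (f i)"] by (simp add: o_def)
      also have "\<dots> \<le> D" unfolding D_def
      proof (rule sum_mono)
        fix i assume i: "i \<in> {..<s}"
        have "degree (u (f i)) \<le> degree (q (f i))" unfolding u_def by (rule map_poly_degree_leq)
        also have "\<dots> \<le> (\<Sum>f\<in>C i. degree (q f))" using C(1) f(1) i by (intro member_le_sum) auto
        finally show "degree (u (f i)) \<le> (\<Sum>f\<in>C i. degree (q f))" .
      qed
      finally show ?thesis .
    qed
    ultimately obtain x where x: "\<not> p dvd poly F x"
      using prime_dvd_coeffs_of_roots[OF p S(1,2), of F] S(3) by force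
    have "\<not> p dvd eval_mpoly (m1(k := x)) (f i)" if i: "i < s" for i
    proof -
      have "poly F x = (\<Prod>i<s. poly (u (f i)) x)" by (simp add: F_def poly_prod)
      then have "\<not> p dvd poly (u (f i)) x"
        using x i by (metis dvd_prodI dvd_trans finite_lessThan lessThan_iff)
      then show ?thesis using u f(1)[OF i] C(2)[OF i] by (metis subsetD)
    qed
    then show ?thesis unfolding nonvanishing_mod_def using f(1) by blast
  qed
  \<comment> \<open>Outside the prime divisors of \<open>\<Delta>\<close>, the eliminants exclude common divisors at every point over \<open>m1\<close>.\<close>
  define \<Delta> where "\<Delta> = (\<Prod>i<s. eval_mpoly m1 (\<delta> i))"
  have \<Delta>: "\<Delta> \<noteq> 0" and lc: "eval_mpoly m1 (lead_coeff (q P0)) \<noteq> 0"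
    using m1(3) by (auto simp: P0'_def \<Delta>_def eval_mult eval_prod)
  obtain R2 where R2: "finite R2" "\<And>p. p \<in> R2 \<Longrightarrow> prime_elem p"
    "\<And>p. prime_elem p \<Longrightarrow> p dvd \<Delta> \<Longrightarrow> \<exists>r\<in>R2. r dvd p"
    using primes[OF \<Delta>] by blast
  have "\<exists>m. nonvanishing_mod s C p m \<and> (\<forall>j. j \<notin> {k} \<longrightarrow> m j = (m1(k := \<alpha>1 k)) j)" if "p \<in> R2" for p
    using slice[OF R2(2)[OF that]] by auto
  from enlarge_modulus[OF _ C(2) R2(1,2) 1(1) m1_good this]
  obtain \<omega>2 m where 2: "\<omega>2 \<noteq> 0" "\<omega>1 dvd \<omega>2" "\<And>j. \<omega>1 dvd m j - (m1(k := \<alpha>1 k)) j" "\<And>j. j \<noteq> k \<Longrightarrow> m j = m1 j"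
    "\<And>p. p \<in> R2 \<Longrightarrow> p dvd \<omega>2" "\<And>p. prime_elem p \<Longrightarrow> p dvd \<omega>2 \<Longrightarrow> nonvanishing_mod s C p m"
    by auto
  have "\<omega> dvd m j - \<alpha> j" if j: "j < Suc k" for j
  proof -
    have "\<omega>1 dvd m j - \<alpha>1 j"
      using 2(3)[of j] 2(4)[of j] m1(1)[of j] j by (cases "j = k") auto
    then have "\<omega> dvd (m j - \<alpha>1 j) + (\<alpha>1 j - \<alpha> j)" using 1(2,3) dvd_trans dvd_add by blast
    then show ?thesis by simp
  qed
  moreover have "nonvanishing_mod s C p (m(k := x))" if x: "\<omega>2 dvd x - m k" and p: "prime_elem p" for x p
  proof (cases "p dvd \<Delta>")
    case True
    then obtain r where "r \<in> R2" "r dvd p" using R2(3) p by blast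
    then have p2: "p dvd \<omega>2" using prime_elem_assoc[OF p R2(2)] 2(5) dvd_trans by blast
    show ?thesis
    proof (rule nonvanishing_mod_cong[OF 2(6)[OF p p2] C(2)])
      fix j
      have "p dvd x - m k" using p2 x dvd_trans by blast
      then have "p dvd m k - x" by (rule cong_sym)
      then show "p dvd m j - (m(k := x)) j" by simp
    qed
  next
    case False
    show ?thesis unfolding nonvanishing_mod_def
    proof (intro allI impI, rule ccontr)
      fix i assume i: "i < s" and "\<not> (\<exists>f\<in>C i. \<not> p dvd eval_mpoly (m(k := x)) f)"
      then have "\<And>f. f \<in> C i \<Longrightarrow> eval_mpoly (m(k := x)) f \<in> {y. p dvd y}" by blast
      moreover have "is_ideal {y. p dvd y}" by (auto simp: is_ideal_def)
      ultimately have "p dvd eval_mpoly (m(k := x)) (\<delta> i)" using \<delta>(3)[OF i] by blast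
      moreover have "eval_mpoly (m(k := x)) (\<delta> i) = eval_mpoly m1 (\<delta> i)"
        by (rule eval_mpoly_cong[OF \<delta>(1)[OF i]]) (use 2(4) in auto)
      ultimately have "p dvd \<Delta>" unfolding \<Delta>_def using i
        by (metis dvd_prodI dvd_trans finite_lessThan lessThan_iff)
      then show False using False by blast
    qed
  qed
  moreover have "finite {x. eval_mpoly (m(k := x)) P0 = 0}"
  proof -
    have "coeff (u P0) (degree (q P0)) \<noteq> 0" using lc by (simp add: u_def coeff_map_poly)
    then have "u P0 \<noteq> 0" by auto
    then have "finite {x. poly (u P0) x = 0}" by (rule poly_roots_finite)
    then show ?thesis using u[OF P0(1), of m] 2(4) by simp
  qed
  moreover have "\<omega> dvd \<omega>2" using 1(2) 2(2) dvd_trans by blast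
  ultimately show ?thesis using 2(1) by blast
qed

text \<open>
  Without variables the point is irrelevant, so that the hypothesis at any point is the claim.
\<close>

lemma prime_free_specialization_holds:
  fixes Z :: "'a::idom itself"
  assumes inf: "infinite (UNIV :: 'a set)" and fp: "finitely_many_primes Z"
  shows "prime_free_specialization Z k s"
proof (induction k)
  case 0
  show ?case unfolding prime_free_specialization_def
  proof (intro allI impI)
    fix C :: "nat \<Rightarrow> 'a mpoly set" and \<omega> and \<alpha> :: "nat \<Rightarrow> 'a" and P0 :: "'a mpoly"
    assume C: "\<forall>i<s. finite (C i) \<and> C i \<subseteq> mpolys 0 \<and> coprime_in (mpolys 0) (to_fract_mpoly ` C i)"
      and ex: "\<forall>p::'a. prime_elem p \<longrightarrow> (\<exists>m. nonvanishing_mod s C p m)" and P0: "P0 \<in> mpolys 0" "P0 \<noteq> 0"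
    obtain c where "P0 = Poly_Mapping.single 0 c" using mpolys_0E[OF P0(1)] .
    then have "eval_mpoly \<alpha> P0 \<noteq> 0" using P0(2) by auto
    moreover have "nonvanishing_mod s C p \<alpha>" if p: "prime_elem p" for p
    proof -
      obtain m where "nonvanishing_mod s C p m" using ex p by blast
      then show ?thesis by (rule nonvanishing_mod_cong[where k = 0]) (use C in auto)
    qed
    ultimately show "\<exists>m. (\<forall>j<0. \<omega> dvd m j - \<alpha> j) \<and> (\<forall>p. prime_elem p \<longrightarrow> nonvanishing_mod s C p m) \<and> eval_mpoly m P0 \<noteq> 0"
      by blast
  qed
next
  case (Suc k)
  show ?case unfolding prime_free_specialization_def
  proof (intro allI impI)
    fix C :: "nat \<Rightarrow> 'a mpoly set" and \<omega> and \<alpha> :: "nat \<Rightarrow> 'a" and P0 :: "'a mpoly"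
    assume C: "\<forall>i<s. finite (C i) \<and> C i \<subseteq> mpolys (Suc k) \<and> coprime_in (mpolys (Suc k)) (to_fract_mpoly ` C i)"
      and ex: "\<forall>p::'a. prime_elem p \<longrightarrow> (\<exists>m. nonvanishing_mod s C p m)" and P0: "P0 \<in> mpolys (Suc k)" "P0 \<noteq> 0"
      and \<omega>: "\<omega> \<noteq> 0" "\<forall>p. prime_elem p \<longrightarrow> p dvd \<omega> \<longrightarrow> nonvanishing_mod s C p \<alpha>"
    have "\<exists>m \<omega>'. \<omega>' \<noteq> 0 \<and> (\<forall>j<Suc k. \<omega> dvd m j - \<alpha> j) \<and> \<omega> dvd \<omega>' \<and>
      (\<forall>x p. \<omega>' dvd x - m k \<longrightarrow> prime_elem p \<longrightarrow> nonvanishing_mod s C p (m(k := x))) \<and>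
      finite {x. eval_mpoly (m(k := x)) P0 = 0}"
      by (rule specialize_last_variable[OF inf fp Suc]) (use C ex P0 \<omega> in auto)
    then obtain m \<omega>' where m: "\<omega>' \<noteq> 0" "\<And>j. j < Suc k \<Longrightarrow> \<omega> dvd m j - \<alpha> j" "\<omega> dvd \<omega>'"
      "\<And>x p. \<omega>' dvd x - m k \<Longrightarrow> prime_elem p \<Longrightarrow> nonvanishing_mod s C p (m(k := x))"
      "finite {x. eval_mpoly (m(k := x)) P0 = 0}" by blast
    have "inj (\<lambda>l. \<omega>' * l + m k)" using m(1) by (auto simp: inj_on_def)
    then have "infinite (range (\<lambda>l. \<omega>' * l + m k))" using inf by (simp add: finite_image_iff)
    then have "\<not> range (\<lambda>l. \<omega>' * l + m k) \<subseteq> {x. eval_mpoly (m(k := x)) P0 = 0}"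
      using m(5) finite_subset by metis
    then obtain l where l: "eval_mpoly (m(k := \<omega>' * l + m k)) P0 \<noteq> 0" by blast
    have "\<omega> dvd (m(k := \<omega>' * l + m k)) j - \<alpha> j" if "j < Suc k" for j
    proof (cases "j = k")
      case True
      have "\<omega> dvd \<omega>' * l + (m k - \<alpha> k)" using m(2)[of k] m(3) by (intro dvd_add dvd_mult2) auto
      then show ?thesis using True by (simp add: algebra_simps)
    next
      case False then show ?thesis using m(2)[OF that] by simp
    qed
    moreover have "nonvanishing_mod s C p (m(k := \<omega>' * l + m k))" if "prime_elem p" for p
      by (rule m(4)) (use that in auto)
    ultimately show "\<exists>m. (\<forall>j<Suc k. \<omega> dvd m j - \<alpha> j) \<and> (\<forall>p. prime_elem p \<longrightarrow> nonvanishing_mod s C p m) \<and> eval_mpoly m P0 \<noteq> 0"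
      using l by blast
  qed
qed

section \<open>Noetherian rings\<close>

lemma ideal_iff_is_ideal: "ideal I (ring_of_type_algebra :: 'a::comm_ring_1 ring) \<longleftrightarrow> is_ideal I"
proof
  assume "ideal I (ring_of_type_algebra :: 'a ring)"
  then interpret ideal I "ring_of_type_algebra :: 'a ring" .
  show "is_ideal I"
    using additive_subgroup.zero_closed[OF is_additive_subgroup]
      additive_subgroup.a_closed[OF is_additive_subgroup] I_l_closed
    by (auto simp: is_ideal_def ring_of_type_algebra_def)
next
  assume I: "is_ideal I"
  interpret R: ring "ring_of_type_algebra :: 'a ring" by (rule ring_from_type_algebra)
  have carrier: "carrier (ring_of_type_algebra :: 'a ring) = UNIV" by (simp add: ring_of_type_algebra_def)
  have add: "x \<oplus>\<^bsub>(ring_of_type_algebra :: 'a ring)\<^esub> y = x + y" for x y by (simp add: ring_of_type_algebra_def)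
  have minus: "\<ominus>\<^bsub>(ring_of_type_algebra :: 'a ring)\<^esub> x = - x" for x
    by (rule R.minus_equality) (simp_all add: ring_of_type_algebra_def)
  have neg: "- x \<in> I" if "x \<in> I" for x using is_ideal_mult[OF I that, of "-1"] by simp
  show "ideal I (ring_of_type_algebra :: 'a ring)"
  proof (rule idealI[OF ring_from_type_algebra])
    show "subgroup I (add_monoid (ring_of_type_algebra :: 'a ring))"
    proof (rule R.add.subgroupI)
      show "I \<subseteq> carrier ring_of_type_algebra" using carrier by simp
      show "I \<noteq> {}" using is_ideal_zero[OF I] by blast
      show "\<ominus>\<^bsub>(ring_of_type_algebra :: 'a ring)\<^esub> x \<in> I" if "x \<in> I" for x using neg[OF that] minus by simp
      show "x \<oplus>\<^bsub>(ring_of_type_algebra :: 'a ring)\<^esub> y \<in> I" if "x \<in> I" "y \<in> I" for x y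
        using is_ideal_add[OF I that] add by simp
    qed
  qed (use I in \<open>auto simp: ring_of_type_algebra_def intro: is_ideal_mult is_ideal_multR\<close>)
qed

lemma noetherian_maximal:
  fixes \<F> :: "'a::comm_ring_1 set set"
  assumes noeth: "noetherian_ring (ring_of_type_algebra :: 'a ring)"
    and \<F>: "\<F> \<noteq> {}" "\<And>I. I \<in> \<F> \<Longrightarrow> is_ideal I"
  shows "\<exists>M\<in>\<F>. \<forall>I\<in>\<F>. M \<subseteq> I \<longrightarrow> I = M"
proof -
  interpret noetherian_ring "ring_of_type_algebra :: 'a ring" by (rule noeth)
  show ?thesis
  proof (rule subset_Zorn_nonempty[OF \<F>(1)])
    fix \<C> assume C: "\<C> \<noteq> {}" "subset.chain \<F> \<C>"
    have "subset.chain {I. ideal I (ring_of_type_algebra :: 'a ring)} \<C>"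
      using C(2) \<F>(2) unfolding pred_on.chain_def ideal_iff_is_ideal by blast
    then have "\<Union>\<C> \<in> \<C>" by (rule ideal_chain_is_trivial[OF C(1)])
    then show "\<Union>\<C> \<in> \<F>" using C(2) unfolding pred_on.chain_def by blast
  qed
qed

text \<open>
  A maximal principal ideal whose generator violates the claim leads to a contradiction: the generator has a prime
  divisor, and the cofactor generates a larger ideal.
\<close>

lemma noetherian_finitely_many_primes:
  fixes Z :: "'a::idom itself"
  assumes noeth: "noetherian_ring (ring_of_type_algebra :: 'a ring)"
  shows "finitely_many_primes Z"
proof -
  define ok where "ok x \<longleftrightarrow> (\<exists>R. finite R \<and> (\<forall>p\<in>R. prime_elem p) \<and>
        (\<forall>p. prime_elem p \<longrightarrow> p dvd x \<longrightarrow> (\<exists>r\<in>R. r dvd p)))" for x :: 'a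
  have "ok x" if "x \<noteq> 0" for x
  proof (rule ccontr)
    assume "\<not> ok x"
    define \<F> where "\<F> = {{y. x dvd y} | x :: 'a. x \<noteq> 0 \<and> \<not> ok x}"
    have "\<F> \<noteq> {}" using \<open>x \<noteq> 0\<close> \<open>\<not> ok x\<close> unfolding \<F>_def by blast
    moreover have "is_ideal I" if "I \<in> \<F>" for I using that by (auto simp: \<F>_def is_ideal_multiples)
    ultimately have "\<exists>M\<in>\<F>. \<forall>I\<in>\<F>. M \<subseteq> I \<longrightarrow> I = M"
      by (rule noetherian_maximal[OF noeth])
    then obtain M where M: "M \<in> \<F>" "\<And>I. I \<in> \<F> \<Longrightarrow> M \<subseteq> I \<Longrightarrow> I = M"
      by blast
    obtain x where x: "M = {y. x dvd y}" "x \<noteq> 0" "\<not> ok x" using M(1) unfolding \<F>_def by blast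
    have "\<exists>p. prime_elem p \<and> p dvd x"
    proof (rule ccontr)
      assume "\<not> ?thesis"
      then have "ok x" unfolding ok_def by (intro exI[of _ "{}"]) blast
      then show False using x by blast
    qed
    then obtain p y where p: "prime_elem p" and xy: "x = p * y" by blast
    have "\<not> x dvd y"
    proof
      assume "x dvd y"
      then obtain c where "y = x * c" by blast
      then have "x * 1 = x * (p * c)" using xy by (metis mult.assoc mult.commute mult_1_right)
      then have "1 = p * c" using x(2) by (metis mult_left_cancel)
      then show False using p by (metis dvd_triv_left prime_elem_not_unit)
    qed
    then have "y \<notin> M" using x(1) by simp
    moreover have "y \<in> {z. y dvd z}" by simp
    ultimately have "{z. y dvd z} \<noteq> M" by metis
    moreover have "M \<subseteq> {z. y dvd z}" using x(1) xy by auto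
    ultimately have "{z. y dvd z} \<notin> \<F>" using M(2) by blast
    moreover have "y \<noteq> 0" using x xy by auto
    ultimately have "ok y" unfolding \<F>_def by blast
    then obtain R where R: "finite R" "\<And>p. p \<in> R \<Longrightarrow> prime_elem p"
        "\<And>p. prime_elem p \<Longrightarrow> p dvd y \<Longrightarrow> (\<exists>r\<in>R. r dvd p)" unfolding ok_def by blast
    have "\<exists>r\<in>insert p R. r dvd q" if "prime_elem q" "q dvd x" for q
      using that R(3) prime_elem_assoc[OF p, of q] unfolding xy by (auto simp: prime_elem_dvd_mult_iff)
    then have "ok x" unfolding ok_def using R p by (intro exI[of _ "insert p R"]) auto
    then show False using x by blast
  qed
  then show ?thesis unfolding finitely_many_primes_def ok_def by blast
qed

section \<open>Dedekind domains\<close>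

definition is_maximal :: "'a::comm_ring_1 set \<Rightarrow> bool" where
  "is_maximal M \<longleftrightarrow> is_ideal M \<and> 1 \<notin> M \<and> (\<forall>J. is_ideal J \<longrightarrow> M \<subseteq> J \<longrightarrow> 1 \<notin> J \<longrightarrow> J = M)"

lemma is_maximalD: "is_maximal M \<Longrightarrow> is_ideal J \<Longrightarrow> M \<subseteq> J \<Longrightarrow> 1 \<notin> J \<Longrightarrow> J = M"
  by (simp add: is_maximal_def)

lemma is_maximal_inverse:
  assumes M: "is_maximal M" and u: "u \<notin> M"
  shows "\<exists>w. 1 - u * w \<in> M"
proof -
  have M': "is_ideal M" using M by (simp add: is_maximal_def)
  let ?J = "ideal_sum M {y. u dvd y}"
  note J = ideal_sum[OF M' is_ideal_multiples[of u]]
  have "u \<in> ?J" using J(3) by (rule subsetD) simp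
  then have "?J \<noteq> M" using u by metis
  then have "1 \<in> ?J" using is_maximalD[OF M J(1,2)] by metis
  then obtain q y where "q \<in> M" "u dvd y" and qy: "q + y = 1" unfolding ideal_sum_def by force
  then obtain w where w: "y = u * w" by blast
  have "1 - u * w = q" unfolding qy[symmetric] w by (rule add_diff_cancel_right')
  then show ?thesis using \<open>q \<in> M\<close> by blast
qed

lemma is_maximal_prime:
  assumes M: "is_maximal M" and xy: "x * y \<in> M"
  shows "x \<in> M \<or> y \<in> M"
proof (rule ccontr)
  assume not: "\<not> ?thesis"
  have M': "is_ideal M" using M by (simp add: is_maximal_def)
  obtain w where w: "1 - x * w \<in> M" using is_maximal_inverse[OF M] not by blast
  have "y = (1 - x * w) * y + w * (x * y)" by (simp add: algebra_simps)
  also have "\<dots> \<in> M" by (intro is_ideal_add[OF M'] is_ideal_multR[OF M' w] is_ideal_mult[OF M' xy])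
  finally show False using not by blast
qed

locale dedekind =
  fixes Z :: "'a::idom itself"
  assumes dedekind: "dedekind_domain Z"
begin

lemma noeth: "noetherian_ring (ring_of_type_algebra :: 'a ring)"
  using dedekind by (simp add: dedekind_domain_def)

lemma maximal_exists:
  assumes "is_ideal (I :: 'a set)" "1 \<notin> I"
  obtains M where "is_maximal M" "I \<subseteq> M"
proof -
  define \<F> where "\<F> = {J. is_ideal J \<and> I \<subseteq> J \<and> (1::'a) \<notin> J}"
  have "\<F> \<noteq> {}" using assms by (auto simp: \<F>_def)
  moreover have "is_ideal J" if "J \<in> \<F>" for J using that by (simp add: \<F>_def)
  ultimately have "\<exists>M\<in>\<F>. \<forall>I\<in>\<F>. M \<subseteq> I \<longrightarrow> I = M"
    by (rule noetherian_maximal[OF noeth])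
  then obtain M where M: "M \<in> \<F>" "\<And>J. J \<in> \<F> \<Longrightarrow> M \<subseteq> J \<Longrightarrow> J = M"
    by blast
  have "is_maximal M" unfolding is_maximal_def
  proof (intro conjI allI impI)
    show "is_ideal M" "1 \<notin> M" using M(1) by (auto simp: \<F>_def)
    fix J assume J: "is_ideal J" "M \<subseteq> J" "1 \<notin> J"
    then have "J \<in> \<F>" using M(1) by (auto simp: \<F>_def)
    then show "J = M" using M(2) J by blast
  qed
  moreover have "I \<subseteq> M" using M(1) by (auto simp: \<F>_def)
  ultimately show thesis by (rule that)
qed

lemma prime_ideal_maximal:
  fixes Q :: "'a set"
  assumes Q: "is_ideal Q" "1 \<notin> Q" and prime: "\<And>x y. x * y \<in> Q \<Longrightarrow> x \<in> Q \<or> y \<in> Q"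
    and "x \<in> Q" "x \<noteq> 0"
  shows "is_maximal Q"
proof -
  have "primeideal Q (ring_of_type_algebra :: 'a ring)"
  proof (rule primeidealI)
    show "ideal Q (ring_of_type_algebra :: 'a ring)" using Q by (simp add: ideal_iff_is_ideal)
    show "cring (ring_of_type_algebra :: 'a ring)" by (rule cring_from_type_algebra)
  qed (use Q prime in \<open>auto simp: ring_of_type_algebra_def\<close>)
  moreover have "Q \<noteq> {0}" using assms by blast
  ultimately have "maximalideal Q (ring_of_type_algebra :: 'a ring)"
    using dedekind unfolding dedekind_domain_def by blast
  then interpret maximalideal Q "ring_of_type_algebra :: 'a ring" .
  show ?thesis unfolding is_maximal_def
  proof (intro conjI allI impI Q)
    fix J assume J: "is_ideal J" "Q \<subseteq> J" "1 \<notin> J"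
    have "J \<subseteq> carrier (ring_of_type_algebra :: 'a ring)" by (simp add: ring_of_type_algebra_def)
    then have "J = Q \<or> J = carrier (ring_of_type_algebra :: 'a ring)"
      using J by (intro I_maximal) (simp_all add: ideal_iff_is_ideal)
    then show "J = Q" using J(3) by (auto simp: ring_of_type_algebra_def)
  qed
qed

text \<open>
  If all powers of \<open>x = b / a\<close> have the common denominator \<open>c\<close>, the elements \<open>c * x ^ n\<close> generate a
  finitely generated ideal of \<open>Z\<close>.  The relation that expresses one of them by the previous ones shows that \<open>x\<close> is
  integral over \<open>Z\<close>.
\<close>

lemma completely_integrally_closed:
  fixes a b c :: 'a
  assumes a: "a \<noteq> 0" and c: "c \<noteq> 0" and dvd: "\<And>n. a ^ n dvd c * b ^ n"
  shows "a dvd b"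
proof -
  define x where "x = to_fract b / to_fract a"
  obtain d where d: "\<And>n. c * b ^ n = a ^ n * d n" using dvd unfolding dvd_def by metis
  have to_fract_power: "to_fract (y ^ n) = to_fract y ^ n" for y :: 'a and n by (induction n) auto
  have dx: "to_fract (d n) = to_fract c * x ^ n" for n
  proof -
    have "to_fract c * to_fract b ^ n = to_fract a ^ n * to_fract (d n)"
      using arg_cong[OF d[of n], of to_fract] by (simp add: to_fract_power)
    then show ?thesis using a by (simp add: x_def power_divide field_simps)
  qed
  define L where "L n = {\<Sum>i\<le>n. r i * d i | r. True}" for n
  have L: "is_ideal (L n)" for n
    unfolding is_ideal_def
  proof (intro conjI ballI allI)
    show "0 \<in> L n" unfolding L_def by (auto intro!: exI[of _ "\<lambda>_. 0"])
    fix y y' assume "y \<in> L n" "y' \<in> L n"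
    then obtain r r' where "y = (\<Sum>i\<le>n. r i * d i)" "y' = (\<Sum>i\<le>n. r' i * d i)" unfolding L_def by blast
    then have "y + y' = (\<Sum>i\<le>n. (r i + r' i) * d i)" by (simp add: distrib_right sum.distrib)
    then show "y + y' \<in> L n" unfolding L_def by (auto intro!: exI[of _ "\<lambda>i. r i + r' i"])
  next
    fix y e assume "y \<in> L n"
    then obtain r where "y = (\<Sum>i\<le>n. r i * d i)" unfolding L_def by blast
    then have "e * y = (\<Sum>i\<le>n. (e * r i) * d i)" by (simp add: sum_distrib_left mult.assoc)
    then show "e * y \<in> L n" unfolding L_def by (auto intro!: exI[of _ "\<lambda>i. e * r i"])
  qed
  have dL: "d i \<in> L n" if "i \<le> n" for i n
  proof -
    have "d i = (\<Sum>j\<le>n. (if j = i then 1 else 0) * d j)"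
      using that by (simp add: if_distrib[of "\<lambda>x. x * _"] cong: if_cong)
    then show ?thesis unfolding L_def by (auto intro!: exI[of _ "\<lambda>j. if j = i then 1 else 0"])
  qed
  have mono: "L n \<subseteq> L (Suc n)" for n
  proof
    fix y assume "y \<in> L n"
    then obtain r where "y = (\<Sum>i\<le>n. r i * d i)" unfolding L_def by blast
    then show "y \<in> L (Suc n)"
      using dL[of _ "Suc n"] by (auto intro!: is_ideal_sum[OF L] is_ideal_mult[OF L])
  qed
  have "range L \<noteq> {}" "\<And>I. I \<in> range L \<Longrightarrow> is_ideal I" using L by auto
  then have "\<exists>M\<in>range L. \<forall>I\<in>range L. M \<subseteq> I \<longrightarrow> I = M"
    by (rule noetherian_maximal[OF noeth])
  then obtain M where M: "M \<in> range L" and M2: "\<forall>I\<in>range L. M \<subseteq> I \<longrightarrow> I = M"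
    by (rule bexE)
  obtain n where n: "M = L n" using M by (rule rangeE)
  have "L (Suc n) = L n" using M2[rule_format, OF rangeI] mono unfolding n .
  then have "d (Suc n) \<in> L n" using dL[of "Suc n" "Suc n"] by simp
  then obtain r where r: "d (Suc n) = (\<Sum>i\<le>n. r i * d i)" unfolding L_def by blast
  have "to_fract c * x ^ Suc n = to_fract c * (\<Sum>i\<le>n. to_fract (r i) * x ^ i)"
    using arg_cong[OF r, of to_fract] by (simp add: dx sum_distrib_left mult_ac)
  then have rx: "x ^ Suc n = (\<Sum>i\<le>n. to_fract (r i) * x ^ i)" using c by simp
  define f where "f = Polynomial.monom 1 (Suc n) - (\<Sum>i\<le>n. Polynomial.monom (r i) i)"
  have coeff: "coeff f j = (if j = Suc n then 1 else if j \<le> n then - r j else 0)" for j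
    by (simp add: f_def coeff_sum)
  have deg: "degree f = Suc n"
    by (intro antisym degree_le le_degree) (auto simp: coeff)
  have "poly (map_poly to_fract f) x = (\<Sum>i\<le>Suc n. to_fract (coeff f i) * x ^ i)"
    by (simp add: poly_altdef degree_map_poly coeff_map_poly deg)
  also have "\<dots> = 0" using rx by (simp add: coeff sum_negf)
  finally have "poly (map_poly to_fract f) x = 0" .
  moreover have "lead_coeff f = 1" by (simp add: deg coeff)
  ultimately have "x \<in> range to_fract" using dedekind unfolding dedekind_domain_def by blast
  then obtain e where "x = to_fract e" by (rule imageE)
  then have "to_fract b = to_fract (a * e)" using a by (simp add: x_def field_simps)
  then show ?thesis by (simp only: to_fract_eq_iff dvd_triv_left)
qed

lemma dvd_if_stabilizes_ideal:
  fixes a b :: 'a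
  assumes a: "a \<noteq> 0" and K: "y \<in> K" "y \<noteq> 0" and stab: "\<And>y. y \<in> K \<Longrightarrow> \<exists>y'\<in>K. b * y = a * y'"
  shows "a dvd b"
proof (rule completely_integrally_closed[OF a K(2)])
  fix n
  have "\<exists>y'\<in>K. y * b ^ n = a ^ n * y'"
  proof (induction n)
    case 0 then show ?case using K by auto
  next
    case (Suc n)
    then obtain y' where y': "y' \<in> K" "y * b ^ n = a ^ n * y'" by blast
    then obtain y'' where "y'' \<in> K" "b * y' = a * y''" using stab by blast
    moreover have "y * b ^ Suc n = a ^ n * (b * y')" using y'(2) by (simp add: mult_ac)
    ultimately show ?case by (intro bexI[of _ y'']) (simp_all add: mult_ac)
  qed
  then show "a ^ n dvd y * b ^ n" by auto
qed

text \<open>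
  The fraction \<open>b / a\<close> multiplies \<open>M\<close> into \<open>Z\<close> without belonging to \<open>Z\<close>.  To find it, choose \<open>b\<close> such that
  the annihilator of \<open>b\<close> modulo \<open>a\<close> is maximal among those contained in \<open>M\<close>.  This annihilator is prime and
  nonzero, hence maximal, hence equal to \<open>M\<close>.
\<close>

lemma inverse_of_maximal_ideal:
  assumes M: "is_maximal M" and a: "a \<in> M" "(a::'a) \<noteq> 0"
  shows "\<exists>b. \<not> a dvd b \<and> (\<forall>y\<in>M. a dvd b * y)"
proof -
  have M': "is_ideal M" "1 \<notin> M" using M by (simp_all add: is_maximal_def)
  define Q where "Q b = {y. a dvd b * y}" for b
  have Qi: "is_ideal (Q b)" for b
    using is_ideal_vimage[OF is_ideal_multiples[of a]] by (simp add: Q_def)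
  define \<F> where "\<F> = {Q b | b. Q b \<subseteq> M}"
  have "Q 1 \<subseteq> M" using a is_ideal_multR[OF M'(1) a(1)] by (auto simp: Q_def elim!: dvdE)
  then have "\<F> \<noteq> {}" by (auto simp: \<F>_def)
  moreover have "is_ideal I" if "I \<in> \<F>" for I using that Qi by (auto simp: \<F>_def)
  ultimately have "\<exists>M\<in>\<F>. \<forall>I\<in>\<F>. M \<subseteq> I \<longrightarrow> I = M"
    by (rule noetherian_maximal[OF noeth])
  then obtain P where P: "P \<in> \<F>" "\<And>I. I \<in> \<F> \<Longrightarrow> P \<subseteq> I \<Longrightarrow> I = P"
    by blast
  obtain b where b: "P = Q b" "Q b \<subseteq> M" using P(1) by (auto simp: \<F>_def)
  have max: "Q c = Q b" if "Q c \<subseteq> M" "Q b \<subseteq> Q c" for c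
    using P(2)[of "Q c"] that b by (auto simp: \<F>_def)
  have prime: "x \<in> Q b \<or> y \<in> Q b" if xy: "x * y \<in> Q b" for x y
  proof (rule ccontr)
    assume not: "\<not> ?thesis"
    have sub: "Q b \<subseteq> Q (b * x)" for x
      by (auto simp: Q_def mult.commute[of b x] mult.assoc intro: dvd_mult)
    have "y \<in> Q (b * x)" using xy by (simp add: Q_def mult.assoc)
    then have "\<not> Q (b * x) \<subseteq> M" using max sub not by blast
    then obtain z where z: "z \<in> Q (b * x)" "z \<notin> M" by blast
    have "Q (b * z) \<subseteq> M"
    proof
      fix w assume "w \<in> Q (b * z)"
      then have "z * w \<in> Q b" by (simp add: Q_def mult.assoc)
      then show "w \<in> M" using b z(2) is_maximal_prime[OF M] by blast
    qed
    then have "Q (b * z) = Q b" using max sub by blast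
    moreover have "x \<in> Q (b * z)" using z(1) by (simp add: Q_def mult_ac)
    ultimately show False using not by blast
  qed
  have "a \<in> Q b" by (simp add: Q_def)
  then have "is_maximal (Q b)" using prime_ideal_maximal[OF Qi _ prime _ a(2)] b M' by blast
  then have "Q b = M" using b M' unfolding is_maximal_def by blast
  then have "\<not> a dvd b" "\<forall>y\<in>M. a dvd b * y" using M'(2) by (auto simp: Q_def)
  then show ?thesis by blast
qed

text \<open>
  The localization at \<open>M\<close> is a discrete valuation ring; in terms of elements, \<open>K\<close> is generated by \<open>g\<close>
  up to factors \<open>s\<close> outside \<open>M\<close>.  With \<open>x = b / a\<close> as in \<open>inverse_of_maximal_ideal\<close>, an ideal \<open>K\<close> which is maximal
  among the counterexamples is strictly contained in \<open>K + x * K\<close>, as otherwise \<open>x\<close> would be integral.  A local generator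
  of the larger ideal, multiplied by an element \<open>\<pi>\<close> of \<open>M\<close> with \<open>x * \<pi>\<close> outside \<open>M\<close>, is one for \<open>K\<close>.
\<close>

lemma locally_principal:
  assumes M: "is_maximal M" and a: "a \<in> M" "(a::'a) \<noteq> 0"
    and K: "is_ideal K" "y \<in> K" "y \<noteq> 0"
  shows "\<exists>g\<in>K. \<exists>s. s \<notin> M \<and> (\<forall>y\<in>K. g dvd s * y)"
proof (rule ccontr)
  let ?P = "\<lambda>K. \<exists>g\<in>K. \<exists>s. s \<notin> M \<and> (\<forall>y\<in>K. g dvd s * y)"
  assume "\<not> ?P K"
  have M': "is_ideal M" "1 \<notin> M" using M by (simp_all add: is_maximal_def)
  obtain b where b: "\<not> a dvd b" "\<And>y. y \<in> M \<Longrightarrow> a dvd b * y"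
    using inverse_of_maximal_ideal[OF M a] by blast
  obtain \<pi> where pi: "\<pi> \<in> M" "\<And>s. s \<in> M \<Longrightarrow> b * \<pi> \<noteq> a * s"
    using dvd_if_stabilizes_ideal[OF a(2) a, of b] b(1) by blast
  obtain t where t: "b * \<pi> = a * t" using b(2)[OF pi(1)] by blast
  have tM: "t \<notin> M" using pi(2) t by blast
  define \<F> where "\<F> = {K. is_ideal K \<and> (\<exists>y\<in>K. y \<noteq> 0) \<and> \<not> ?P K}"
  have "\<F> \<noteq> {}" using K \<open>\<not> ?P K\<close> unfolding \<F>_def by blast
  moreover have "is_ideal I" if "I \<in> \<F>" for I using that by (auto simp: \<F>_def)
  ultimately have "\<exists>M\<in>\<F>. \<forall>I\<in>\<F>. M \<subseteq> I \<longrightarrow> I = M"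
    by (rule noetherian_maximal[OF noeth])
  then obtain K where K: "K \<in> \<F>" and max: "\<And>I. I \<in> \<F> \<Longrightarrow> K \<subseteq> I \<Longrightarrow> I = K"
    by blast
  have Ki: "is_ideal K" and notP: "\<not> ?P K" using K by (auto simp: \<F>_def)
  obtain y0 where y0: "y0 \<in> K" "y0 \<noteq> 0" using K by (auto simp: \<F>_def)
  have KM: "K \<subseteq> M"
  proof
    fix g assume "g \<in> K"
    then show "g \<in> M" using notP by (metis dvd_triv_left)
  qed
  \<comment> \<open>\<open>V\<close> is \<open>(b / a) * K\<close>.\<close>
  define V where "V = {v. \<exists>y\<in>K. a * v = b * y}"
  have Vi: "is_ideal V"
    unfolding is_ideal_def
  proof (intro conjI ballI allI)
    show "0 \<in> V" using is_ideal_zero[OF Ki] by (auto simp: V_def)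
    fix v v' assume "v \<in> V" "v' \<in> V"
    then obtain y y' where "y \<in> K" "y' \<in> K" "a * v = b * y" "a * v' = b * y'" by (auto simp: V_def)
    then show "v + v' \<in> V" unfolding V_def using is_ideal_add[OF Ki]
      by (auto simp: distrib_left intro!: bexI[of _ "y + y'"])
  next
    fix v c assume "v \<in> V"
    then obtain y where y: "y \<in> K" "a * v = b * y" by (auto simp: V_def)
    have "a * (c * v) = b * (c * y)" using y(2) by (metis mult.left_commute)
    then show "c * v \<in> V" unfolding V_def using is_ideal_mult[OF Ki y(1)] by blast
  qed
  let ?K = "ideal_sum K V"
  note S = ideal_sum[OF Ki Vi]
  have "?K \<noteq> K"
  proof
    assume eq: "?K = K"
    have "\<exists>y'\<in>K. b * y = a * y'" if y: "y \<in> K" for y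
    proof -
      obtain v where v: "b * y = a * v" using b(2) y KM by blast
      then have "v \<in> V" using y unfolding V_def by force
      then show ?thesis using v S(3) eq by blast
    qed
    then have "a dvd b" using dvd_if_stabilizes_ideal[OF a(2) y0] by blast
    then show False using b(1) by blast
  qed
  then have "?K \<notin> \<F>" using max S(2) by blast
  then have "?P ?K" using S y0 unfolding \<F>_def by blast
  then obtain g s where g: "g \<in> ?K" "s \<notin> M" "\<And>y. y \<in> ?K \<Longrightarrow> g dvd s * y" by blast
  have piV: "\<exists>y\<in>K. \<pi> * v = t * y" if "v \<in> V" for v
  proof -
    obtain y where y: "y \<in> K" "a * v = b * y" using \<open>v \<in> V\<close> by (auto simp: V_def)
    have "a * (\<pi> * v) = \<pi> * (a * v)" by (rule mult.left_commute)
    also have "\<dots> = (b * \<pi>) * y" unfolding y(2) by (simp add: mult_ac)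
    also have "\<dots> = a * (t * y)" unfolding t by (simp add: mult_ac)
    finally show ?thesis using a(2) y(1) by auto
  qed
  obtain u v where uv: "u \<in> K" "v \<in> V" "g = u + v" using g(1) by (auto simp: ideal_sum_def)
  obtain y1 where y1: "y1 \<in> K" "\<pi> * v = t * y1" using piV[OF uv(2)] by blast
  have "\<pi> * g = \<pi> * u + t * y1" using uv(3) y1(2) by (simp add: distrib_left)
  then have "\<pi> * g \<in> K" using uv(1) y1(1) is_ideal_add[OF Ki] is_ideal_mult[OF Ki] by simp
  moreover have "s * t \<notin> M" using g(2) tM is_maximal_prime[OF M] by blast
  moreover have "\<pi> * g dvd s * t * y" if y: "y \<in> K" for y
  proof -
    obtain v where v: "b * y = a * v" using b(2) y KM by blast
    then have vV: "v \<in> V" using y unfolding V_def by force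
    have "a * (\<pi> * v) = (b * \<pi>) * y" using v by (metis mult.assoc mult.commute)
    then have "a * (\<pi> * v) = a * (t * y)" unfolding t by (simp add: mult_ac)
    then have "\<pi> * v = t * y" using a(2) by simp
    then have "s * t * y = \<pi> * (s * v)" by (simp add: mult_ac)
    moreover have "g dvd s * v" using g(3) vV S(3) by blast
    then have "\<pi> * g dvd \<pi> * (s * v)" by (rule mult_dvd_mono[OF dvd_refl])
    ultimately show ?thesis by (simp only:)
  qed
  ultimately show False using notP by blast
qed

text \<open>
  Locally at each maximal ideal one of \<open>I\<close> and \<open>J\<close> contains the other: if \<open>g1 + g2\<close>, with \<open>g1\<close> in \<open>I\<close> and \<open>g2\<close> in \<open>J\<close>, is
  a local generator of \<open>I + J\<close>, then so is one of \<open>g1\<close> and \<open>g2\<close>.  Hence no maximal ideal contains both of the ideals \<open>(I : J)\<close> and \<open>(J : I)\<close>.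
\<close>

lemma comparable_ideals:
  fixes I J :: "'a set"
  assumes I: "is_ideal I" "x \<in> I" "x \<noteq> 0" and J: "is_ideal J"
  shows "\<exists>u v. u + v = 1 \<and> (\<forall>y\<in>J. u * y \<in> I) \<and> (\<forall>y\<in>I. v * y \<in> J)"
proof -
  have colon: "is_ideal {u. \<forall>y\<in>J. u * y \<in> I}" if "is_ideal I" for I J :: "'a set"
    using that unfolding is_ideal_def by (auto simp: distrib_right mult.assoc)
  let ?T = "ideal_sum {u. \<forall>y\<in>J. u * y \<in> I} {v. \<forall>y\<in>I. v * y \<in> J}"
  note T = ideal_sum[OF colon[OF I(1), of J] colon[OF J, of I]]
  have "1 \<in> ?T"
  proof (rule ccontr)
    assume "1 \<notin> ?T"
    then obtain M where M: "is_maximal M" "?T \<subseteq> M" using maximal_exists[OF T(1)] by blast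
    have "x \<in> ?T" using T(2) is_ideal_multR[OF I(1,2)] by blast
    let ?K = "ideal_sum I J"
    note K = ideal_sum[OF I(1) J]
    have "\<exists>g\<in>?K. \<exists>s. s \<notin> M \<and> (\<forall>y\<in>?K. g dvd s * y)"
      using locally_principal[OF M(1) _ I(3) K(1) _ I(3)] \<open>x \<in> ?T\<close> M(2) K(2) I(2) by blast
    then obtain g s where g: "g \<in> ?K" "s \<notin> M" "\<And>y. y \<in> ?K \<Longrightarrow> g dvd s * y" by blast
    have M': "is_ideal M" using M(1) by (simp add: is_maximal_def)
    have s0: "s \<noteq> 0" using g(2) is_ideal_zero[OF M'] by blast
    have "x \<in> ?K" using K(2) I(2) by blast
    then have g0: "g \<noteq> 0" using g(3) s0 I(3) by fastforce
    obtain g1 g2 where g12: "g1 \<in> I" "g2 \<in> J" "g = g1 + g2" using g(1) by (auto simp: ideal_sum_def)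
    obtain r1 where r1: "s * g1 = g * r1" using g(3)[of g1] g12 K(2) by blast
    obtain r2 where r2: "s * g2 = g * r2" using g(3)[of g2] g12 K(3) by blast
    have "g * s = g * (r1 + r2)" using r1 r2 g12(3) by (metis distrib_left mult.commute)
    then have s: "s = r1 + r2" using g0 by simp
    have transfer: "r * y \<in> H" if H: "is_ideal H" "h \<in> H" and r: "s * h = g * r" and y: "y \<in> ?K" for r h H y
    proof -
      obtain z where z: "s * y = g * z" using g(3)[OF y] by blast
      have "s * (r * y) = r * (s * y)" by (simp add: mult_ac)
      also have "\<dots> = z * (s * h)" unfolding z r by (simp add: mult_ac)
      also have "\<dots> = s * (z * h)" by (simp add: mult_ac)
      finally have "r * y = z * h" using s0 by simp
      then show ?thesis using is_ideal_mult[OF H] by simp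
    qed
    have "r1 \<in> ?T" using transfer[OF I(1) g12(1) r1] T(2) K(3) by blast
    moreover have "r2 \<in> ?T" using transfer[OF J g12(2) r2] T(3) K(2) by blast
    ultimately have "s \<in> M" using M(2) s is_ideal_add[OF M'] by blast
    then show False using g(2) by blast
  qed
  then show ?thesis unfolding ideal_sum_def by force
qed

text \<open>
  Modulo \<open>\<delta>\<close> all prime ideals are maximal.  The elements \<open>u ^ n * (1 - u * w)\<close> form a multiplicative set; an ideal
  that contains \<open>\<delta>\<close> and is maximal among those that avoid this set is prime, hence maximal.  It does not contain
  \<open>u\<close>, so it contains some \<open>1 - u * w\<close>, which is in the set.
\<close>

lemma pi_regular:
  fixes \<delta> u :: 'a
  assumes \<delta>: "\<delta> \<noteq> 0"
  shows "\<exists>n w. \<delta> dvd u ^ n * (1 - u * w)"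
proof (rule ccontr)
  assume not: "\<not> ?thesis"
  define \<F> where "\<F> = {Q. is_ideal Q \<and> \<delta> \<in> Q \<and> (\<forall>n w. u ^ n * (1 - u * w) \<notin> Q)}"
  have "{y. \<delta> dvd y} \<in> \<F>" using not is_ideal_multiples by (auto simp: \<F>_def)
  then have "\<F> \<noteq> {}" by blast
  moreover have "is_ideal I" if "I \<in> \<F>" for I using that by (auto simp: \<F>_def)
  ultimately have "\<exists>M\<in>\<F>. \<forall>I\<in>\<F>. M \<subseteq> I \<longrightarrow> I = M"
    by (rule noetherian_maximal[OF noeth])
  then obtain Q where Q: "Q \<in> \<F>" and max: "\<And>I. I \<in> \<F> \<Longrightarrow> Q \<subseteq> I \<Longrightarrow> I = Q"
    by blast
  have Qi: "is_ideal Q" "\<delta> \<in> Q" "\<And>n w. u ^ n * (1 - u * w) \<notin> Q" using Q by (auto simp: \<F>_def)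
  have hit: "\<exists>q r n w. q \<in> Q \<and> u ^ n * (1 - u * w) = q + x * r" if x: "x \<notin> Q" for x
  proof -
    note S = ideal_sum[OF Qi(1) is_ideal_multiples[of x]]
    have "x \<in> ideal_sum Q {y. x dvd y}" using S(3) by (rule subsetD) simp
    then have "ideal_sum Q {y. x dvd y} \<notin> \<F>" using max S(2) x by blast
    then obtain n w where "u ^ n * (1 - u * w) \<in> ideal_sum Q {y. x dvd y}"
      using S Qi(2) unfolding \<F>_def by blast
    then show ?thesis unfolding ideal_sum_def by (auto elim!: dvdE)
  qed
  have prime: "x \<in> Q \<or> y \<in> Q" if xy: "x * y \<in> Q" for x y
  proof (rule ccontr)
    assume "\<not> ?thesis"
    then obtain q r n w q' r' n' w' where 1: "q \<in> Q" "u ^ n * (1 - u * w) = q + x * r"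
      and 2: "q' \<in> Q" "u ^ n' * (1 - u * w') = q' + y * r'" using hit by metis
    have "u ^ (n + n') * (1 - u * (w + w' - u * w * w')) = (u ^ n * (1 - u * w)) * (u ^ n' * (1 - u * w'))"
      by (simp add: power_add algebra_simps)
    also have "\<dots> = q * (q' + y * r') + q' * (x * r) + (x * y) * (r * r')"
      unfolding 1(2) 2(2) by (simp add: algebra_simps)
    also have "\<dots> \<in> Q"
      by (intro is_ideal_add[OF Qi(1)] is_ideal_multR[OF Qi(1)] 1(1) 2(1) xy)
    finally show False using Qi(3) by blast
  qed
  have "1 \<notin> Q" using Qi(3)[of 0 0] by simp
  then have Qm: "is_maximal Q" using prime_ideal_maximal[OF Qi(1) _ prime Qi(2) \<delta>] by blast
  have "u \<notin> Q" using Qi(3)[of 1 0] by simp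
  then obtain w where "1 - u * w \<in> Q" using is_maximal_inverse[OF Qm] by blast
  then show False using Qi(3)[of 0 w] by simp
qed

text \<open>
  A power of \<open>u * w\<close> for the \<open>w\<close> of \<open>pi_regular\<close> is idempotent modulo \<open>\<delta>\<close>: it is \<open>0\<close> at the primes that contain \<open>u\<close>
  and \<open>1\<close> at the others.  Its complement is supported at the primes that contain \<open>u = 1 - v\<close>, where \<open>v\<close> is invertible,
  and is therefore a multiple of \<open>v\<close> modulo \<open>\<delta>\<close>.
\<close>

lemma idempotent_modulo:
  fixes \<delta> u v :: 'a
  assumes \<delta>: "\<delta> \<noteq> 0" and uv: "u + v = 1"
  shows "\<exists>e w w'. \<delta> dvd e * (1 - e) \<and> \<delta> dvd e - u * w \<and> \<delta> dvd (1 - e) - v * w'"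
proof -
  obtain n0 w where n0: "\<delta> dvd u ^ n0 * (1 - u * w)" using pi_regular[OF \<delta>] by blast
  define n where "n = Suc n0"
  have n: "\<delta> dvd u ^ n * (1 - u * w)"
    using dvd_mult[OF n0, of u] by (simp add: n_def mult.assoc)
  define e where "e = (u * w) ^ n"
  have "1 - u * w dvd 1 ^ n - (u * w) ^ n" by (rule cong_power) simp
  then obtain h where h: "1 - e = (1 - u * w) * h" unfolding e_def by (auto elim: dvdE)
  have ann: "\<delta> dvd u ^ n * (1 - e)" unfolding h using dvd_mult2[OF n, of h] by (simp add: mult.assoc)
  have "e * (1 - e) = w ^ n * (u ^ n * (1 - e))" by (simp add: e_def power_mult_distrib mult_ac)
  then have "\<delta> dvd e * (1 - e)" using dvd_mult[OF ann, of "w ^ n"] by (simp only:)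
  moreover have "e = u * (w * (u * w) ^ n0)" by (simp add: e_def n_def mult_ac)
  then have "\<delta> dvd e - u * (w * (u * w) ^ n0)" by simp
  moreover have "\<exists>w'. \<delta> dvd (1 - e) - v * w'"
  proof -
    have "v dvd 1 - u" using uv by (metis add_diff_cancel_left' dvd_refl)
    then have "v dvd 1 ^ n - u ^ n" by (rule cong_power)
    then obtain t where t: "1 - u ^ n = v * t" by (auto elim: dvdE)
    have "(1 - e) - v * (t * (1 - e)) = (1 - e) - (1 - u ^ n) * (1 - e)" unfolding t by (simp add: mult.assoc)
    also have "\<dots> = u ^ n * (1 - e)" by (simp add: left_diff_distrib)
    finally show ?thesis using ann by metis
  qed
  ultimately show ?thesis by blast
qed

text \<open>
  The functions \<open>g i\<close> are polynomial functions, of which only the compatibility with congruences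
  matters.  As \<open>\<delta>\<close> lies in all the ideals, computations may be done modulo \<open>\<delta>\<close>, where the point \<open>e * x + (1 - e) * y\<close>
  agrees with \<open>x\<close> on the component of \<open>e\<close> and with \<open>y\<close> on the other one.
\<close>

lemma largest_value_ideal:
  fixes g :: "'i \<Rightarrow> 'a \<Rightarrow> 'a"
  assumes cong: "\<And>i x y. i \<in> S \<Longrightarrow> x - y dvd g i x - g i y"
    and \<delta>: "\<delta> \<noteq> 0" "\<And>x. \<delta> \<in> ideal_gen ((\<lambda>i. g i x) ` S)"
  shows "\<exists>x. \<forall>y. ideal_gen ((\<lambda>i. g i y) ` S) \<subseteq> ideal_gen ((\<lambda>i. g i x) ` S)"
proof -
  define I where "I x = ideal_gen ((\<lambda>i. g i x) ` S)" for x
  have I: "is_ideal (I x)" for x by (simp add: I_def is_ideal_gen)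
  have gI: "g i x \<in> I x" if "i \<in> S" for i x using ideal_gen_superset that by (force simp: I_def)
  have least: "I x \<subseteq> J" if "is_ideal J" "\<And>i. i \<in> S \<Longrightarrow> g i x \<in> J" for x J
    unfolding I_def using that by (intro ideal_gen_least) auto
  have \<delta>I: "\<delta> \<in> I x" for x using \<delta>(2) by (simp add: I_def)
  have mod: "y \<in> I x" if dvd: "\<delta> dvd y - y'" and mem: "y' \<in> I x" for x y y'
  proof -
    obtain c where "y - y' = \<delta> * c" using dvd by blast
    then have "y = \<delta> * c + y'" by (simp add: algebra_simps)
    then show ?thesis using is_ideal_add[OF I is_ideal_multR[OF I \<delta>I] mem] by simp
  qed
  have "\<exists>m. I x \<subseteq> I m \<and> I y \<subseteq> I m" for x y
  proof -
    obtain u v where uv: "u + v = 1" "\<And>z. z \<in> I y \<Longrightarrow> u * z \<in> I x" "\<And>z. z \<in> I x \<Longrightarrow> v * z \<in> I y"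
      using comparable_ideals[OF I[of x] \<delta>I \<delta>(1) I[of y]] by blast
    obtain e w w' where e: "\<delta> dvd e * (1 - e)" "\<delta> dvd e - u * w" "\<delta> dvd (1 - e) - v * w'"
      using idempotent_modulo[OF \<delta>(1) uv(1)] by blast
    define m where "m = e * x + (1 - e) * y"
    have "e * g i x \<in> I m" if i: "i \<in> S" for i
    proof -
      have "x - m = (1 - e) * (x - y)" by (simp add: m_def algebra_simps)
      then have "(1 - e) * (x - y) dvd g i x - g i m" using cong[OF i, of x m] by simp
      then have "e * ((1 - e) * (x - y)) dvd e * (g i x - g i m)" by (rule mult_dvd_mono[OF dvd_refl])
      moreover have "\<delta> dvd e * ((1 - e) * (x - y))" using dvd_mult2[OF e(1), of "x - y"] by (simp add: mult.assoc)
      ultimately have "\<delta> dvd e * g i x - e * g i m" by (metis dvd_trans right_diff_distrib)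
      then show ?thesis using mod is_ideal_mult[OF I gI[OF i]] by blast
    qed
    then have eI: "e * z \<in> I m" if "z \<in> I x" for z
      using least[OF is_ideal_vimage[OF I[of m]], of x e] that by blast
    have "(1 - e) * g i y \<in> I m" if i: "i \<in> S" for i
    proof -
      have "y - m = e * (y - x)" by (simp add: m_def algebra_simps)
      then have "e * (y - x) dvd g i y - g i m" using cong[OF i, of y m] by simp
      then have "(1 - e) * (e * (y - x)) dvd (1 - e) * (g i y - g i m)" by (rule mult_dvd_mono[OF dvd_refl])
      moreover have "\<delta> dvd (1 - e) * (e * (y - x))" using dvd_mult2[OF e(1), of "y - x"] by (simp add: mult_ac)
      ultimately have "\<delta> dvd (1 - e) * g i y - (1 - e) * g i m" by (metis dvd_trans right_diff_distrib)
      then show ?thesis using mod is_ideal_mult[OF I gI[OF i]] by blast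
    qed
    then have eI': "(1 - e) * z \<in> I m" if "z \<in> I y" for z
      using least[OF is_ideal_vimage[OF I[of m]], of y "1 - e"] that by blast
    have "z \<in> I m" if z: "z \<in> I x" for z
    proof -
      have "z - (e * z + w' * ((1 - e) * (v * z)))
          = (e * (1 - e)) * z + ((1 - e) - v * w') * ((1 - e) * z)" by (simp add: algebra_simps)
      then have "\<delta> dvd z - (e * z + w' * ((1 - e) * (v * z)))" using e(1,3) by simp
      then show ?thesis
        using mod is_ideal_add[OF I eI[OF z] is_ideal_mult[OF I eI'[OF uv(3)[OF z]]]] by blast
    qed
    moreover have "z \<in> I m" if z: "z \<in> I y" for z
    proof -
      have "z - ((1 - e) * z + w * (e * (u * z)))
          = (e * (1 - e)) * z + (e - u * w) * (e * z)" by (simp add: algebra_simps)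
      then have "\<delta> dvd z - ((1 - e) * z + w * (e * (u * z)))" using e(1,2) by simp
      then show ?thesis
        using mod is_ideal_add[OF I eI'[OF z] is_ideal_mult[OF I eI[OF uv(2)[OF z]]]] by blast
    qed
    ultimately show ?thesis by blast
  qed
  note upper = this
  have "range I \<noteq> {}" "\<And>J. J \<in> range I \<Longrightarrow> is_ideal J" using I by auto
  then have "\<exists>M\<in>range I. \<forall>I\<in>range I. M \<subseteq> I \<longrightarrow> I = M"
    by (rule noetherian_maximal[OF noeth])
  then obtain M where M: "M \<in> range I" and M2: "\<forall>J\<in>range I. M \<subseteq> J \<longrightarrow> J = M"
    by (rule bexE)
  obtain x where x: "M = I x" using M by (rule rangeE)
  have "I y \<subseteq> I x" for y
  proof -
    obtain m where m: "I x \<subseteq> I m" "I y \<subseteq> I m" using upper by blast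
    then have "I m = I x" using M2[rule_format, OF rangeI, of m] unfolding x by blast
    then show ?thesis using m(2) by simp
  qed
  then show ?thesis unfolding I_def by blast
qed

end

section \<open>Coefficients of products\<close>

lemma lookup_mult_in_ideal:
  fixes A B :: "'r::comm_ring_1 mpoly"
  assumes I: "is_ideal I" and *: "\<And>e1 e2. b * Poly_Mapping.lookup A e1 * Poly_Mapping.lookup B e2 \<in> I"
  shows "b * Poly_Mapping.lookup (A * B) e \<in> I"
proof -
  have "b * Poly_Mapping.lookup (A * B) e = (\<Sum>e1\<in>Poly_Mapping.keys A. \<Sum>e2\<in>Poly_Mapping.keys B.
      if e1 + e2 = e then b * Poly_Mapping.lookup A e1 * Poly_Mapping.lookup B e2 else 0)"
    by (simp add: mult_eq_sum_singles[of A B] lookup_sum sum_distrib_left lookup_single when_def if_distrib mult.assoc cong: if_cong)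
  also have "\<dots> \<in> I" using * is_ideal_zero[OF I] by (intro is_ideal_sum[OF I]) auto
  finally show ?thesis .
qed

text \<open>
  Each coefficient of a product is a sum of products of coefficients of the factors.  The factor \<open>b\<close> carries the
  coefficients that the induction has already chosen.
\<close>

lemma lookup_prod_in_ideal:
  fixes Q :: "nat \<Rightarrow> 'r::comm_ring_1 mpoly"
  assumes I: "is_ideal I"
    and "\<And>c. (\<And>i. i < s \<Longrightarrow> c i \<in> range (Poly_Mapping.lookup (Q i))) \<Longrightarrow> b * (\<Prod>i<s. c i) \<in> I"
  shows "b * Poly_Mapping.lookup (\<Prod>i<s. Q i) e \<in> I"
  using assms(2)
proof (induction s arbitrary: b e)
  case 0
  have "b \<in> I" using 0[of "\<lambda>_. 0"] by simp
  then show ?case using is_ideal_zero[OF I] by (simp add: lookup_one when_def)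
next
  case (Suc s)
  have "b * Poly_Mapping.lookup (\<Prod>i<s. Q i) e1 * Poly_Mapping.lookup (Q s) e2 \<in> I" for e1 e2
  proof -
    have "b * Poly_Mapping.lookup (Q s) e2 * Poly_Mapping.lookup (\<Prod>i<s. Q i) e1 \<in> I"
    proof (rule Suc.IH)
      fix c assume c: "\<And>i. i < s \<Longrightarrow> c i \<in> range (Poly_Mapping.lookup (Q i))"
      let ?c = "c(s := Poly_Mapping.lookup (Q s) e2)"
      have "b * (\<Prod>i<Suc s. ?c i) \<in> I" by (rule Suc.prems) (use c in \<open>auto simp: less_Suc_eq\<close>)
      moreover have "(\<Prod>i<s. ?c i) = (\<Prod>i<s. c i)" by (intro prod.cong) auto
      ultimately show "b * Poly_Mapping.lookup (Q s) e2 * (\<Prod>i<s. c i) \<in> I" by (simp add: mult_ac)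
    qed
    then show ?thesis by (simp add: mult_ac)
  qed
  then show ?case using lookup_mult_in_ideal[OF I] by simp
qed

text \<open>
  An element \<open>d i\<close> that lies in the ideal generated by the values \<open>x f\<close>, for every \<open>i\<close>, gives a product in the ideal generated by
  the products of values, in the same way as for \<open>lookup_prod_in_ideal\<close>.
\<close>

lemma prod_in_ideal:
  fixes x :: "'b \<Rightarrow> 'a::comm_ring_1" and s :: nat
  assumes I: "is_ideal I"
    and "\<forall>i<s. \<forall>J. is_ideal J \<longrightarrow> (\<forall>f\<in>C i. x f \<in> J) \<longrightarrow> d i \<in> J"
    and "\<forall>c. (\<forall>i<s. c i \<in> C i) \<longrightarrow> b * (\<Prod>i<s. x (c i)) \<in> I"
  shows "b * (\<Prod>i<s. d i) \<in> I"
  using assms(2,3)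
proof (induction s arbitrary: b)
  case 0
  then show ?case by simp
next
  case (Suc s)
  have "b * d s * (\<Prod>i<s. d i) \<in> I"
  proof (rule Suc.IH)
    show "\<forall>i<s. \<forall>J. is_ideal J \<longrightarrow> (\<forall>f\<in>C i. x f \<in> J) \<longrightarrow> d i \<in> J"
      using Suc.prems(1) by simp
    show "\<forall>c. (\<forall>i<s. c i \<in> C i) \<longrightarrow> b * d s * (\<Prod>i<s. x (c i)) \<in> I"
    proof (intro allI impI)
      fix c assume c: "\<forall>i<s. c i \<in> C i"
      let ?J = "{y. (b * (\<Prod>i<s. x (c i))) * y \<in> I}"
      have "x f \<in> ?J" if f: "f \<in> C s" for f
      proof -
        have "b * (\<Prod>i<Suc s. x ((c(s := f)) i)) \<in> I"
          by (rule Suc.prems(2)[rule_format]) (use c f in \<open>auto simp: less_Suc_eq\<close>)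
        moreover have "(\<Prod>i<s. x ((c(s := f)) i)) = (\<Prod>i<s. x (c i))" by (intro prod.cong) auto
        ultimately show ?thesis by (simp add: mult.assoc)
      qed
      then have "d s \<in> ?J"
        using Suc.prems(1)[rule_format, OF lessI is_ideal_vimage[OF I]] by blast
      then show "b * d s * (\<Prod>i<s. x (c i)) \<in> I" by (simp add: mult_ac)
    qed
  qed
  then show ?case by (simp add: mult_ac)
qed

lemma primitive_in_to_fract_iff:
  "primitive_in (mpolys k) (to_fract_mpoly2 P) \<longleftrightarrow>
     coprime_in (mpolys k) (to_fract_mpoly ` range (Poly_Mapping.lookup P))"
proof -
  have "Poly_Mapping.lookup (to_fract_mpoly2 P) e = to_fract_mpoly (Poly_Mapping.lookup P e)" for e
    by (simp add: to_fract_mpoly2_def map.rep_eq when_def)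
  then show ?thesis by (simp add: primitive_in_def image_image)
qed

lemma finite_range_lookup: "finite (range (Poly_Mapping.lookup P))"
proof -
  have "range (Poly_Mapping.lookup P) \<subseteq> insert 0 (Poly_Mapping.lookup P ` Poly_Mapping.keys P)"
    by (auto simp: in_keys_iff)
  then show ?thesis by (rule finite_subset) simp
qed

lemma coefficient_set:
  assumes "P \<in> mpolys2 k n \<and> P \<noteq> 0 \<and> primitive_in (mpolys k) (to_fract_mpoly2 P)"
  shows "finite (range (Poly_Mapping.lookup P))" "range (Poly_Mapping.lookup P) \<subseteq> mpolys k"
    "coprime_in (mpolys k) (to_fract_mpoly ` range (Poly_Mapping.lookup P))"
  using assms finite_range_lookup by (auto simp: primitive_in_to_fract_iff mpolys2_def)

text \<open>
  The ideal of \<open>lookup_prod_in_ideal\<close> is that of the polynomials whose value at \<open>m\<close> is divisible by \<open>p\<close>.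
\<close>

lemma nonvanishing_mod_of_no_fixed_prime:
  fixes P :: "nat \<Rightarrow> 'a::idom mpoly mpoly"
  assumes p: "prime_elem p" and fixed: "p \<notin> fixed_divisors (\<Prod>i<s. P i)"
  shows "\<exists>m. nonvanishing_mod s (\<lambda>i. range (Poly_Mapping.lookup (P i))) p m"
proof -
  obtain m e where me: "\<not> p dvd eval_mpoly m (Poly_Mapping.lookup (\<Prod>i<s. P i) e)"
    using fixed p by (auto simp: fixed_divisors_def divides_mpoly_def lookup_specialize prime_elem_def)
  let ?I = "{h. p dvd eval_mpoly m h}"
  have I: "is_ideal ?I" by (auto simp: is_ideal_def eval_add eval_mult)
  have "\<exists>c. (\<forall>i<s. c i \<in> range (Poly_Mapping.lookup (P i))) \<and> \<not> p dvd eval_mpoly m (\<Prod>i<s. c i)"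
  proof (rule ccontr)
    assume not: "\<not> ?thesis"
    have "1 * Poly_Mapping.lookup (\<Prod>i<s. P i) e \<in> ?I"
      by (rule lookup_prod_in_ideal[OF I]) (use not in auto)
    then show False using me by simp
  qed
  then obtain c where c: "\<And>i. i < s \<Longrightarrow> c i \<in> range (Poly_Mapping.lookup (P i))"
    "\<not> p dvd (\<Prod>i<s. eval_mpoly m (c i))" by (auto simp: eval_prod)
  have "\<not> p dvd eval_mpoly m (c i)" if "i < s" for i
    using c(2) that by (metis dvd_prodI dvd_trans finite_lessThan lessThan_iff)
  then show ?thesis unfolding nonvanishing_mod_def using c(1) by blast
qed

section \<open>The starred Primitive Specialization Hypothesis\<close>

text \<open>
  The exceptions in the progression are all zeros of \<open>P0\<close>, as a polynomial in the last variable; over a finite domain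
  there is nothing to show.
\<close>

lemma PriSpe_star_holds:
  fixes Z :: "'a::idom itself"
  assumes fp: "finitely_many_primes Z" and k: "k \<ge> 1"
  shows "PriSpe_star Z k s"
  unfolding PriSpe_star_def
proof (intro allI impI)
  fix n :: nat and P :: "nat \<Rightarrow> 'a mpoly mpoly" and P0 :: "'a mpoly"
  let ?bad = "\<lambda>m \<omega> \<alpha>. {x \<in> range (\<lambda>l. \<omega> * l + \<alpha>).
             \<not> ((\<forall>i<s. \<not> (\<exists>p. prime_elem p \<and>
                     divides_mpoly p (specialize (m(k - 1 := x)) (P i)))) \<and>
                eval_mpoly (m(k - 1 := x)) P0 \<noteq> 0)}"
  assume asm: "(\<forall>i<s. P i \<in> mpolys2 k n \<and> P i \<noteq> 0 \<and> primitive_in (mpolys k) (to_fract_mpoly2 (P i))) \<and>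
        \<not> (\<exists>p \<in> fixed_divisors (\<Prod>i<s. P i). prime_elem p) \<and> P0 \<in> mpolys k \<and> P0 \<noteq> 0"
  show "\<exists>m \<omega> \<alpha>. \<omega> \<noteq> 0 \<and> finite (?bad m \<omega> \<alpha>)"
  proof (cases "finite (UNIV :: 'a set)")
    case True
    then have "finite (?bad (\<lambda>_. 0) 1 0)" by (rule finite_subset[OF subset_UNIV])
    then show ?thesis using one_neq_zero by blast
  next
    case False
    obtain k' where k': "k = Suc k'" using k by (cases k) auto
    let ?C = "\<lambda>i. range (Poly_Mapping.lookup (P i))"
    have "\<exists>m \<omega>'. \<omega>' \<noteq> 0 \<and> (\<forall>j<Suc k'. 1 dvd m j - (\<lambda>_. 0::'a) j) \<and> 1 dvd \<omega>' \<and>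
     (\<forall>x p. \<omega>' dvd x - m k' \<longrightarrow> prime_elem p \<longrightarrow> nonvanishing_mod s ?C p (m(k' := x))) \<and>
     finite {x. eval_mpoly (m(k' := x)) P0 = 0}"
    proof (rule specialize_last_variable[OF False fp prime_free_specialization_holds[OF False fp]])
      fix i assume "i < s"
      then show "finite (?C i)" "?C i \<subseteq> mpolys (Suc k')"
          "coprime_in (mpolys (Suc k')) (to_fract_mpoly ` ?C i)"
        using coefficient_set[of "P i" k n] asm unfolding k' by blast+
    next
      fix p :: 'a assume p: "prime_elem p"
      then show "\<exists>m. nonvanishing_mod s ?C p m" using asm by (intro nonvanishing_mod_of_no_fixed_prime) auto
      show "nonvanishing_mod s ?C p (\<lambda>_. 0)" if "p dvd 1" using that p prime_elem_not_unit by blast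
    qed (use asm k' in auto)
    then obtain m \<omega> where m: "\<omega> \<noteq> 0"
      "\<And>x p. \<omega> dvd x - m k' \<Longrightarrow> prime_elem p \<Longrightarrow> nonvanishing_mod s ?C p (m(k' := x))"
      "finite {x. eval_mpoly (m(k' := x)) P0 = 0}" by blast
    have "?bad m \<omega> (m k') \<subseteq> {x. eval_mpoly (m(k' := x)) P0 = 0}"
    proof
      fix x assume x: "x \<in> ?bad m \<omega> (m k')"
      then have "\<omega> dvd x - m k'" by auto
      then have "\<not> divides_mpoly p (specialize (m(k' := x)) (P i))" if "i < s" "prime_elem p" for i p
        using m(2) that unfolding nonvanishing_mod_def divides_mpoly_def lookup_specialize by blast
      then show "x \<in> {x. eval_mpoly (m(k' := x)) P0 = 0}" using x k' by auto
    qed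
    then have "finite (?bad m \<omega> (m k'))" using m(3) by (rule finite_subset)
    then show ?thesis using m(1) by blast
  qed
qed

section \<open>Near UFDs\<close>

lemma near_UFD_finitely_many_primes:
  fixes Z :: "'a::idom itself"
  assumes "near_UFD Z"
  shows "finitely_many_primes Z"
  unfolding finitely_many_primes_def
proof (intro allI impI)
  fix x :: 'a assume "x \<noteq> 0"
  let ?cl = "\<lambda>p :: 'a. {u * p | u. u dvd 1}" and ?A = "{p. prime_elem p \<and> p dvd x}"
  have "finite (?cl ` ?A)" using assms \<open>x \<noteq> 0\<close> by (auto simp: near_UFD_def)
  from finite_subset_image[OF this subset_refl]
  obtain R where R: "R \<subseteq> ?A" "finite R" "?cl ` ?A = ?cl ` R"
    by (elim exE conjE) (rule that)
  have "\<exists>r\<in>R. r dvd p" if "prime_elem p" "p dvd x" for p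
  proof -
    have "?cl p \<in> ?cl ` R" unfolding R(3)[symmetric] using that by (intro imageI CollectI conjI)
    then obtain r where r: "?cl p = ?cl r" "r \<in> R" by (rule imageE)
    have "p \<in> ?cl p" by (auto intro!: exI[of _ 1])
    then have "r dvd p" unfolding r(1) by auto
    then show ?thesis using r(2) by blast
  qed
  then show "\<exists>R. finite R \<and> (\<forall>p\<in>R. prime_elem p) \<and> (\<forall>p. prime_elem p \<longrightarrow> p dvd x \<longrightarrow> (\<exists>r\<in>R. r dvd p))"
    using R by blast
qed

text \<open>
  A finite domain is a field, but in a near UFD the non-unit \<open>0\<close> has a prime divisor.
\<close>

lemma near_UFD_infinite:
  fixes Z :: "'a::idom itself"
  assumes "near_UFD Z"
  shows "infinite (UNIV :: 'a set)"
proof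
  assume fin: "finite (UNIV :: 'a set)"
  obtain p :: 'a where p: "prime_elem p" using assms unfolding near_UFD_def by (metis dvd_0_left_iff zero_neq_one)
  then have p0: "p \<noteq> 0" "\<not> p dvd 1" using prime_elem_not_unit by auto
  have "inj ((*) p)" using p0 by (auto simp: inj_on_def)
  then have "surj ((*) p)" using fin by (rule finite_UNIV_inj_surj[rotated])
  then show False using p0(2) by (metis dvd_triv_left surjD)
qed

text \<open>
  A common divisor that is not a unit has a prime divisor, and no prime divides all the values.
\<close>

lemma near_UFD_prime_free_specialization:
  fixes Z :: "'a::idom itself" and C :: "nat \<Rightarrow> 'a mpoly set"
  assumes Z: "near_UFD Z"
    and C: "\<And>i. i < s \<Longrightarrow> finite (C i)" "\<And>i. i < s \<Longrightarrow> C i \<subseteq> mpolys k"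
      "\<And>i. i < s \<Longrightarrow> coprime_in (mpolys k) (to_fract_mpoly ` C i)"
    and good: "\<And>p. prime_elem p \<Longrightarrow> \<exists>m. nonvanishing_mod s C p m"
  shows "\<exists>m. \<forall>i<s. coprime_in UNIV (eval_mpoly m ` C i)"
proof -
  have "\<exists>m. (\<forall>j<k. 1 dvd m j - (\<lambda>_. 0::'a) j) \<and> (\<forall>p. prime_elem p \<longrightarrow> nonvanishing_mod s C p m) \<and> eval_mpoly m 1 \<noteq> 0"
    by (rule prime_free_specialization_holds[OF near_UFD_infinite[OF Z] near_UFD_finitely_many_primes[OF Z],
        unfolded prime_free_specialization_def, rule_format])
      (use C good mpolys.one_mem in \<open>auto dest: prime_elem_not_unit\<close>)
  then obtain m where m: "\<And>p. prime_elem p \<Longrightarrow> nonvanishing_mod s C p m" by blast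
  have "coprime_in UNIV (eval_mpoly m ` C i)" if i: "i < s" for i
    unfolding coprime_in_def
  proof (intro ballI impI, rule ccontr)
    fix d assume d: "\<forall>x\<in>eval_mpoly m ` C i. \<exists>c\<in>UNIV. x = d * c" and "\<not> (\<exists>c\<in>UNIV. d * c = 1)"
    then have "\<not> d dvd 1" by (metis UNIV_I dvdE)
    then obtain p where p: "prime_elem p" "p dvd d" using Z unfolding near_UFD_def by blast
    then obtain f where "f \<in> C i" "\<not> p dvd eval_mpoly m f"
      using m i unfolding nonvanishing_mod_def by blast
    then show False using d p(2) by (metis dvd_mult2 imageI)
  qed
  then show ?thesis by blast
qed

lemma near_UFD_CopSch:
  fixes Z :: "'a::idom itself"
  assumes Z: "near_UFD Z"
  shows "CopSch Z k s"
  unfolding CopSch_def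
proof (intro allI impI)
  fix l :: "nat \<Rightarrow> nat" and P :: "nat \<Rightarrow> nat \<Rightarrow> 'a mpoly"
  assume asm: "(\<forall>i<s. l i \<ge> 2 \<and> (\<forall>j<l i. P i j \<in> mpolys k \<and> P i j \<noteq> 0) \<and>
           coprime_in (mpolys k) ((\<lambda>j. to_fract_mpoly (P i j)) ` {..<l i})) \<and>
        (\<forall>a. \<not> a dvd 1 \<longrightarrow> (\<exists>m. \<forall>i<s. \<not> (\<forall>j<l i. a dvd eval_mpoly m (P i j))))"
  have "\<exists>m. \<forall>i<s. coprime_in UNIV (eval_mpoly m ` (P i ` {..<l i}))"
  proof (rule near_UFD_prime_free_specialization[OF Z])
    fix p :: 'a assume "prime_elem p"
    then have "\<not> p dvd 1" using prime_elem_not_unit by blast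
    then show "\<exists>m. nonvanishing_mod s (\<lambda>i. P i ` {..<l i}) p m"
      using asm unfolding nonvanishing_mod_def by (metis imageI lessThan_iff)
  qed (use asm in \<open>auto simp: image_image\<close>)
  then show "\<exists>m. \<forall>i<s. coprime_in UNIV ((\<lambda>j. eval_mpoly m (P i j)) ` {..<l i})"
    by (simp add: image_image)
qed

lemma near_UFD_PriSpe:
  fixes Z :: "'a::idom itself"
  assumes Z: "near_UFD Z"
  shows "PriSpe Z k n s"
  unfolding PriSpe_def
proof (intro allI impI)
  fix P :: "nat \<Rightarrow> 'a mpoly mpoly"
  assume asm: "(\<forall>i<s. P i \<in> mpolys2 k n \<and> P i \<noteq> 0 \<and> primitive_in (mpolys k) (to_fract_mpoly2 (P i))) \<and>
        fixed_divisors (\<Prod>i<s. P i) = {}"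
  have "\<exists>m. \<forall>i<s. coprime_in UNIV (eval_mpoly m ` range (Poly_Mapping.lookup (P i)))"
  proof (rule near_UFD_prime_free_specialization[OF Z])
    fix p :: 'a assume "prime_elem p"
    then show "\<exists>m. nonvanishing_mod s (\<lambda>i. range (Poly_Mapping.lookup (P i))) p m"
      using asm by (intro nonvanishing_mod_of_no_fixed_prime) auto
  next
    fix i assume "i < s"
    then show "finite (range (Poly_Mapping.lookup (P i)))" "range (Poly_Mapping.lookup (P i)) \<subseteq> mpolys k"
        "coprime_in (mpolys k) (to_fract_mpoly ` range (Poly_Mapping.lookup (P i)))"
      using coefficient_set[of "P i" k n] asm by blast+
  qed
  then show "\<exists>m. \<forall>i<s. primitive_in UNIV (specialize m (P i))"
    by (simp add: primitive_in_def lookup_specialize image_image)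
qed

section \<open>Univariate specialization over Dedekind domains\<close>

context dedekind begin

lemma largest_value_ideal_mpoly:
  fixes F :: "'a mpoly set"
  assumes F: "F \<subseteq> mpolys 1" and \<delta>: "\<delta> \<noteq> 0" "\<And>m. \<delta> \<in> ideal_gen (eval_mpoly m ` F)"
  shows "\<exists>m. \<forall>m'. ideal_gen (eval_mpoly m' ` F) \<subseteq> ideal_gen (eval_mpoly m ` F)"
proof -
  have "\<exists>x. \<forall>y. ideal_gen ((\<lambda>f. eval_mpoly (\<lambda>_. y) f) ` F) \<subseteq> ideal_gen ((\<lambda>f. eval_mpoly (\<lambda>_. x) f) ` F)"
    by (rule largest_value_ideal[OF _ \<delta>]) (use F in \<open>auto intro: eval_cong\<close>)
  then obtain x where x: "\<And>y. ideal_gen (eval_mpoly (\<lambda>_. y) ` F) \<subseteq> ideal_gen (eval_mpoly (\<lambda>_. x) ` F)"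
    by blast
  have "eval_mpoly m' ` F = eval_mpoly (\<lambda>_. m' 0) ` F" for m'
    using F by (intro image_cong refl eval_mpoly_cong[of _ 1]) auto
  then show ?thesis using x by metis
qed

lemma univariate_eliminant:
  fixes C :: "'a mpoly set"
  assumes "C \<subseteq> mpolys 1" "coprime_in (mpolys 1) (to_fract_mpoly ` C)"
  shows "\<exists>d. d \<noteq> 0 \<and> (\<forall>m I. is_ideal I \<longrightarrow> (\<forall>f\<in>C. eval_mpoly m f \<in> I) \<longrightarrow> d \<in> I)"
proof -
  obtain \<delta> where \<delta>: "\<delta> \<in> mpolys 0" "\<delta> \<noteq> 0"
    "\<And>m I. is_ideal I \<Longrightarrow> (\<forall>f\<in>C. eval_mpoly m f \<in> I) \<Longrightarrow> eval_mpoly m \<delta> \<in> I"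
    using coprime_eliminant[of C 0] assms by auto
  obtain d where d: "\<delta> = Poly_Mapping.single 0 d" using mpolys_0E[OF \<delta>(1)] .
  then show ?thesis using \<delta> by (intro exI[of _ d]) auto
qed

lemma PriSpe_holds: "PriSpe Z 1 n s"
  unfolding PriSpe_def
proof (intro allI impI)
  fix P :: "nat \<Rightarrow> 'a mpoly mpoly"
  assume asm: "(\<forall>i<s. P i \<in> mpolys2 1 n \<and> P i \<noteq> 0 \<and> primitive_in (mpolys 1) (to_fract_mpoly2 (P i))) \<and>
        fixed_divisors (\<Prod>i<s. P i) = {}"
  let ?C = "\<lambda>i. range (Poly_Mapping.lookup (P i))"
  have C: "?C i \<subseteq> mpolys 1" "coprime_in (mpolys 1) (to_fract_mpoly ` ?C i)" if "i < s" for i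
    using coefficient_set[of "P i" 1 n] asm that by blast+
  have "\<forall>i\<in>{..<s}. \<exists>d. d \<noteq> 0 \<and> (\<forall>m I. is_ideal I \<longrightarrow> (\<forall>f\<in>?C i. eval_mpoly m f \<in> I) \<longrightarrow> d \<in> I)"
    using univariate_eliminant[OF C] by simp
  then obtain d where
    "\<forall>i\<in>{..<s}. d i \<noteq> 0 \<and> (\<forall>m I. is_ideal I \<longrightarrow> (\<forall>f\<in>?C i. eval_mpoly m f \<in> I) \<longrightarrow> d i \<in> I)"
    by (rule bchoice[THEN exE])
  then have d: "\<And>i. i < s \<Longrightarrow> d i \<noteq> 0"
    "\<And>m. \<forall>i<s. \<forall>I. is_ideal I \<longrightarrow> (\<forall>f\<in>?C i. eval_mpoly m f \<in> I) \<longrightarrow> d i \<in> I"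
    by simp_all
  \<comment> \<open>The ideal generated by the values of \<open>F\<close> is the product of the content ideals of the specialized \<open>P i\<close>.\<close>
  define F where "F = {\<Prod>i<s. c i | c. \<forall>i<s. c i \<in> ?C i}"
  have "F \<subseteq> mpolys 1" unfolding F_def using C(1) by (fastforce intro: mpolys.prod_mem)
  moreover have "(\<Prod>i<s. d i) \<noteq> 0" using d(1) by simp
  moreover have "(\<Prod>i<s. d i) \<in> ideal_gen (eval_mpoly m ` F)" for m
  proof -
    have "1 * (\<Prod>i<s. d i) \<in> ideal_gen (eval_mpoly m ` F)"
    proof (rule prod_in_ideal[OF is_ideal_gen d(2)], intro allI impI)
      fix c assume "\<forall>i<s. c i \<in> ?C i"
      then have "(\<Prod>i<s. c i) \<in> F" unfolding F_def by blast
      then have "eval_mpoly m (\<Prod>i<s. c i) \<in> ideal_gen (eval_mpoly m ` F)"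
        by (intro subsetD[OF ideal_gen_superset] imageI)
      then show "1 * (\<Prod>i<s. eval_mpoly m (c i)) \<in> ideal_gen (eval_mpoly m ` F)"
        by (simp add: eval_prod)
    qed
    then show ?thesis by simp
  qed
  ultimately obtain m where m: "\<And>m'. ideal_gen (eval_mpoly m' ` F) \<subseteq> ideal_gen (eval_mpoly m ` F)"
    using largest_value_ideal_mpoly by blast
  have "primitive_in UNIV (specialize m (P i))" if i: "i < s" for i
  proof (rule ccontr)
    assume "\<not> ?thesis"
    then obtain a where unit: "\<not> (\<exists>c. a * c = 1)" and a: "\<And>e. \<exists>c. eval_mpoly m (Poly_Mapping.lookup (P i) e) = a * c"
      unfolding primitive_in_def coprime_in_def by (auto simp: lookup_specialize)
    have dvd: "a dvd eval_mpoly m f" if f: "f \<in> ?C i" for f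
    proof -
      obtain e where "f = Poly_Mapping.lookup (P i) e" using f by (rule rangeE)
      then show ?thesis using a by (metis dvd_triv_left)
    qed
    have "d i \<in> {y. a dvd y}" using d(2)[rule_format, OF i is_ideal_multiples, of m a] dvd by blast
    then have a0: "a \<noteq> 0" using d(1)[OF i] by auto
    have "a dvd eval_mpoly m g" if "g \<in> F" for g
    proof -
      obtain c where c: "g = (\<Prod>i<s. c i)" "\<forall>i<s. c i \<in> ?C i" using \<open>g \<in> F\<close> unfolding F_def by blast
      have "eval_mpoly m (c i) dvd eval_mpoly m g" unfolding c(1) eval_prod using i by (intro dvd_prodI) auto
      then show ?thesis using dvd[of "c i"] c(2) i dvd_trans by blast
    qed
    then have sub: "ideal_gen (eval_mpoly m ` F) \<subseteq> {y. a dvd y}"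
      by (intro ideal_gen_least is_ideal_multiples) auto
    have fixed: "a dvd eval_mpoly m' g" if g: "g \<in> F" for m' g
    proof -
      have "eval_mpoly m' g \<in> ideal_gen (eval_mpoly m' ` F)"
        using g by (intro subsetD[OF ideal_gen_superset] imageI)
      then show ?thesis using m[of m'] sub by (auto dest: subsetD)
    qed
    have "a dvd eval_mpoly m' (Poly_Mapping.lookup (\<Prod>i<s. P i) e)" for m' e
    proof -
      have "is_ideal {h. a dvd eval_mpoly m' h}" by (auto simp: is_ideal_def eval_add eval_mult)
      then have "1 * Poly_Mapping.lookup (\<Prod>i<s. P i) e \<in> {h. a dvd eval_mpoly m' h}"
        by (rule lookup_prod_in_ideal) (use fixed in \<open>auto simp: F_def\<close>)
      then show ?thesis by simp
    qed
    moreover have "\<not> a dvd 1" using unit by (metis dvdE)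
    ultimately have "a \<in> fixed_divisors (\<Prod>i<s. P i)"
      using a0 by (simp add: fixed_divisors_def divides_mpoly_def lookup_specialize)
    then show False using asm by blast
  qed
  then show "\<exists>m. \<forall>i<s. primitive_in UNIV (specialize m (P i))" by blast
qed

lemma CopSch_holds: "CopSch Z 1 1"
  unfolding CopSch_def
proof (intro allI impI)
  fix l :: "nat \<Rightarrow> nat" and P :: "nat \<Rightarrow> nat \<Rightarrow> 'a mpoly"
  assume asm: "(\<forall>i<1. l i \<ge> 2 \<and> (\<forall>j<l i. P i j \<in> mpolys 1 \<and> P i j \<noteq> 0) \<and>
           coprime_in (mpolys 1) ((\<lambda>j. to_fract_mpoly (P i j)) ` {..<l i})) \<and>
        (\<forall>a. \<not> a dvd 1 \<longrightarrow> (\<exists>m. \<forall>i<1. \<not> (\<forall>j<l i. a dvd eval_mpoly m (P i j))))"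
  define F where "F = P 0 ` {..<l 0}"
  have F: "F \<subseteq> mpolys 1" "coprime_in (mpolys 1) (to_fract_mpoly ` F)"
    using asm by (auto simp: F_def image_image)
  obtain d where d: "d \<noteq> 0" "\<And>m I. is_ideal I \<Longrightarrow> \<forall>f\<in>F. eval_mpoly m f \<in> I \<Longrightarrow> d \<in> I"
    using univariate_eliminant[OF F] by blast
  have "d \<in> ideal_gen (eval_mpoly m ` F)" for m
    by (rule d(2)[of _ m, OF is_ideal_gen]) (intro ballI subsetD[OF ideal_gen_superset] imageI)
  then obtain m where m: "\<And>m'. ideal_gen (eval_mpoly m' ` F) \<subseteq> ideal_gen (eval_mpoly m ` F)"
    using largest_value_ideal_mpoly[OF F(1) d(1)] by blast
  have "coprime_in UNIV ((\<lambda>j. eval_mpoly m (P 0 j)) ` {..<l 0})"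
    unfolding coprime_in_def
  proof (intro ballI impI, rule ccontr)
    fix a assume a: "\<forall>x\<in>(\<lambda>j. eval_mpoly m (P 0 j)) ` {..<l 0}. \<exists>c\<in>UNIV. x = a * c"
      and unit: "\<not> (\<exists>c\<in>UNIV. a * c = 1)"
    have "eval_mpoly m ` F \<subseteq> {y. a dvd y}" using a by (auto simp: F_def dvd_def)
    then have sub: "ideal_gen (eval_mpoly m ` F) \<subseteq> {y. a dvd y}"
      by (intro ideal_gen_least is_ideal_multiples)
    have "a dvd eval_mpoly m' (P 0 j)" if "j < l 0" for m' j
    proof -
      have "eval_mpoly m' (P 0 j) \<in> eval_mpoly m' ` F" using that by (auto simp: F_def)
      then have "eval_mpoly m' (P 0 j) \<in> ideal_gen (eval_mpoly m' ` F)" by (rule subsetD[OF ideal_gen_superset])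
      then show ?thesis using m[of m'] sub by (auto dest: subsetD)
    qed
    moreover have "\<not> a dvd 1" using unit by (metis UNIV_I dvdE)
    ultimately show False using asm by force
  qed
  then show "\<exists>m. \<forall>i<1. coprime_in UNIV ((\<lambda>j. eval_mpoly m (P i j)) ` {..<l i})" by auto
qed

end

theorem theorem3p7:
  fixes Z :: "'a::idom itself"
  shows "(near_UFD Z \<or> dedekind_domain Z \<longrightarrow>
            (\<forall>k\<ge>1. \<forall>s\<ge>1. PriSpe_star Z k s)) \<and>
         (near_UFD Z \<longrightarrow>
            (\<forall>k\<ge>1. \<forall>s\<ge>1. CopSch Z k s) \<and>
            (\<forall>k\<ge>1. \<forall>n\<ge>1. \<forall>s\<ge>1. PriSpe Z k n s)) \<and>
         (dedekind_domain Z \<longrightarrow>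
            (\<forall>n\<ge>1. \<forall>s\<ge>1. PriSpe Z 1 n s) \<and> CopSch Z 1 1)"
proof -
  have "finitely_many_primes Z" if "near_UFD Z \<or> dedekind_domain Z"
    using that near_UFD_finitely_many_primes noetherian_finitely_many_primes[of Z]
    by (auto simp: dedekind_domain_def)
  moreover have "PriSpe Z 1 n s" "CopSch Z 1 1" if "dedekind_domain Z" for n s
    using dedekind.PriSpe_holds dedekind.CopSch_holds that by (auto simp: dedekind_def)
  ultimately show ?thesis
    using PriSpe_star_holds near_UFD_CopSch near_UFD_PriSpe by blast
qed

end
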